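(* Let $\alpha>0$. Let $\mathcal{T}^2_{(\alpha)}:=\mathcal{C}_\alpha(L_2(\mathbb{R}^+))$ and $H^2_{(\alpha)}(\mathbb{C}^+):=\mathcal{L}(\mathcal{T}^2_{(\alpha)})$, with the Hilbert space structures given in the context. Let $R_\alpha$ be the reproducing kernel of $H^2_{(\alpha)}(\mathbb{C}^+)$ and $K_\alpha$ the reproducing kernel of $H_2^{(\alpha)}(\mathbb{C}^+)$. Then $R_\alpha(z,w)=K_\alpha(z,w)$ for all $z,w\in\mathbb{C}^+$; consequently the spaces $H^2_{(\alpha)}(\mathbb{C}^+)$ and $H_2^{(\alpha)}(\mathbb{C}^+)$ are the same, and so are $$\mathcal{T}_2^{(\alpha)}(t^\alpha)=\mathcal{C}_\alpha(L_2(\mathbb{R}^+))=\mathcal{T}^2_{(\alpha)}.$$ In particular, the norms $f\mapsto\Gamma(\alpha+1)\|\mathcal{C}_\alpha^{-1}f\|_{L_2(\mathbb{R}^+)}$ and $f\mapsto\|t^\alpha W^\alpha f\|_{L_2(\mathbb{R}^+)}$ are equivalent on $\mathcal{T}^2_{(\alpha)}$.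
   Context: $\mathbb{R}^+=(0,\infty)$, $\mathbb{C}^+=\{z\in\mathbb{C}:\Re z>0\}$, $\mathcal{L}f(z)=\int_0^\infty f(t)e^{-zt}\,dt$. On $L_2(\mathbb{R}^+)$ the operators $\mathcal{C}_\alpha f(s)=\frac{\alpha}{s^\alpha}\int_0^s(s-u)^{\alpha-1}f(u)\,du$ and $\mathcal{C}_\alpha^*f(s)=\alpha\int_s^\infty\frac{(u-s)^{\alpha-1}}{u^\alpha}f(u)\,du$ are bounded and injective. $\mathcal{T}_2^{(\alpha)}(t^\alpha):=\mathcal{C}_\alpha^*(L_2(\mathbb{R}^+))$; for $f$ in it, $W^\alpha f(t):=\Gamma(\alpha+1)t^{-\alpha}[(\mathcal{C}_\alpha^* )^{-1}f](t)$, and $\|f\|_{2,(\alpha)}=\|t^\alpha W^\alpha f\|_{L_2(\mathbb{R}^+)}=\Gamma(\alpha+1)\|(\mathcal{C}_\alpha^* )^{-1}f\|_{L_2(\mathbb{R}^+)}$. $\mathcal{T}^2_{(\alpha)}=\mathcal{C}_\alpha(L_2(\mathbb{R}^+))$ has inner product $(f|g)_{(\alpha),2}=\Gamma(\alpha+1)^2\int_0^\infty(\mathcal{C}_\alpha^{-1}f)(s)\overline{(\mathcal{C}_\alpha^{-1}g)(s)}\,ds$, and $H^2_{(\alpha)}(\mathbb{C}^+)$ has the transported inner product $(\mathcal{L}f|\mathcal{L}g)_{(\alpha),2}:=(f|g)_{(\alpha),2}$. (In the paper the norm $\Gamma(\alpha+1)\|\mathcal{C}_\alpha^{-1}f\|_2$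 is also written $\|\mathcal{D}^\alpha(\tau_\alpha f)\|_2$, where $\tau_\alpha f(t)=t^\alpha f(t)$ and $\mathcal{D}^\alpha$ is the Riemann–Liouville fractional derivative, the inverse of $\mathcal{D}^{-\alpha}h(x)=\frac{1}{\Gamma(\alpha)}\int_0^x(x-y)^{\alpha-1}h(y)\,dy$ on $L_2(\mathbb{R}^+)$.) $H_2(\mathbb{C}^+)$ is the Hardy space of holomorphic $F$ on $\mathbb{C}^+$ with $\|F\|_2:=\sup_{x>0}\left(\frac{1}{2\pi}\int_{-\infty}^\infty|F(x+iy)|^2dy\right)^{1/2}<\infty$. With $T_2(t)F(z)=e^{-t/2}F(e^{-t}z)$, put $\mathfrak{C}_\alpha^*F:=\int_0^\infty\alpha(1-e^{-t})^{\alpha-1}e^{-t/2}\,T_2(-t)F\,dt$ (Bochner integral), a bounded injective operator on $H_2(\mathbb{C}^+)$; $H_2^{(\alpha)}(\mathbb{C}^+):=\mathfrak{C}_\alpha^*(H_2(\mathbb{C}^+))$ with norm $\|F\|_{2,(\alpha)}:=\Gamma(\alpha+1)\|(\mathfrak{C}_\alpha^* )^{-1}F\|_2$. Both $H^2_{(\alpha)}(\mathbb{C}^+)$ and $H_2^{(\alpha)}(\mathbb{C}^+)$ are continuously included in $H_2(\mathbb{C}^+)$ and hence are reproducing kernel Hilbert spaces. The reproducing kernel $K$ of such a space $H$ satisfies $K(\cdot,w)\in H$ and $F(w)=(F|K(\cdot,w))_H$ for all $F\in H$, $w\in\mathbb{C}^+$. *)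

theory Defs
  imports "HOL-Complex_Analysis.Complex_Analysis"
begin

section \<open>The space of square-integrable functions on the positive half-line\<close>

text \<open>
  Elements of the Lebesgue space are represented by complex-valued Borel functions, and equality
  in that space is equality almost everywhere. All subspaces introduced below are sets of
  representatives that are closed under almost everywhere equality of Borel functions on the
  half-line, so that equality of sets is equality of the corresponding spaces of classes.
\<close>

definition Rplus :: "real measure" where
  "Rplus = restrict_space lborel {0<..}"

definition L2 :: "(real \<Rightarrow> complex) set" where
  "L2 = {f \<in> borel_measurable Rplus. integrable Rplus (\<lambda>s. (cmod (f s))\<^sup>2)}"

definition L2_norm :: "(real \<Rightarrow> complex) \<Rightarrow> real" where
  "L2_norm f = sqrt (LINT s|Rplus. (cmod (f s))\<^sup>2)"

definition L2_inner :: "(real \<Rightarrow> complex) \<Rightarrow> (real \<Rightarrow> complex) \<Rightarrow> complex" where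
  "L2_inner f g = (LINT s|Rplus. f s * cnj (g s))"

definition L2_range :: "((real \<Rightarrow> complex) \<Rightarrow> real \<Rightarrow> complex) \<Rightarrow> (real \<Rightarrow> complex) set" where
  "L2_range A = {g \<in> L2. \<exists>f\<in>L2. AE s in Rplus. g s = A f s}"

text \<open>
  For an injective operator the chosen preimage is determined up to almost everywhere equality,
  and it is only ever used under integrals over the half-line.
\<close>

definition L2_inv :: "((real \<Rightarrow> complex) \<Rightarrow> real \<Rightarrow> complex) \<Rightarrow> (real \<Rightarrow> complex) \<Rightarrow> real \<Rightarrow> complex" where
  "L2_inv A g = (SOME f. f \<in> L2 \<and> (AE s in Rplus. g s = A f s))"

section \<open>The generalized Cesaro operators and their ranges\<close>

text \<open>
  For square-integrable \<open>f\<close> and small \<open>\<alpha>\<close> the integrals below need converge for almost every \<open>s\<close>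
  only; elsewhere the library's convention makes them \<open>0\<close>.
\<close>

definition cesaro :: "real \<Rightarrow> (real \<Rightarrow> complex) \<Rightarrow> real \<Rightarrow> complex" where
  "cesaro \<alpha> f s =
     (\<alpha> / s powr \<alpha>) *\<^sub>R (LINT u:{0<..<s}|lborel. ((s - u) powr (\<alpha> - 1)) *\<^sub>R f u)"

definition cesaro_adj :: "real \<Rightarrow> (real \<Rightarrow> complex) \<Rightarrow> real \<Rightarrow> complex" where
  "cesaro_adj \<alpha> f s =
     \<alpha> *\<^sub>R (LINT u:{s<..}|lborel. ((u - s) powr (\<alpha> - 1) / u powr \<alpha>) *\<^sub>R f u)"

text \<open>\<open>T_lower \<alpha>\<close> is $\mathcal{T}^2_{(\alpha)}$ and \<open>T_upper \<alpha>\<close> is $\mathcal{T}_2^{(\alpha)}(t^\alpha)$.\<close>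

definition T_lower :: "real \<Rightarrow> (real \<Rightarrow> complex) set" where
  "T_lower \<alpha> = L2_range (cesaro \<alpha>)"

definition T_lower_inner :: "real \<Rightarrow> (real \<Rightarrow> complex) \<Rightarrow> (real \<Rightarrow> complex) \<Rightarrow> complex" where
  "T_lower_inner \<alpha> f g =
     (Gamma (\<alpha> + 1))\<^sup>2 *\<^sub>R L2_inner (L2_inv (cesaro \<alpha>) f) (L2_inv (cesaro \<alpha>) g)"

definition T_lower_norm :: "real \<Rightarrow> (real \<Rightarrow> complex) \<Rightarrow> real" where
  "T_lower_norm \<alpha> f = Gamma (\<alpha> + 1) * L2_norm (L2_inv (cesaro \<alpha>) f)"

definition T_upper :: "real \<Rightarrow> (real \<Rightarrow> complex) set" where
  "T_upper \<alpha> = L2_range (cesaro_adj \<alpha>)"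

definition weyl :: "real \<Rightarrow> (real \<Rightarrow> complex) \<Rightarrow> real \<Rightarrow> complex" where
  "weyl \<alpha> f t = (Gamma (\<alpha> + 1) * t powr (- \<alpha>)) *\<^sub>R L2_inv (cesaro_adj \<alpha>) f t"

definition T_upper_norm :: "real \<Rightarrow> (real \<Rightarrow> complex) \<Rightarrow> real" where
  "T_upper_norm \<alpha> f = L2_norm (\<lambda>t. (t powr \<alpha>) *\<^sub>R weyl \<alpha> f t)"

section \<open>Function spaces on the right half-plane\<close>

text \<open>
  A function on the right half-plane is represented by a function on all of the complex plane
  whose values outside the half-plane are irrelevant: every space below is closed under changing
  its members outside the half-plane.
\<close>

definition Cplus :: "complex set" where
  "Cplus = {z. 0 < Re z}"

definition laplace :: "(real \<Rightarrow> complex) \<Rightarrow> complex \<Rightarrow> complex" where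
  "laplace f z = (LINT t|Rplus. f t * exp (- (z * complex_of_real t)))"

definition H_lower :: "real \<Rightarrow> (complex \<Rightarrow> complex) set" where
  "H_lower \<alpha> = {F. \<exists>f\<in>T_lower \<alpha>. \<forall>z\<in>Cplus. F z = laplace f z}"

definition laplace_inv :: "real \<Rightarrow> (complex \<Rightarrow> complex) \<Rightarrow> real \<Rightarrow> complex" where
  "laplace_inv \<alpha> F = (SOME f. f \<in> T_lower \<alpha> \<and> (\<forall>z\<in>Cplus. F z = laplace f z))"

definition H_lower_inner :: "real \<Rightarrow> (complex \<Rightarrow> complex) \<Rightarrow> (complex \<Rightarrow> complex) \<Rightarrow> complex" where
  "H_lower_inner \<alpha> F G = T_lower_inner \<alpha> (laplace_inv \<alpha> F) (laplace_inv \<alpha> G)"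

definition line_norm :: "(complex \<Rightarrow> complex) \<Rightarrow> real \<Rightarrow> real" where
  "line_norm F x = sqrt (1 / (2 * pi) * (LINT y|lborel. (cmod (F (Complex x y)))\<^sup>2))"

definition hardy :: "(complex \<Rightarrow> complex) set" where
  "hardy = {F. F holomorphic_on Cplus \<and>
               (\<forall>x>0. integrable lborel (\<lambda>y. (cmod (F (Complex x y)))\<^sup>2)) \<and>
               bdd_above (line_norm F ` {0<..})}"

definition hardy_norm :: "(complex \<Rightarrow> complex) \<Rightarrow> real" where
  "hardy_norm F = (SUP x\<in>{0<..}. line_norm F x)"

definition dilation :: "real \<Rightarrow> (complex \<Rightarrow> complex) \<Rightarrow> complex \<Rightarrow> complex" where
  "dilation t F z = complex_of_real (exp (- t / 2)) * F (complex_of_real (exp (- t)) * z)"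

text \<open>
  The Bochner integral over the half-line of functions with values in the Hardy space. The Hardy
  space is not a type of class \<^class>\<open>banach\<close>, hence the definition is spelled out as in the
  library: approximation by integrable simple functions, in the integrated norm.
\<close>

definition hardy_simple_integrable :: "(real \<Rightarrow> complex \<Rightarrow> complex) \<Rightarrow> bool" where
  "hardy_simple_integrable s \<longleftrightarrow>
     simple_function Rplus s \<and> (\<forall>t\<in>space Rplus. s t \<in> hardy) \<and>
     emeasure Rplus {t \<in> space Rplus. s t \<noteq> (\<lambda>_. 0)} \<noteq> \<infinity>"

definition hardy_simple_integral :: "(real \<Rightarrow> complex \<Rightarrow> complex) \<Rightarrow> complex \<Rightarrow> complex" where
  "hardy_simple_integral s z =
     (\<Sum>G\<in>s ` space Rplus. measure Rplus {t \<in> space Rplus. s t = G} *\<^sub>R G z)"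

definition has_hardy_integral :: "(real \<Rightarrow> complex \<Rightarrow> complex) \<Rightarrow> (complex \<Rightarrow> complex) \<Rightarrow> bool" where
  "has_hardy_integral \<phi> G \<longleftrightarrow>
     G \<in> hardy \<and> (\<forall>t\<in>space Rplus. \<phi> t \<in> hardy) \<and>
     (\<exists>s. (\<forall>n::nat. hardy_simple_integrable (s n)) \<and>
          (\<forall>n. (\<lambda>t. hardy_norm (\<lambda>z. \<phi> t z - s n t z)) \<in> borel_measurable Rplus) \<and>
          (\<lambda>n. \<integral>\<^sup>+t. ennreal (hardy_norm (\<lambda>z. \<phi> t z - s n t z)) \<partial>Rplus) \<longlonglongrightarrow> 0 \<and>
          (\<lambda>n. hardy_norm (\<lambda>z. hardy_simple_integral (s n) z - G z)) \<longlonglongrightarrow> 0)"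

definition hardy_integral :: "(real \<Rightarrow> complex \<Rightarrow> complex) \<Rightarrow> complex \<Rightarrow> complex" where
  "hardy_integral \<phi> = (SOME G. has_hardy_integral \<phi> G)"

definition hardy_cesaro_adj :: "real \<Rightarrow> (complex \<Rightarrow> complex) \<Rightarrow> complex \<Rightarrow> complex" where
  "hardy_cesaro_adj \<alpha> F =
     hardy_integral (\<lambda>t z. (\<alpha> * (1 - exp (- t)) powr (\<alpha> - 1) * exp (- t / 2)) *\<^sub>R dilation (- t) F z)"

definition H_upper :: "real \<Rightarrow> (complex \<Rightarrow> complex) set" where
  "H_upper \<alpha> = {F. \<exists>G\<in>hardy. \<forall>z\<in>Cplus. F z = hardy_cesaro_adj \<alpha> G z}"

definition hardy_cesaro_adj_inv :: "real \<Rightarrow> (complex \<Rightarrow> complex) \<Rightarrow> complex \<Rightarrow> complex" where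
  "hardy_cesaro_adj_inv \<alpha> F =
     (SOME G. G \<in> hardy \<and> (\<forall>z\<in>Cplus. F z = hardy_cesaro_adj \<alpha> G z))"

definition H_upper_norm :: "real \<Rightarrow> (complex \<Rightarrow> complex) \<Rightarrow> real" where
  "H_upper_norm \<alpha> F = Gamma (\<alpha> + 1) * hardy_norm (hardy_cesaro_adj_inv \<alpha> F)"

text \<open>
  The Hilbert space structure of \<open>H_upper \<alpha>\<close> is given through its norm; its inner product, linear
  in the first argument, is recovered from the norm by polarization.
\<close>

definition polarization ::
    "((complex \<Rightarrow> complex) \<Rightarrow> real) \<Rightarrow> (complex \<Rightarrow> complex) \<Rightarrow> (complex \<Rightarrow> complex) \<Rightarrow> complex" where
  "polarization N F G =
     (\<Sum>k<4. \<i> ^ k * complex_of_real ((N (\<lambda>z. F z + \<i> ^ k * G z))\<^sup>2)) / 4"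

definition H_upper_inner :: "real \<Rightarrow> (complex \<Rightarrow> complex) \<Rightarrow> (complex \<Rightarrow> complex) \<Rightarrow> complex" where
  "H_upper_inner \<alpha> = polarization (H_upper_norm \<alpha>)"

definition reproducing_kernel ::
    "(complex \<Rightarrow> complex) set \<Rightarrow> ((complex \<Rightarrow> complex) \<Rightarrow> (complex \<Rightarrow> complex) \<Rightarrow> complex) \<Rightarrow>
     (complex \<Rightarrow> complex \<Rightarrow> complex) \<Rightarrow> bool" where
  "reproducing_kernel H ip K \<longleftrightarrow>
     (\<forall>w\<in>Cplus. (\<lambda>z. K z w) \<in> H \<and> (\<forall>F\<in>H. F w = ip F (\<lambda>z. K z w)))"

end

theory Submission
  imports Defs "HOL-Probability.Sinc_Integral"
begin

text \<open>
  On square-integrable functions the Cesaro operator \<open>C\<close> and its adjoint \<open>C*\<close> are averages of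
  dilations. Dilations commute, so \<open>C\<close> is normal and \<open>C h\<close>, \<open>C* h\<close> have equal norms; by the
  Riesz representation theorem this makes the ranges of \<open>C\<close> and \<open>C*\<close> coincide, with equal norms.

  The Laplace transform is an isometry of the square-integrable functions onto the Hardy space.
  Finite sums of exponentials are dense by Lerch's theorem, the isometry on them is a Gram matrix
  computation for Cauchy kernels on a vertical line, and surjectivity follows by representing the
  functional that sends an exponential \<open>exp (- a t)\<close> to the conjugate of \<open>G a\<close>, which is bounded by
  Cauchy's integral formula in the half-plane.

  The Laplace transform intertwines \<open>C\<close> with the operator defining \<open>H_upper\<close>. Hence both spaces
  consist of the transforms of the functions \<open>C f\<close>, with the same inner product.
\<close>


section \<open>Square-integrable functions\<close>

text \<open>Dilating a transform by \<open>exp t\<close> in the half-plane dilates the function by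
  \<open>exp (- t)\<close> on the half-line. The operator called adjoint on the Hardy space is
  therefore the image of \<open>cesaro\<close>, and not of \<open>cesaro_adj\<close>, under the
  Laplace transform. This alone identifies \<open>H_upper\<close> with \<open>H_lower\<close>;
  normality is what compares \<open>T_upper\<close> with \<open>T_lower\<close>. All inverses and
  the Hardy-valued integral are choices by \<open>SOME\<close>. Before a norm or an inner product
  can be evaluated, a witness must be exhibited and be shown to be unique up to the relevant
  equality, which is equality almost everywhere on the half-line or equality on
  \<open>Cplus\<close>. Existence of the integral requires an explicit approximation by simple
  functions, and uniqueness of preimages rests on injectivity of the Laplace transform on positive
  reals. The kernel is explicit: evaluation at \<open>w\<close> pairs
  \<open>cesaro \<alpha> f\<close> with an exponential, and moving the operator across shows that
  the kernel at \<open>w\<close> is the transform of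
  \<open>cesaro \<alpha> (cesaro_adj \<alpha> e)\<close>, where \<open>e\<close> is that
  exponential, up to the Gamma factor.\<close>

definition sq_int :: "'a measure \<Rightarrow> ('a \<Rightarrow> complex) \<Rightarrow> bool" where
  "sq_int M f \<longleftrightarrow> f \<in> borel_measurable M \<and> integrable M (\<lambda>x. (cmod (f x))\<^sup>2)"

text \<open>The measure is a parameter because the theory is applied to \<open>Rplus\<close> and, on
  vertical lines, to \<open>lborel\<close>.\<close>

definition norm2 :: "'a measure \<Rightarrow> ('a \<Rightarrow> complex) \<Rightarrow> real" where
  "norm2 M f = sqrt (LINT x|M. (cmod (f x))\<^sup>2)"

definition inner2 :: "'a measure \<Rightarrow> ('a \<Rightarrow> complex) \<Rightarrow> ('a \<Rightarrow> complex) \<Rightarrow> complex" where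
  "inner2 M f g = (LINT x|M. f x * cnj (g x))"

lemma borel_measurable_cnj [measurable (raw)]:
  assumes "f \<in> borel_measurable M"
  shows "(\<lambda>x. cnj (f x)) \<in> borel_measurable M"
  using measurable_compose[OF assms borel_measurable_continuous_onI[OF continuous_on_cnj[OF continuous_on_id]]]
  by simp

lemma norm2_nonneg [simp]: "0 \<le> norm2 M f"
  by (simp add: norm2_def)

lemma norm2_power2: "(norm2 M f)\<^sup>2 = (LINT x|M. (cmod (f x))\<^sup>2)"
  by (simp add: norm2_def)

lemma nn_integral_sq_int:
  assumes "sq_int M f"
  shows "(\<integral>\<^sup>+x. ennreal ((cmod (f x))\<^sup>2) \<partial>M) = ennreal ((norm2 M f)\<^sup>2)"
  using assms unfolding norm2_power2 sq_int_def
  by (intro nn_integral_eq_integral) auto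

text \<open>An extended integral makes sense before square integrability is known, which is the
  situation after Fatou's lemma and after Tonelli's theorem.\<close>

lemma sq_intI:
  assumes "f \<in> borel_measurable M" "(\<integral>\<^sup>+x. ennreal ((cmod (f x))\<^sup>2) \<partial>M) \<le> ennreal (B\<^sup>2)"
  shows "sq_int M f" "0 \<le> B \<Longrightarrow> norm2 M f \<le> B"
proof -
  have [measurable]: "f \<in> borel_measurable M" by fact
  have fin: "(\<integral>\<^sup>+x. ennreal ((cmod (f x))\<^sup>2) \<partial>M) < \<infinity>"
    by (rule order_le_less_trans[OF assms(2)]) simp
  show s: "sq_int M f"
    unfolding sq_int_def
  proof (intro conjI integrableI_nonneg)
    show "(\<integral>\<^sup>+x. ennreal ((cmod (f x))\<^sup>2) \<partial>M) < \<infinity>" by (rule fin)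
  qed auto
  show "norm2 M f \<le> B" if "0 \<le> B"
  proof (rule power2_le_imp_le[OF _ that])
    show "(norm2 M f)\<^sup>2 \<le> B\<^sup>2"
      using assms(2) unfolding nn_integral_sq_int[OF s] by simp
  qed
qed

lemma sq_int_cong_AE:
  assumes "sq_int M f" "g \<in> borel_measurable M" "AE x in M. f x = g x"
  shows "sq_int M g"
proof -
  have [measurable]: "f \<in> borel_measurable M" "g \<in> borel_measurable M"
    using assms by (auto simp: sq_int_def)
  have "integrable M (\<lambda>x. (cmod (f x))\<^sup>2) \<longleftrightarrow> integrable M (\<lambda>x. (cmod (g x))\<^sup>2)"
    by (rule integrable_cong_AE) (use assms(3) in auto)
  thus ?thesis using assms by (auto simp: sq_int_def)
qed

lemma norm2_cong_AE:
  assumes "f \<in> borel_measurable M" "g \<in> borel_measurable M" "AE x in M. f x = g x"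
  shows "norm2 M f = norm2 M g"
proof -
  have [measurable]: "f \<in> borel_measurable M" "g \<in> borel_measurable M"
    using assms by (auto simp: sq_int_def)
  show ?thesis unfolding norm2_def
    by (intro arg_cong[where f=sqrt] integral_cong_AE) (use assms(3) in auto)
qed

lemma inner2_cong_AE:
  assumes "f \<in> borel_measurable M" "g \<in> borel_measurable M" "AE x in M. f x = g x"
    "f' \<in> borel_measurable M" "g' \<in> borel_measurable M" "AE x in M. f' x = g' x"
  shows "inner2 M f f' = inner2 M g g'"
proof -
  have [measurable]: "f \<in> borel_measurable M" "g \<in> borel_measurable M"
      "f' \<in> borel_measurable M" "g' \<in> borel_measurable M"
    using assms by (auto simp: sq_int_def)
  show ?thesis unfolding inner2_def
    by (intro integral_cong_AE) (use assms(3,6) in auto)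
qed

text \<open>Cauchy-Schwarz, from its version for extended integrals. The moduli stay inside the
  integral because this is the form that Fubini arguments ask for.\<close>

lemma integrable_norm_mult:
  assumes "sq_int M f" "sq_int M g"
  shows "integrable M (\<lambda>x. cmod (f x) * cmod (g x))"
    and "(LINT x|M. cmod (f x) * cmod (g x)) \<le> norm2 M f * norm2 M g"
proof -
  have [measurable]: "f \<in> borel_measurable M" "g \<in> borel_measurable M"
    using assms by (auto simp: sq_int_def)
  have "integrable M (\<lambda>x. (cmod (f x))\<^sup>2 + (cmod (g x))\<^sup>2)"
    using assms by (auto simp: sq_int_def)
  thus i: "integrable M (\<lambda>x. cmod (f x) * cmod (g x))"
  proof (rule Bochner_Integration.integrable_bound)
    have "a * b \<le> a\<^sup>2 + b\<^sup>2" if "0 \<le> a" "0 \<le> b" for a b :: real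
      using that sum_squares_bound[of a b] mult_nonneg_nonneg[OF that] by linarith
    thus "AE x in M. norm (cmod (f x) * cmod (g x)) \<le> norm ((cmod (f x))\<^sup>2 + (cmod (g x))\<^sup>2)"
      by auto
  qed measurable
  have "(\<integral>\<^sup>+x. ennreal (cmod (f x)) * ennreal (cmod (g x)) \<partial>M)\<^sup>2
     \<le> (\<integral>\<^sup>+x. (ennreal (cmod (f x)))\<^sup>2 \<partial>M) * (\<integral>\<^sup>+x. (ennreal (cmod (g x)))\<^sup>2 \<partial>M)"
    by (rule Cauchy_Schwarz_nn_integral) auto
  also have "\<dots> = ennreal ((norm2 M f)\<^sup>2) * ennreal ((norm2 M g)\<^sup>2)"
    using nn_integral_sq_int[OF assms(1)] nn_integral_sq_int[OF assms(2)]
    by (simp add: ennreal_power)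
  also have "(\<integral>\<^sup>+x. ennreal (cmod (f x)) * ennreal (cmod (g x)) \<partial>M)
      = ennreal (LINT x|M. cmod (f x) * cmod (g x))"
    using i by (subst nn_integral_eq_integral[symmetric]) (auto simp: ennreal_mult)
  finally have "(LINT x|M. cmod (f x) * cmod (g x))\<^sup>2 \<le> (norm2 M f * norm2 M g)\<^sup>2"
    by (simp add: ennreal_power ennreal_mult[symmetric] power_mult_distrib)
  thus "(LINT x|M. cmod (f x) * cmod (g x)) \<le> norm2 M f * norm2 M g"
    by (rule power2_le_imp_le) simp
qed

lemma integrable_inner2:
  assumes "sq_int M f" "sq_int M g"
  shows "integrable M (\<lambda>x. f x * cnj (g x))"
proof -
  have [measurable]: "f \<in> borel_measurable M" "g \<in> borel_measurable M"
    using assms by (auto simp: sq_int_def)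
  show ?thesis
    by (rule Bochner_Integration.integrable_bound[OF integrable_norm_mult(1)[OF assms]])
       (auto simp: norm_mult)
qed

lemma inner2_le_norm2:
  assumes "sq_int M f" "sq_int M g"
  shows "cmod (inner2 M f g) \<le> norm2 M f * norm2 M g"
proof -
  have "cmod (inner2 M f g) \<le> (LINT x|M. cmod (f x * cnj (g x)))"
    unfolding inner2_def by (rule integral_norm_bound)
  also have "\<dots> = (LINT x|M. cmod (f x) * cmod (g x))" by (simp add: norm_mult)
  also have "\<dots> \<le> norm2 M f * norm2 M g" by (rule integrable_norm_mult(2)[OF assms])
  finally show ?thesis .
qed

lemma sq_int_scale: "sq_int M f \<Longrightarrow> sq_int M (\<lambda>x. c * f x)"
  by (auto simp: sq_int_def norm_mult power_mult_distrib)

lemma norm2_scale: "norm2 M (\<lambda>x. c * f x) = cmod c * norm2 M f"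
  by (simp add: norm2_def norm_mult power_mult_distrib real_sqrt_mult)

lemma cmod_add_power2: "(cmod (a + b))\<^sup>2 = (cmod a)\<^sup>2 + 2 * Re (a * cnj b) + (cmod b)\<^sup>2"
  unfolding cmod_power2 by (simp add: power2_eq_square algebra_simps)

lemma sq_int_add:
  assumes "sq_int M f" "sq_int M g"
  shows "sq_int M (\<lambda>x. f x + g x)"
    and norm2_add_power2: "(norm2 M (\<lambda>x. f x + g x))\<^sup>2
      = (norm2 M f)\<^sup>2 + 2 * Re (inner2 M f g) + (norm2 M g)\<^sup>2"
proof -
  note i = integrable_inner2[OF assms]
  have i1: "integrable M (\<lambda>x. (cmod (f x))\<^sup>2)" "integrable M (\<lambda>x. (cmod (g x))\<^sup>2)"
    using assms by (auto simp: sq_int_def)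
  show "sq_int M (\<lambda>x. f x + g x)"
    using assms integrable_Re[OF i] unfolding sq_int_def cmod_add_power2
    by (auto simp del: times_complex.sel intro!: borel_measurable_add)
  show "(norm2 M (\<lambda>x. f x + g x))\<^sup>2
      = (norm2 M f)\<^sup>2 + 2 * Re (inner2 M f g) + (norm2 M g)\<^sup>2"
    unfolding norm2_power2 cmod_add_power2 inner2_def integral_Re[OF i, symmetric]
    using i1 integrable_Re[OF i] by (simp del: times_complex.sel)
qed

lemma sq_int_diff:
  assumes "sq_int M f" "sq_int M g"
  shows "sq_int M (\<lambda>x. f x - g x)"
  using sq_int_add(1)[OF assms(1) sq_int_scale[OF assms(2), of "-1"]] by simp

lemma sq_int_zero [simp]: "sq_int M (\<lambda>x. 0)"
  by (simp add: sq_int_def)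

lemma norm2_zero [simp]: "norm2 M (\<lambda>x. 0) = 0"
  by (simp add: norm2_def)

lemma norm2_minus: "norm2 M (\<lambda>x. f x - g x) = norm2 M (\<lambda>x. g x - f x)"
  by (simp add: norm2_def norm_minus_commute)

lemma norm2_add_le:
  assumes "sq_int M f" "sq_int M g"
  shows "norm2 M (\<lambda>x. f x + g x) \<le> norm2 M f + norm2 M g"
proof (rule power2_le_imp_le)
  have "Re (inner2 M f g) \<le> norm2 M f * norm2 M g"
    using inner2_le_norm2[OF assms] complex_Re_le_cmod order_trans by blast
  thus "(norm2 M (\<lambda>x. f x + g x))\<^sup>2 \<le> (norm2 M f + norm2 M g)\<^sup>2"
    unfolding norm2_add_power2[OF assms] by (simp add: power2_sum)
qed simp

lemma norm2_triangle:
  assumes "sq_int M f" "sq_int M g" "sq_int M h"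
  shows "norm2 M (\<lambda>x. f x - h x) \<le> norm2 M (\<lambda>x. f x - g x) + norm2 M (\<lambda>x. g x - h x)"
  using norm2_add_le[OF sq_int_diff[OF assms(1,2)] sq_int_diff[OF assms(2,3)]] by simp

lemma norm2_diff_le:
  assumes "sq_int M f" "sq_int M g"
  shows "norm2 M (\<lambda>x. f x - g x) \<le> norm2 M f + norm2 M g"
  using norm2_add_le[OF assms(1) sq_int_scale[OF assms(2), of "-1"]]
  by (simp add: norm2_scale[of M "-1", simplified])

lemma abs_norm2_diff_le:
  assumes "sq_int M f" "sq_int M g"
  shows "\<bar>norm2 M f - norm2 M g\<bar> \<le> norm2 M (\<lambda>x. f x - g x)"
  using norm2_triangle[OF assms sq_int_zero] norm2_triangle[OF assms(2,1) sq_int_zero]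
  by (simp add: norm2_minus[of M f g])

lemma norm2_eq_0:
  assumes "sq_int M f" "norm2 M f = 0"
  shows "AE x in M. f x = 0"
proof -
  have "(LINT x|M. (cmod (f x))\<^sup>2) = 0" using assms(2) by (simp add: norm2_def)
  hence "AE x in M. (cmod (f x))\<^sup>2 = 0"
    using assms(1) by (subst (asm) integral_nonneg_eq_0_iff_AE) (auto simp: sq_int_def)
  thus ?thesis by simp
qed

lemma inner2_commute: "inner2 M f g = cnj (inner2 M g f)"
  unfolding inner2_def by (subst Bochner_Integration.integral_cnj[symmetric]) (simp add: mult.commute)

lemma inner2_scale_left: "inner2 M (\<lambda>x. c * f x) g = c * inner2 M f g"
  by (simp add: inner2_def mult.assoc)

lemma inner2_scale_right: "inner2 M f (\<lambda>x. c * g x) = cnj c * inner2 M f g"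
  by (simp add: inner2_def mult.left_commute)

lemma inner2_add_left:
  assumes "sq_int M f" "sq_int M g" "sq_int M h"
  shows "inner2 M (\<lambda>x. f x + g x) h = inner2 M f h + inner2 M g h"
  using integrable_inner2[OF assms(1,3)] integrable_inner2[OF assms(2,3)]
  by (simp add: inner2_def distrib_right)

lemma inner2_diff_left:
  assumes "sq_int M f" "sq_int M g" "sq_int M h"
  shows "inner2 M (\<lambda>x. f x - g x) h = inner2 M f h - inner2 M g h"
  using integrable_inner2[OF assms(1,3)] integrable_inner2[OF assms(2,3)]
  by (simp add: inner2_def left_diff_distrib)

lemma inner2_self:
  assumes "sq_int M f"
  shows "inner2 M f f = complex_of_real ((norm2 M f)\<^sup>2)"
proof -
  have "f x * cnj (f x) = complex_of_real ((cmod (f x))\<^sup>2)" for x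
    by (rule complex_norm_square[symmetric])
  thus ?thesis unfolding inner2_def norm2_power2 integral_complex_of_real[symmetric] by presburger
qed

section \<open>Limits, completeness and the Riesz representation theorem\<close>

lemma inner2_tendsto:
  assumes "\<And>n. sq_int M (v n)" "sq_int M g" "sq_int M h"
    and "(\<lambda>n. norm2 M (\<lambda>x. v n x - g x)) \<longlonglongrightarrow> 0"
  shows "(\<lambda>n. inner2 M (v n) h) \<longlonglongrightarrow> inner2 M g h"
proof (rule LIM_zero_cancel, rule Lim_null_comparison)
  show "(\<lambda>n. norm2 M (\<lambda>x. v n x - g x) * norm2 M h) \<longlonglongrightarrow> 0"
    using tendsto_mult_right[OF assms(4), of "norm2 M h"] by simp
  show "\<forall>\<^sub>F n in sequentially. norm (inner2 M (v n) h - inner2 M g h)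
      \<le> norm2 M (\<lambda>x. v n x - g x) * norm2 M h"
    using inner2_le_norm2[OF sq_int_diff[OF assms(1,2)] assms(3)]
    by (simp add: inner2_diff_left[OF assms(1,2,3)])
qed

lemma norm2_tendsto:
  assumes "\<And>n. sq_int M (v n)" "sq_int M g" "(\<lambda>n. norm2 M (\<lambda>x. v n x - g x)) \<longlonglongrightarrow> 0"
  shows "(\<lambda>n. norm2 M (v n)) \<longlonglongrightarrow> norm2 M g"
proof (rule LIM_zero_cancel, rule Lim_null_comparison[OF _ assms(3)])
  show "\<forall>\<^sub>F n in sequentially. norm (norm2 M (v n) - norm2 M g) \<le> norm2 M (\<lambda>x. v n x - g x)"
    using abs_norm2_diff_le[OF assms(1,2)] by simp
qed

text \<open>Fatou's lemma for the squared moduli: norm bounds survive pointwise limits even where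
  norm convergence is not yet known.\<close>

lemma sq_int_Fatou:
  assumes v: "\<And>n. sq_int M (v n)" and bd: "\<And>n. norm2 M (v n) \<le> B" and "0 \<le> B"
    and g [measurable]: "g \<in> borel_measurable M"
    and lim: "AE x in M. (\<lambda>n::nat. v n x) \<longlonglongrightarrow> g x"
  shows "sq_int M g" "norm2 M g \<le> B"
proof -
  have [measurable]: "v n \<in> borel_measurable M" for n using v[of n] by (simp add: sq_int_def)
  have "(\<integral>\<^sup>+x. ennreal ((cmod (g x))\<^sup>2) \<partial>M)
      = (\<integral>\<^sup>+x. liminf (\<lambda>n. ennreal ((cmod (v n x))\<^sup>2)) \<partial>M)"
  proof (rule nn_integral_cong_AE, use lim in eventually_elim)
    case (elim x)
    have "(\<lambda>n. ennreal ((cmod (v n x))\<^sup>2)) \<longlonglongrightarrow> ennreal ((cmod (g x))\<^sup>2)"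
      by (intro tendsto_ennrealI tendsto_power tendsto_norm elim)
    from lim_imp_Liminf[OF sequentially_bot this] show ?case by (rule sym)
  qed
  also have "\<dots> \<le> liminf (\<lambda>n. \<integral>\<^sup>+x. ennreal ((cmod (v n x))\<^sup>2) \<partial>M)"
    by (rule nn_integral_liminf) measurable
  also have "\<dots> \<le> limsup (\<lambda>n. \<integral>\<^sup>+x. ennreal ((cmod (v n x))\<^sup>2) \<partial>M)"
    by (rule Liminf_le_Limsup) simp
  also have "\<dots> \<le> ennreal (B\<^sup>2)"
  proof (rule Limsup_bounded, rule always_eventually, rule allI)
    fix n show "(\<integral>\<^sup>+x. ennreal ((cmod (v n x))\<^sup>2) \<partial>M) \<le> ennreal (B\<^sup>2)"
      unfolding nn_integral_sq_int[OF v] using bd[of n] by (intro ennreal_leI power_mono) auto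
  qed
  finally have le: "(\<integral>\<^sup>+x. ennreal ((cmod (g x))\<^sup>2) \<partial>M) \<le> ennreal (B\<^sup>2)" .
  show "sq_int M g" "norm2 M g \<le> B"
    using sq_intI[OF g le] \<open>0 \<le> B\<close> by auto
qed

text \<open>The increments have squares of integral at most \<open>(1/4) ^ n\<close>, so their
  squares weighted by \<open>2 ^ n\<close> still have a finite total integral and are summable at
  almost every point. The weight allows the return from squares to the increments themselves on a
  space of infinite measure, where the quadratic norm does not control the integral of the
  modulus.\<close>

lemma sq_int_fast_Cauchy:
  assumes v: "\<And>n. sq_int M (v n)"
    and fast: "\<And>n. norm2 M (\<lambda>x. v (Suc n) x - v n x) \<le> (1/2) ^ n"
  shows "AE x in M. Cauchy (\<lambda>n. v n x)"
proof -
  have [measurable]: "v n \<in> borel_measurable M" for n using v[of n] by (simp add: sq_int_def)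
  define d where "d n x = cmod (v (Suc n) x - v n x)" for n x
  have [measurable]: "d n \<in> borel_measurable M" for n unfolding d_def by measurable
  have "(\<integral>\<^sup>+x. ennreal (2 ^ n * (d n x)\<^sup>2) \<partial>M) \<le> ennreal ((1/2) ^ n)" for n
  proof -
    have "(\<integral>\<^sup>+x. ennreal (2 ^ n * (d n x)\<^sup>2) \<partial>M)
        = ennreal (2 ^ n) * (\<integral>\<^sup>+x. ennreal ((d n x)\<^sup>2) \<partial>M)"
      by (subst nn_integral_cmult[symmetric]) (auto simp: ennreal_mult)
    also have "\<dots> = ennreal (2 ^ n * (norm2 M (\<lambda>x. v (Suc n) x - v n x))\<^sup>2)"
      unfolding d_def nn_integral_sq_int[OF sq_int_diff[OF v v]] by (simp add: ennreal_mult)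
    also have "\<dots> \<le> ennreal (2 ^ n * ((1/2) ^ n)\<^sup>2)"
      by (intro ennreal_leI mult_left_mono power_mono fast) auto
    also have "2 ^ n * ((1/2) ^ n)\<^sup>2 = (1/2::real) ^ n"
      by (simp add: power2_eq_square power_mult_distrib[symmetric])
    finally show ?thesis .
  qed
  hence "(\<Sum>n. \<integral>\<^sup>+x. ennreal (2 ^ n * (d n x)\<^sup>2) \<partial>M) \<le> (\<Sum>n. ennreal ((1/2) ^ n))"
    by (intro suminf_le) auto
  also have "\<dots> = ennreal (\<Sum>n. (1/2) ^ n)"
    by (rule suminf_ennreal2) (auto simp: summable_geometric)
  also have "\<dots> < \<infinity>" by simp
  finally have "(\<integral>\<^sup>+x. (\<Sum>n. ennreal (2 ^ n * (d n x)\<^sup>2)) \<partial>M) \<noteq> \<infinity>"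
    by (subst nn_integral_suminf) auto
  hence "AE x in M. (\<Sum>n. ennreal (2 ^ n * (d n x)\<^sup>2)) \<noteq> \<infinity>"
    by (intro nn_integral_noteq_infinite) auto
  thus ?thesis
  proof eventually_elim
    case (elim x)
    have "summable (\<lambda>n. 2 ^ n * (d n x)\<^sup>2)"
      by (rule summable_suminf_not_top) (use elim in auto)
    moreover have "summable (\<lambda>n. (1/2::real) ^ n)" by (simp add: summable_geometric)
    ultimately have "summable (\<lambda>n. 2 ^ n * (d n x)\<^sup>2 + (1/2) ^ n)" by (rule summable_add)
    hence "summable (\<lambda>n. d n x)"
    proof (rule summable_comparison_test')
      fix n :: nat
      have pos: "0 \<le> d n x" by (simp add: d_def)
      \<comment> \<open>After division by \<open>2 ^ n\<close> this bounds the increment by its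
        weighted square plus a geometric term.\<close>
      have "2 * (2 ^ n * d n x) * 1 \<le> (2 ^ n * d n x)\<^sup>2 + 1\<^sup>2" by (rule sum_squares_bound)
      hence "2 ^ n * (2 * d n x) \<le> 2 ^ n * (2 ^ n * (d n x)\<^sup>2 + (1/2) ^ n)"
        by (simp add: power2_eq_square algebra_simps power_mult_distrib[symmetric])
      hence "2 * d n x \<le> 2 ^ n * (d n x)\<^sup>2 + (1/2) ^ n" by simp
      thus "norm (d n x) \<le> 2 ^ n * (d n x)\<^sup>2 + (1/2) ^ n" using pos by simp
    qed
    hence "summable (\<lambda>n. v (Suc n) x - v n x)"
      unfolding d_def by (rule summable_norm_cancel)
    hence "convergent (\<lambda>n. \<Sum>k<n. v (Suc k) x - v k x)" by (simp add: summable_iff_convergent)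
    hence "convergent (\<lambda>n. v n x - v 0 x)"
      unfolding sum_lessThan_telescope[of "\<lambda>k. v k x"] .
    hence "convergent (\<lambda>n. (v n x - v 0 x) + v 0 x)" by (intro convergent_add convergent_const)
    thus ?case by (simp add: Cauchy_convergent_iff)
  qed
qed

text \<open>Riesz-Fischer: a rapidly converging subsequence converges almost everywhere, and Fatou's
  lemma with one index fixed turns the Cauchy condition into norm convergence of the whole
  sequence.\<close>

lemma sq_int_complete:
  assumes v: "\<And>n. sq_int M (v n)"
    and Cauchy: "\<And>e. 0 < e \<Longrightarrow> \<exists>N. \<forall>m\<ge>N. \<forall>n\<ge>N. norm2 M (\<lambda>x. v m x - v n x) \<le> e"
  obtains g where "sq_int M g" "(\<lambda>n. norm2 M (\<lambda>x. v n x - g x)) \<longlonglongrightarrow> 0"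
proof -
  have meas [measurable]: "v n \<in> borel_measurable M" for n using v[of n] by (simp add: sq_int_def)
  have "\<exists>N. \<forall>m\<ge>N. \<forall>n\<ge>N. norm2 M (\<lambda>x. v m x - v n x) \<le> (1/2) ^ k" for k
    by (rule Cauchy) simp
  then obtain N where N: "\<And>k m n. N k \<le> m \<Longrightarrow> N k \<le> n \<Longrightarrow> norm2 M (\<lambda>x. v m x - v n x) \<le> (1/2) ^ k"
    by metis
  \<comment> \<open>Taking the maximum makes \<open>r\<close> strictly increasing and keeps
    \<open>r k\<close> beyond \<open>N k\<close>.\<close>
  define r where "r = rec_nat (N 0) (\<lambda>k p. max (Suc p) (N (Suc k)))"
  have r_Suc: "r (Suc k) = max (Suc (r k)) (N (Suc k))" for k by (simp add: r_def)
  have rN: "N k \<le> r k" for k by (cases k) (auto simp: r_def)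
  have "strict_mono r" by (rule strict_monoI_Suc) (simp add: r_Suc)
  have "norm2 M (\<lambda>x. v (r (Suc k)) x - v (r k) x) \<le> (1/2) ^ k" for k
    using rN[of k] by (intro N) (auto simp: r_Suc)
  hence AEC: "AE x in M. Cauchy (\<lambda>k. v (r k) x)"
    by (intro sq_int_fast_Cauchy v)
  define g where "g x = lim (\<lambda>k. v (r k) x)" for x
  have [measurable]: "g \<in> borel_measurable M" unfolding g_def by measurable
  have lim: "AE x in M. (\<lambda>k. v (r k) x) \<longlonglongrightarrow> g x"
    using AEC by eventually_elim (simp add: g_def Cauchy_convergent_iff convergent_LIMSEQ_iff)
  have close: "sq_int M (\<lambda>x. v n x - g x) \<and> norm2 M (\<lambda>x. v n x - g x) \<le> (1/2) ^ k" if "N k \<le> n" for n k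
  proof -
    have bd: "norm2 M (\<lambda>x. v n x - v (r (j + k)) x) \<le> (1/2) ^ k" for j
      using that rN[of k] strict_mono_mono[OF \<open>strict_mono r\<close>] by (intro N) (auto simp: mono_def intro: order_trans)
    have lim': "AE x in M. (\<lambda>j. v n x - v (r (j + k)) x) \<longlonglongrightarrow> v n x - g x"
      using lim by eventually_elim (intro tendsto_diff tendsto_const LIMSEQ_ignore_initial_segment)
    show ?thesis
      using sq_int_Fatou[OF sq_int_diff[OF v v] bd _ _ lim'] by simp
  qed
  have "sq_int M (\<lambda>x. v (N 0) x - (v (N 0) x - g x))"
    by (rule sq_int_diff[OF v]) (use close[of 0 "N 0"] in auto)
  hence g: "sq_int M g" by simp
  have "(\<lambda>n. norm2 M (\<lambda>x. v n x - g x)) \<longlonglongrightarrow> 0"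
  proof (rule LIMSEQ_I)
    fix e :: real assume "0 < e"
    then obtain k where k: "(1/2) ^ k < e" using real_arch_pow_inv[of e "1/2"] by auto
    show "\<exists>n0. \<forall>n\<ge>n0. norm (norm2 M (\<lambda>x. v n x - g x) - 0) < e"
      using close k by (intro exI[of _ "N k"]) (auto intro: order_le_less_trans)
  qed
  with g show ?thesis by (rule that)
qed

text \<open>
  The family \<open>v\<close> enumerates a subspace (up to null sets), on which \<open>\<phi>\<close> is a bounded linear
  functional.
\<close>

lemma Riesz_subspace:
  assumes i0: "i0 \<in> I" and v: "\<And>i. i \<in> I \<Longrightarrow> sq_int M (v i)"
    and lin: "\<And>i j c. i \<in> I \<Longrightarrow> j \<in> I \<Longrightarrow> \<exists>k\<in>I. (AE x in M. v k x = v i x + c * v j x) \<and> \<phi> k = \<phi> i + c * \<phi> j"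
    and bd: "\<And>i. i \<in> I \<Longrightarrow> cmod (\<phi> i) \<le> B * norm2 M (v i)" and "0 \<le> B"
  obtains g k where "sq_int M g" "norm2 M g \<le> B" "\<And>i. i \<in> I \<Longrightarrow> \<phi> i = inner2 M (v i) g"
    "\<And>n. k n \<in> I" "(\<lambda>n. norm2 M (\<lambda>x. v (k n) x - g x)) \<longlonglongrightarrow> 0"
proof -
  \<comment> \<open>If \<open>g\<close> represents the functional, \<open>J i\<close> is the squared
    distance of \<open>v i\<close> from \<open>g\<close> minus the squared norm of \<open>g\<close>.
    A minimising sequence for \<open>J\<close> must then approach \<open>g\<close>.\<close>
  define J where "J i = (norm2 M (v i))\<^sup>2 - 2 * Re (\<phi> i)" for i
  have J_ge: "- B\<^sup>2 \<le> J i" if "i \<in> I" for i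
  proof -
    have "Re (\<phi> i) \<le> B * norm2 M (v i)"
      using bd[OF that] complex_Re_le_cmod order_trans by blast
    moreover have "2 * B * norm2 M (v i) \<le> B\<^sup>2 + (norm2 M (v i))\<^sup>2" by (rule sum_squares_bound)
    ultimately show ?thesis unfolding J_def by linarith
  qed
  define m where "m = (INF i\<in>I. J i)"
  have bdd: "bdd_below (J ` I)" using J_ge by (intro bdd_belowI[of _ "- B\<^sup>2"]) auto
  have m_le: "m \<le> J i" if "i \<in> I" for i
    unfolding m_def by (rule cINF_lower[OF bdd that])
  have "\<exists>i\<in>I. J i < m + 1 / real (Suc n)" for n
  proof (rule ccontr)
    assume "\<not> ?thesis"
    hence "m + 1 / real (Suc n) \<le> m"
      unfolding m_def using i0 by (intro cINF_greatest) (auto simp: m_def not_less)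
    thus False by simp
  qed
  then obtain k where kI: "\<And>n. k n \<in> I" and kJ: "\<And>n. J (k n) < m + 1 / real (Suc n)" by metis
  have lin_norm: "\<exists>q\<in>I. (norm2 M (v q))\<^sup>2 = (norm2 M (v i))\<^sup>2 + 2 * Re (cnj c * inner2 M (v i) (v j))
        + (cmod c)\<^sup>2 * (norm2 M (v j))\<^sup>2 \<and> \<phi> q = \<phi> i + c * \<phi> j" if ij: "i \<in> I" "j \<in> I" for i j c
  proof -
    from lin[OF ij] obtain q where q: "q \<in> I" "AE x in M. v q x = v i x + c * v j x" "\<phi> q = \<phi> i + c * \<phi> j"
      by blast
    note s = v[OF ij(1)] sq_int_scale[OF v[OF ij(2)], of c]
    have "norm2 M (v q) = norm2 M (\<lambda>x. v i x + c * v j x)"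
      using v[OF q(1)] sq_int_add(1)[OF s] q(2) by (intro norm2_cong_AE) (auto simp: sq_int_def)
    hence "(norm2 M (v q))\<^sup>2 = (norm2 M (v i))\<^sup>2 + 2 * Re (cnj c * inner2 M (v i) (v j))
        + (cmod c)\<^sup>2 * (norm2 M (v j))\<^sup>2"
      by (simp only: sq_int_add(2)[OF s] inner2_scale_right norm2_scale power_mult_distrib)
    with q show ?thesis by blast
  qed
  \<comment> \<open>The parallelogram law: the midpoint \<open>p\<close> also satisfies
    \<open>m \<le> J p\<close>, so two elements with nearly minimal \<open>J\<close> are close to
    each other.\<close>
  have par: "(norm2 M (\<lambda>x. v i x - v j x))\<^sup>2 \<le> 2 * (J i + J j - 2 * m)" if ij: "i \<in> I" "j \<in> I" for i j
  proof -
    from lin_norm[OF ij, of 1] obtain q where q: "q \<in> I"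
      "(norm2 M (v q))\<^sup>2 = (norm2 M (v i))\<^sup>2 + 2 * Re (inner2 M (v i) (v j)) + (norm2 M (v j))\<^sup>2"
      "\<phi> q = \<phi> i + \<phi> j" by auto
    \<comment> \<open>The hypothesis \<open>lin\<close> only offers combinations
      \<open>v i + c * v j\<close>; half of \<open>q\<close> is written as
      \<open>q - q / 2\<close>.\<close>
    from lin_norm[OF q(1) q(1), of "-1/2"] obtain p where p: "p \<in> I"
      "(norm2 M (v p))\<^sup>2 = (norm2 M (v q))\<^sup>2 / 4" "\<phi> p = \<phi> q / 2"
      by (auto simp: inner2_self[OF v[OF q(1)]] power_divide)
    have "(norm2 M (\<lambda>x. v i x - v j x))\<^sup>2
       = (norm2 M (v i))\<^sup>2 - 2 * Re (inner2 M (v i) (v j)) + (norm2 M (v j))\<^sup>2"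
      using sq_int_add(2)[OF v[OF ij(1)] sq_int_scale[OF v[OF ij(2)], of "-1"]]
      unfolding inner2_scale_right norm2_scale by simp
    moreover have "J p = ((norm2 M (v i))\<^sup>2 + 2 * Re (inner2 M (v i) (v j)) + (norm2 M (v j))\<^sup>2) / 4
        - Re (\<phi> i) - Re (\<phi> j)"
      unfolding J_def p(2,3) q(2,3) by (simp add: field_simps)
    ultimately show ?thesis using m_le[OF p(1)] unfolding J_def[of i] J_def[of j]
      by (simp add: field_simps)
  qed
  have kv: "sq_int M (v (k n))" for n by (rule v[OF kI])
  obtain g where g: "sq_int M g" and lim: "(\<lambda>n. norm2 M (\<lambda>x. v (k n) x - g x)) \<longlonglongrightarrow> 0"
  proof (rule sq_int_complete[of M "\<lambda>n. v (k n)", OF kv])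
    fix e :: real assume e: "0 < e"
    \<comment> \<open>Two values of \<open>J\<close> within \<open>1 / Suc N\<close> of the infimum
      belong, by \<open>par\<close>, to elements at squared distance at most
      \<open>4 / Suc N\<close>.\<close>
    obtain N where N: "4 / e\<^sup>2 < real N" using reals_Archimedean2 by blast
    have "4 < real N * e\<^sup>2" using N e by (simp add: field_simps)
    hence "4 \<le> e\<^sup>2 * real (Suc N)" using zero_le_power2[of e]
      unfolding of_nat_Suc distrib_left by (simp only: mult.commute)
    hence N1: "4 / real (Suc N) \<le> e\<^sup>2" by (subst pos_divide_le_eq) auto
    have "norm2 M (\<lambda>x. v (k a) x - v (k b) x) \<le> e" if "N \<le> a" "N \<le> b" for a b
    proof (rule power2_le_imp_le[OF _ less_imp_le[OF e]])
      have "1 / real (Suc a) \<le> 1 / real (Suc N)" "1 / real (Suc b) \<le> 1 / real (Suc N)"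
        using that by (auto simp: field_simps)
      hence "2 * (J (k a) + J (k b) - 2 * m) \<le> 4 / real (Suc N)"
        using kJ[of a] kJ[of b] by simp
      with par[OF kI[of a] kI[of b]] N1 show "(norm2 M (\<lambda>x. v (k a) x - v (k b) x))\<^sup>2 \<le> e\<^sup>2" by linarith
    qed
    thus "\<exists>N. \<forall>a\<ge>N. \<forall>b\<ge>N. norm2 M (\<lambda>x. v (k a) x - v (k b) x) \<le> e" by blast
  qed
  have Jlim: "(\<lambda>n. J (k n)) \<longlonglongrightarrow> m"
  proof (rule tendsto_sandwich[OF _ _ tendsto_const])
    show "(\<lambda>n. m + 1 / real (Suc n)) \<longlonglongrightarrow> m"
      using tendsto_add[OF tendsto_const LIMSEQ_inverse_real_of_nat, of m] by (simp add: inverse_eq_divide)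
    show "\<forall>\<^sub>F n in sequentially. m \<le> J (k n)" using m_le[OF kI] by simp
    show "\<forall>\<^sub>F n in sequentially. J (k n) \<le> m + 1 / real (Suc n)"
      using kJ by (intro always_eventually allI less_imp_le)
  qed
  have rep: "\<phi> i = inner2 M (v i) g" if i: "i \<in> I" for i
  proof (rule ccontr)
    define d where "d = inner2 M (v i) g - \<phi> i"
    assume "\<not> ?thesis"
    hence d0: "d \<noteq> 0" by (simp add: d_def)
    \<comment> \<open>Minimality against the perturbation of the minimising sequence by
      \<open>c * v i\<close>, in the limit. The quadratic expression in \<open>c\<close> has the
      linear coefficient \<open>d\<close>, which must therefore vanish.\<close>
    have ineq: "0 \<le> 2 * Re (c * d) + (cmod c)\<^sup>2 * (norm2 M (v i))\<^sup>2" for c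
    proof -
      have "m \<le> J (k n) + 2 * Re (cnj c * inner2 M (v (k n)) (v i)) + (cmod c)\<^sup>2 * (norm2 M (v i))\<^sup>2 - 2 * Re (c * \<phi> i)" for n
      proof -
        from lin_norm[OF kI[of n] i, of c] obtain q where q: "q \<in> I"
          "(norm2 M (v q))\<^sup>2 = (norm2 M (v (k n)))\<^sup>2 + 2 * Re (cnj c * inner2 M (v (k n)) (v i))
            + (cmod c)\<^sup>2 * (norm2 M (v i))\<^sup>2" "\<phi> q = \<phi> (k n) + c * \<phi> i" by blast
        have "m \<le> J q" by (rule m_le[OF q(1)])
        also have "J q = J (k n) + 2 * Re (cnj c * inner2 M (v (k n)) (v i)) + (cmod c)\<^sup>2 * (norm2 M (v i))\<^sup>2 - 2 * Re (c * \<phi> i)"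
          unfolding J_def q(2,3) plus_complex.sel by simp
        finally show ?thesis .
      qed
      moreover have "(\<lambda>n. J (k n) + 2 * Re (cnj c * inner2 M (v (k n)) (v i)) + (cmod c)\<^sup>2 * (norm2 M (v i))\<^sup>2 - 2 * Re (c * \<phi> i))
          \<longlonglongrightarrow> m + 2 * Re (cnj c * inner2 M g (v i)) + (cmod c)\<^sup>2 * (norm2 M (v i))\<^sup>2 - 2 * Re (c * \<phi> i)"
        by (intro tendsto_intros Jlim inner2_tendsto[OF kv g v[OF i] lim])
      ultimately have "m \<le> m + 2 * Re (cnj c * inner2 M g (v i)) + (cmod c)\<^sup>2 * (norm2 M (v i))\<^sup>2 - 2 * Re (c * \<phi> i)"
        by (intro LIMSEQ_le_const) auto
      moreover have "Re (cnj c * inner2 M g (v i)) = Re (c * inner2 M (v i) g)"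
        unfolding inner2_commute[of M g] complex_cnj_mult[symmetric] by simp
      ultimately show ?thesis by (simp only: d_def right_diff_distrib minus_complex.sel)
    qed
    \<comment> \<open>The perturbation is \<open>c = - t * cnj d\<close>. With this step length the
      quadratic term is smaller than the linear one, so the expression becomes negative.\<close>
    define t where "t = 1 / ((norm2 M (v i))\<^sup>2 + 1)"
    have "0 < (norm2 M (v i))\<^sup>2 + 1" by (simp add: add_nonneg_pos)
    hence t: "0 < t" "t * (norm2 M (v i))\<^sup>2 < 1" unfolding t_def by (auto simp: field_simps)
    have "0 \<le> 2 * Re (complex_of_real (- t) * cnj d * d) + (cmod (complex_of_real (- t) * cnj d))\<^sup>2 * (norm2 M (v i))\<^sup>2"
      by (rule ineq)
    also have "complex_of_real (- t) * cnj d * d = complex_of_real (- t * (cmod d)\<^sup>2)"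
      using complex_norm_square[of d] by (simp add: mult.commute)
    also have "(cmod (complex_of_real (- t) * cnj d))\<^sup>2 = t\<^sup>2 * (cmod d)\<^sup>2"
      by (simp add: norm_mult power_mult_distrib)
    also have "2 * Re (complex_of_real (- t * (cmod d)\<^sup>2)) + t\<^sup>2 * (cmod d)\<^sup>2 * (norm2 M (v i))\<^sup>2
        = t * (cmod d)\<^sup>2 * (t * (norm2 M (v i))\<^sup>2 - 2)"
      by (simp add: power2_eq_square algebra_simps)
    finally have "0 \<le> t * (cmod d)\<^sup>2 * (t * (norm2 M (v i))\<^sup>2 - 2)" .
    moreover have "t * (cmod d)\<^sup>2 * (t * (norm2 M (v i))\<^sup>2 - 2) < 0"
      using t d0 by (intro mult_pos_neg) auto
    ultimately show False by simp
  qed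
  \<comment> \<open>The bound on the functional passes to the limit \<open>g\<close>, where it
    reads: the squared norm of \<open>g\<close> is at most \<open>B\<close> times its norm.\<close>
  have "cmod (inner2 M (v (k n)) g) \<le> B * norm2 M (v (k n))" for n
    using bd[OF kI[of n]] rep[OF kI[of n]] by simp
  hence "cmod (inner2 M g g) \<le> B * norm2 M g"
    by (intro LIMSEQ_le[OF tendsto_norm[OF inner2_tendsto[OF kv g g lim]]
          tendsto_mult_left[OF norm2_tendsto[OF kv g lim], of B]]) auto
  hence "norm2 M g * norm2 M g \<le> B * norm2 M g"
    unfolding inner2_self[OF g] by (simp add: power2_eq_square norm_mult)
  hence "norm2 M g \<le> B"
    using \<open>0 \<le> B\<close> norm2_nonneg[of M g] by (cases "norm2 M g = 0") (auto simp: mult_le_cancel_right)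
  thus ?thesis using g rep kI lim that by blast
qed


section \<open>Integrals of square-integrable functions\<close>

text \<open>The square of the integral over \<open>t\<close> is a double integral over
  \<open>t\<close> and \<open>t'\<close>. Exchanging it with the integral over \<open>s\<close> and
  applying Cauchy-Schwarz to each pair bounds it by the square of the integrated norm.\<close>

lemma Minkowski_integral:
  fixes W :: "'t \<Rightarrow> 'a \<Rightarrow> complex"
  assumes ps: "pair_sigma_finite T M"
    and W [measurable]: "case_prod W \<in> borel_measurable (T \<Otimes>\<^sub>M M)"
    and sq: "\<And>t. t \<in> space T \<Longrightarrow> sq_int M (W t)"
    and int: "integrable T (\<lambda>t. norm2 M (W t))"
  defines "V \<equiv> \<lambda>s. LINT t|T. W t s"
  shows "sq_int M V" (is ?A) and "norm2 M V \<le> (LINT t|T. norm2 M (W t))" (is ?B)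
    and "AE s in M. integrable T (\<lambda>t. W t s)" (is ?C)
proof -
  interpret pair_sigma_finite T M by (rule ps)
  define b where "b = (LINT t|T. norm2 M (W t))"
  have b0: "0 \<le> b" unfolding b_def by (rule integral_nonneg_AE) simp
  have Wt [measurable]: "W t \<in> borel_measurable M" if "t \<in> space T" for t
    using sq[OF that] by (simp add: sq_int_def)
  have bn: "(\<integral>\<^sup>+t. ennreal (norm2 M (W t)) \<partial>T) = ennreal b"
    unfolding b_def using int by (intro nn_integral_eq_integral) auto
  \<comment> \<open>\<open>N\<close> may be infinite. The estimate of its square yields at once the
    existence of \<open>V\<close> almost everywhere and the norm bound.\<close>
  define N where "N s = (\<integral>\<^sup>+t. ennreal (cmod (W t s)) \<partial>T)" for s
  have [measurable]: "N \<in> borel_measurable M" unfolding N_def by measurable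
  have [measurable]: "(\<lambda>t. norm2 M (W t)) \<in> borel_measurable T" using int by simp
  have "(\<integral>\<^sup>+s. (N s)\<^sup>2 \<partial>M) = (\<integral>\<^sup>+s. (\<integral>\<^sup>+t. ennreal (cmod (W t s)) * N s \<partial>T) \<partial>M)"
    unfolding power2_eq_square
    by (rule nn_integral_cong, subst nn_integral_multc) (auto simp: N_def)
  also have "\<dots> = (\<integral>\<^sup>+t. (\<integral>\<^sup>+s. ennreal (cmod (W t s)) * N s \<partial>M) \<partial>T)"
    by (rule Fubini') measurable
  also have "\<dots> \<le> (\<integral>\<^sup>+t. ennreal (norm2 M (W t)) * ennreal b \<partial>T)"
  proof (rule nn_integral_mono)
    fix t assume t: "t \<in> space T"
    note [measurable] = Wt[OF t]
    have "(\<integral>\<^sup>+s. ennreal (cmod (W t s)) * N s \<partial>M)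
        = (\<integral>\<^sup>+s. (\<integral>\<^sup>+t'. ennreal (cmod (W t s)) * ennreal (cmod (W t' s)) \<partial>T) \<partial>M)"
      by (rule nn_integral_cong, subst nn_integral_cmult) (auto simp: N_def)
    also have "\<dots> = (\<integral>\<^sup>+t'. (\<integral>\<^sup>+s. ennreal (cmod (W t s)) * ennreal (cmod (W t' s)) \<partial>M) \<partial>T)"
      by (rule Fubini') measurable
    also have "\<dots> \<le> (\<integral>\<^sup>+t'. ennreal (norm2 M (W t)) * ennreal (norm2 M (W t')) \<partial>T)"
    proof (rule nn_integral_mono)
      fix t' assume t': "t' \<in> space T"
      have "(\<integral>\<^sup>+s. ennreal (cmod (W t s)) * ennreal (cmod (W t' s)) \<partial>M)
          = ennreal (LINT s|M. cmod (W t s) * cmod (W t' s))"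
        using integrable_norm_mult(1)[OF sq[OF t] sq[OF t']]
        by (subst nn_integral_eq_integral[symmetric]) (auto simp: ennreal_mult)
      also have "\<dots> \<le> ennreal (norm2 M (W t) * norm2 M (W t'))"
        by (intro ennreal_leI integrable_norm_mult(2) sq t t')
      finally show "(\<integral>\<^sup>+s. ennreal (cmod (W t s)) * ennreal (cmod (W t' s)) \<partial>M)
        \<le> ennreal (norm2 M (W t)) * ennreal (norm2 M (W t'))" by (simp add: ennreal_mult)
    qed
    also have "\<dots> = ennreal (norm2 M (W t)) * ennreal b"
      by (subst nn_integral_cmult) (auto simp: bn)
    finally show "(\<integral>\<^sup>+s. ennreal (cmod (W t s)) * N s \<partial>M) \<le> ennreal (norm2 M (W t)) * ennreal b" .
  qed
  also have "\<dots> = ennreal (b\<^sup>2)"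
    by (subst nn_integral_multc) (auto simp: bn power2_eq_square ennreal_mult b0)
  finally have le: "(\<integral>\<^sup>+s. (N s)\<^sup>2 \<partial>M) \<le> ennreal (b\<^sup>2)" .
  have "AE s in M. (N s)\<^sup>2 \<noteq> \<infinity>"
  proof (rule nn_integral_noteq_infinite)
    have "(\<integral>\<^sup>+s. (N s)\<^sup>2 \<partial>M) < \<infinity>" by (rule order_le_less_trans[OF le]) simp
    thus "(\<integral>\<^sup>+s. (N s)\<^sup>2 \<partial>M) \<noteq> \<infinity>" by simp
  qed measurable
  hence fin: "AE s in M. s \<in> space M \<and> N s < \<infinity>"
    using AE_space by eventually_elim (auto simp: power_eq_top_ennreal less_top)
  show ?C using fin
  proof eventually_elim
    case (elim s)
    show ?case
    proof (rule integrableI_bounded)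
      show "(\<lambda>t. W t s) \<in> borel_measurable T"
        using measurable_compose[OF measurable_Pair2' W, of s] elim by simp
    qed (use elim in \<open>simp add: N_def\<close>)
  qed
  hence "AE s in M. ennreal ((cmod (V s))\<^sup>2) \<le> (N s)\<^sup>2"
  proof eventually_elim
    case (elim s)
    have "ennreal (cmod (V s)) \<le> N s"
      unfolding V_def N_def by (rule integral_norm_bound_ennreal[OF elim])
    thus ?case by (simp add: ennreal_power[symmetric] power_mono)
  qed
  hence "(\<integral>\<^sup>+s. ennreal ((cmod (V s))\<^sup>2) \<partial>M) \<le> (\<integral>\<^sup>+s. (N s)\<^sup>2 \<partial>M)"
    by (rule nn_integral_mono_AE)
  also note le
  finally have le': "(\<integral>\<^sup>+s. ennreal ((cmod (V s))\<^sup>2) \<partial>M) \<le> ennreal (b\<^sup>2)" .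
  have "V \<in> borel_measurable M" unfolding V_def by measurable
  from sq_intI[OF this le'] b0 show ?A ?B by (auto simp: b_def)
qed

text \<open>With \<open>h\<close> an exponential this moves the Laplace transform under an integral
  of functions.\<close>

lemma inner2_integral_left:
  fixes W :: "'t \<Rightarrow> 'a \<Rightarrow> complex"
  assumes ps: "pair_sigma_finite T M"
    and W [measurable]: "case_prod W \<in> borel_measurable (T \<Otimes>\<^sub>M M)"
    and sq: "\<And>t. t \<in> space T \<Longrightarrow> sq_int M (W t)"
    and int: "integrable T (\<lambda>t. norm2 M (W t))"
    and h: "sq_int M h"
  shows "integrable T (\<lambda>t. inner2 M (W t) h)"
    and "inner2 M (\<lambda>s. LINT t|T. W t s) h = (LINT t|T. inner2 M (W t) h)"
proof -
  interpret pair_sigma_finite T M by (rule ps)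
  have [measurable]: "h \<in> borel_measurable M" using h by (simp add: sq_int_def)
  have i: "integrable (T \<Otimes>\<^sub>M M) (\<lambda>(t, s). W t s * cnj (h s))"
  proof (rule Fubini_integrable)
    show "integrable T (\<lambda>t. LINT s|M. norm (case (t, s) of (t, s) \<Rightarrow> W t s * cnj (h s)))"
    proof (rule Bochner_Integration.integrable_bound)
      show "integrable T (\<lambda>t. norm2 M (W t) * norm2 M h)" using int by simp
      have "norm (LINT s|M. cmod (W t s) * cmod (h s)) \<le> norm (norm2 M (W t) * norm2 M h)"
        if "t \<in> space T" for t
        using integrable_norm_mult(2)[OF sq[OF that] h] by simp
      thus "AE t in T. norm (LINT s|M. norm (case (t, s) of (t, s) \<Rightarrow> W t s * cnj (h s)))
          \<le> norm (norm2 M (W t) * norm2 M h)"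
        by (simp add: norm_mult)
    qed measurable
    show "AE t in T. integrable M (\<lambda>s. case (t, s) of (t, s) \<Rightarrow> W t s * cnj (h s))"
      using integrable_inner2[OF sq h] by simp
  qed measurable
  from integrable_fst[OF i] show "integrable T (\<lambda>t. inner2 M (W t) h)"
    unfolding inner2_def by simp
  have "inner2 M (\<lambda>s. LINT t|T. W t s) h = (LINT s|M. LINT t|T. W t s * cnj (h s))"
    unfolding inner2_def by simp
  also have "\<dots> = (LINT t|T. LINT s|M. W t s * cnj (h s))"
    by (rule Fubini_integral[OF i])
  finally show "inner2 M (\<lambda>s. LINT t|T. W t s) h = (LINT t|T. inner2 M (W t) h)"
    by (simp add: inner2_def)
qed

section \<open>The positive half-line\<close>

lemma L2_eq: "L2 = {f. sq_int Rplus f}"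
  by (auto simp: L2_def sq_int_def)

lemma L2_norm_eq: "L2_norm = norm2 Rplus"
  by (intro ext) (simp add: L2_norm_def norm2_def)

lemma L2_inner_eq: "L2_inner = inner2 Rplus"
  by (intro ext) (simp add: L2_inner_def inner2_def)

lemma space_Rplus [simp]: "space Rplus = {0<..}"
  by (simp add: Rplus_def)

lemma sets_Rplus: "sets Rplus = sets (restrict_space borel {0<..})"
  unfolding Rplus_def by (rule sets_restrict_space_cong) simp

lemma measurable_Rplus_borel: "f \<in> borel_measurable borel \<Longrightarrow> f \<in> borel_measurable Rplus"
  unfolding Rplus_def by (intro measurable_restrict_space1) simp

lemma measurable_ident_Rplus: "(\<lambda>x. x) \<in> borel_measurable Rplus"
  by (rule measurable_Rplus_borel) simp

lemma measurable_into_Rplus: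
  assumes [measurable]: "f \<in> borel_measurable M" and "\<And>x. x \<in> space M \<Longrightarrow> 0 < f x"
  shows "f \<in> M \<rightarrow>\<^sub>M Rplus"
proof -
  have "f \<in> M \<rightarrow>\<^sub>M restrict_space borel {0<..}"
    by (rule measurable_restrict_space2) (use assms in auto)
  thus ?thesis by (simp cong: measurable_cong_sets add: sets_Rplus)
qed

interpretation Rplus: sigma_finite_measure Rplus
  unfolding Rplus_def
  by (intro sigma_finite_measure_restrict_space sigma_finite_lborel) auto

interpretation Rplus2: pair_sigma_finite Rplus Rplus ..

lemma pair_sigma_finite_Rplus: "pair_sigma_finite Rplus Rplus" ..

lemma measurable_mult_Rplus [measurable]:
  "(\<lambda>p. fst p * snd p) \<in> Rplus \<Otimes>\<^sub>M Rplus \<rightarrow>\<^sub>M Rplus"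
proof -
  note measurable_ident_Rplus [measurable]
  show ?thesis by (rule measurable_into_Rplus) (measurable, auto simp: space_pair_measure)
qed

lemma measurable_scale_Rplus: "0 < r \<Longrightarrow> (\<lambda>s. r * s) \<in> Rplus \<rightarrow>\<^sub>M Rplus"
  by (rule measurable_into_Rplus) (auto intro: borel_measurable_times measurable_ident_Rplus)

lemma integral_Rplus:
  fixes f :: "real \<Rightarrow> 'b :: {banach, second_countable_topology}"
  shows "(LINT s|Rplus. f s) = (LINT s|lborel. indicator {0<..} s *\<^sub>R f s)"
  unfolding Rplus_def by (subst integral_restrict_space) auto

lemma integrable_Rplus:
  fixes f :: "real \<Rightarrow> 'b :: {banach, second_countable_topology}"
  shows "integrable Rplus f \<longleftrightarrow> integrable lborel (\<lambda>s. indicator {0<..} s *\<^sub>R f s)"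
  unfolding Rplus_def by (subst integrable_restrict_space) auto

lemma AE_Rplus: "(AE s in Rplus. P s) \<longleftrightarrow> (AE s in lborel. 0 < s \<longrightarrow> P s)"
  unfolding Rplus_def by (subst AE_restrict_space_iff) auto

lemma integral_Rplus_scale:
  fixes f :: "real \<Rightarrow> 'b :: {banach, second_countable_topology}"
  assumes "0 < r"
  shows "(LINT s|Rplus. f (r * s)) = (1 / r) *\<^sub>R (LINT s|Rplus. f s)"
proof -
  have ind: "indicator {0<..} (0 + r * s) = (indicator {0<..} s :: real)" for s :: real
    using assms by (auto simp: indicator_def zero_less_mult_iff)
  have "(LINT s|lborel. indicator {0<..} s *\<^sub>R f s)
      = \<bar>r\<bar> *\<^sub>R (LINT s|lborel. indicator {0<..} (0 + r * s) *\<^sub>R f (0 + r * s))"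
    by (rule lborel_integral_real_affine) (use assms in auto)
  thus ?thesis using assms unfolding integral_Rplus ind by simp
qed

lemma integrable_Rplus_scale:
  fixes f :: "real \<Rightarrow> 'b :: {banach, second_countable_topology}"
  assumes "0 < r"
  shows "integrable Rplus (\<lambda>s. f (r * s)) \<longleftrightarrow> integrable Rplus f"
proof -
  have ind: "indicator {0<..} (0 + r * s) = (indicator {0<..} s :: real)" for s :: real
    using assms by (auto simp: indicator_def zero_less_mult_iff)
  show ?thesis
    using lborel_integrable_real_affine_iff[of r "\<lambda>s. indicator {0<..} s *\<^sub>R f s" 0] assms
    unfolding integrable_Rplus ind by simp
qed

lemma sq_int_scale_arg:
  assumes "sq_int Rplus f" "0 < r"
  shows "sq_int Rplus (\<lambda>s. f (r * s))"
    and norm2_scale_arg: "norm2 Rplus (\<lambda>s. f (r * s)) = norm2 Rplus f / sqrt r"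
proof -
  show "sq_int Rplus (\<lambda>s. f (r * s))"
    using assms integrable_Rplus_scale[OF assms(2), of "\<lambda>s. (cmod (f s))\<^sup>2"]
      measurable_compose[OF measurable_scale_Rplus[OF assms(2)], of f borel]
    by (auto simp: sq_int_def)
  show "norm2 Rplus (\<lambda>s. f (r * s)) = norm2 Rplus f / sqrt r"
    unfolding norm2_def integral_Rplus_scale[OF assms(2), of "\<lambda>s. (cmod (f s))\<^sup>2"]
    by (simp add: real_sqrt_divide)
qed

section \<open>Exponential functions and the Laplace transform\<close>

lemma integral_exp_Rplus:
  fixes c :: complex
  assumes "0 < Re c"
  shows "integrable Rplus (\<lambda>t. exp (- (c * of_real t)))"
    and "(LINT t|Rplus. exp (- (c * of_real t))) = 1 / c"
proof -
  have c0: "c \<noteq> 0" using assms by auto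
  have "(\<lambda>x. exp (- Re c * x)) absolutely_integrable_on {0..}"
    using has_integral_exp_minus_to_infinity[OF assms, of 0]
    by (intro nonnegative_absolutely_integrable_1) (auto simp: integrable_on_def)
  hence "set_integrable lborel {0..} (\<lambda>x. exp (- Re c * x))"
    unfolding set_integrable_def by (subst (asm) integrable_completion) auto
  hence "set_integrable lborel {0<..} (\<lambda>x. exp (- Re c * x))"
    by (rule set_integrable_subset) auto
  hence "integrable Rplus (\<lambda>x. exp (- Re c * x))"
    by (simp add: integrable_Rplus set_integrable_def)
  thus i: "integrable Rplus (\<lambda>t. exp (- (c * of_real t)))"
  proof (rule Bochner_Integration.integrable_bound)
    show "(\<lambda>t. exp (- (c * of_real t))) \<in> borel_measurable Rplus"
      by (intro measurable_Rplus_borel borel_measurable_continuous_onI continuous_intros)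
  qed auto
  have "(LBINT x=0..\<infinity>. exp (- (c * of_real x))) = 0 - (- 1 / c)"
  proof (rule interval_integral_FTC_integrable[where F = "\<lambda>x. - exp (- (c * of_real x)) / c"])
    show "((\<lambda>x. - exp (- (c * of_real x)) / c) has_vector_derivative exp (- (c * of_real x))) (at x)"
      for x :: real
      using c0 by (auto intro!: derivative_eq_intros has_vector_derivative_real_field)
    show "set_integrable lborel (einterval 0 \<infinity>) (\<lambda>x. exp (- (c * of_real x)))"
      using i by (simp add: integrable_Rplus set_integrable_def zero_ereal_def)
    show "(((\<lambda>x. - exp (- (c * of_real x)) / c) \<circ> real_of_ereal) \<longlongrightarrow> - 1 / c) (at_right 0)"
      unfolding zero_ereal_def ereal_tendsto_simps
      by (rule tendsto_eq_intros | use c0 in simp)+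
    show "(((\<lambda>x. - exp (- (c * of_real x)) / c) \<circ> real_of_ereal) \<longlongrightarrow> 0) (at_left \<infinity>)"
      unfolding ereal_tendsto_simps
    proof (rule tendsto_norm_zero_cancel)
      have "((\<lambda>x. exp (- (Re c * x))) \<longlongrightarrow> 0) at_top"
        using assms by real_asymp
      hence "((\<lambda>x. exp (- (Re c * x)) / cmod c) \<longlongrightarrow> 0 / cmod c) at_top"
        by (rule tendsto_divide) (use c0 in auto)
      thus "((\<lambda>x. norm (- exp (- (c * of_real x)) / c)) \<longlongrightarrow> 0) at_top"
        by (simp add: norm_divide)
    qed
  qed auto
  thus "(LINT t|Rplus. exp (- (c * of_real t))) = 1 / c"
    by (simp add: integral_Rplus interval_lebesgue_integral_def set_lebesgue_integral_def zero_ereal_def)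
qed

lemma exp_mult_cnj_exp:
  "exp (- (z * complex_of_real t)) * cnj (exp (- (w * complex_of_real t)))
     = exp (- ((z + cnj w) * complex_of_real t))"
  by (simp add: exp_cnj mult_exp_exp algebra_simps)

lemma sq_int_exp:
  assumes "0 < Re z"
  shows "sq_int Rplus (\<lambda>t. exp (- (z * of_real t)))"
proof -
  have "integrable Rplus (\<lambda>t. Re (exp (- ((z + cnj z) * complex_of_real t))))"
    by (intro integrable_Re integral_exp_Rplus) (use assms in simp)
  moreover have "Re (exp (- ((z + cnj z) * complex_of_real t))) = (cmod (exp (- (z * of_real t))))\<^sup>2" for t
    unfolding exp_mult_cnj_exp[symmetric] complex_norm_square[symmetric] by simp
  ultimately show ?thesis
    by (auto simp: sq_int_def intro!: measurable_Rplus_borel borel_measurable_continuous_onI continuous_intros)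
qed

lemma inner2_exp:
  assumes "0 < Re z" "0 < Re w"
  shows "inner2 Rplus (\<lambda>t. exp (- (z * of_real t))) (\<lambda>t. exp (- (w * of_real t))) = 1 / (z + cnj w)"
  unfolding inner2_def exp_mult_cnj_exp by (rule integral_exp_Rplus(2)) (use assms in simp)

text \<open>Evaluation of the transform at a point is a pairing with an exponential. Linearity, the
  pointwise bound and the reproducing kernel all come from this form.\<close>

lemma laplace_eq_inner2: "laplace f z = inner2 Rplus f (\<lambda>t. exp (- (cnj z * of_real t)))"
  by (simp add: laplace_def inner2_def exp_cnj)

text \<open>The positive and the negative part are densities of two finite measures that agree on
  all half-lines, hence coincide. Equal parts must vanish, since at each point one of them is
  zero.\<close>

lemma AE_zero_of_tail_integrals:
  fixes F :: "real \<Rightarrow> real"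
  assumes F: "integrable lborel F" and zero: "\<And>b. (LINT t|lborel. indicator {b<..} t * F t) = 0"
  shows "AE t in lborel. F t = 0"
proof -
  have [measurable]: "F \<in> borel_measurable borel" using F by simp
  let ?p = "\<lambda>t. ennreal (F t)" and ?m = "\<lambda>t. ennreal (- F t)"
  have fin: "(\<integral>\<^sup>+t. ?p t \<partial>lborel) < \<infinity>" "(\<integral>\<^sup>+t. ?m t \<partial>lborel) < \<infinity>"
    using F real_integrable_def[of lborel F] by (auto simp: less_top)
  have enn2real_inj: "x = y" if "x \<noteq> \<infinity>" "y \<noteq> \<infinity>" "enn2real x = enn2real y" for x y
    using that by (cases x; cases y) auto
  have eq: "(\<integral>\<^sup>+t. ?p t * indicator {b<..} t \<partial>lborel) = (\<integral>\<^sup>+t. ?m t * indicator {b<..} t \<partial>lborel)" for b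
  proof -
    have i: "integrable lborel (\<lambda>t. indicator {b<..} t * F t)"
      using integrable_mult_indicator[OF _ F, of "{b<..}"] by simp
    have "(\<integral>\<^sup>+t. ennreal (indicator {b<..} t * F t) \<partial>lborel) \<noteq> \<infinity>"
         "(\<integral>\<^sup>+t. ennreal (- (indicator {b<..} t * F t)) \<partial>lborel) \<noteq> \<infinity>"
      using i unfolding real_integrable_def by auto
    moreover have "enn2real (\<integral>\<^sup>+t. ennreal (indicator {b<..} t * F t) \<partial>lborel)
        = enn2real (\<integral>\<^sup>+t. ennreal (- (indicator {b<..} t * F t)) \<partial>lborel)"
      using real_lebesgue_integral_def[OF i] zero[of b] by simp
    ultimately have "(\<integral>\<^sup>+t. ennreal (indicator {b<..} t * F t) \<partial>lborel)
        = (\<integral>\<^sup>+t. ennreal (- (indicator {b<..} t * F t)) \<partial>lborel)"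
      by (rule enn2real_inj)
    moreover have "ennreal (indicator {b<..} t * F t) = ?p t * indicator {b<..} t"
      "ennreal (- (indicator {b<..} t * F t)) = ?m t * indicator {b<..} t" for t
      by (auto simp: indicator_def)
    ultimately show ?thesis by simp
  qed
  have "density lborel ?p = density lborel ?m"
  proof (rule measure_eqI_lessThan)
    fix b :: real
    have "emeasure (density lborel ?p) {b<..} \<le> (\<integral>\<^sup>+t. ?p t \<partial>lborel)"
      by (subst emeasure_density) (auto intro!: nn_integral_mono simp: indicator_def)
    thus "emeasure (density lborel ?p) {b<..} < \<infinity>" using fin(1) by (rule order_le_less_trans)
    show "emeasure (density lborel ?p) {b<..} = emeasure (density lborel ?m) {b<..}"
      by (simp add: emeasure_density eq)
  qed auto
  hence "AE t in lborel. ?p t = ?m t"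
    by (subst (asm) finite_density_unique) (use fin in auto)
  thus ?thesis
  proof eventually_elim
    case (elim t)
    thus ?case by (cases "0 \<le> F t") (auto simp: ennreal_neg ennreal_eq_0_iff)
  qed
qed

text \<open>
  Lerch's theorem. The function \<open>exp (- exp (n * (b - t)))\<close> is a convergent series in the
  exponentials \<open>exp (- (k * n * t))\<close> and approximates the indicator of \<open>t > b\<close>.
\<close>

lemma laplace_unique_nat:
  fixes G :: "real \<Rightarrow> complex"
  assumes G: "integrable Rplus G"
    and zero: "\<And>k::nat. (LINT t|Rplus. G t * of_real (exp (- (real k * t)))) = 0"
  shows "AE t in Rplus. G t = 0"
proof -
  have [measurable]: "G \<in> borel_measurable Rplus" using G by simp
  have smooth: "(LINT t|Rplus. G t * of_real (exp (- exp (real n * (b - t))))) = 0" for n b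
  proof -
    define f where "f k t = G t * of_real ((- exp (real n * (b - t))) ^ k /\<^sub>R fact k)" for k t
    have f_eq: "f k t = of_real ((- exp (real n * b)) ^ k / fact k) * (G t * of_real (exp (- (real (k * n) * t))))" for k t
    proof -
      have "exp (real n * (b - t)) ^ k = exp (real n * b) ^ k * exp (- (real (k * n) * t))"
        by (simp add: exp_of_nat_mult[symmetric] exp_add[symmetric] algebra_simps)
      thus ?thesis unfolding f_def power_minus[of "exp _"] by (simp add: divide_inverse mult_ac)
    qed
    have int: "integrable Rplus (\<lambda>t. G t * of_real (exp (- (real k * t))))" for k
    proof (rule Bochner_Integration.integrable_bound[OF G])
      show "AE t in Rplus. norm (G t * of_real (exp (- (real k * t)))) \<le> norm (G t)"
        by (auto simp: AE_Rplus norm_mult intro!: AE_I2 mult_right_le_one_le)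
      have [measurable]: "(\<lambda>t::real. complex_of_real (exp (- (real k * t)))) \<in> borel_measurable Rplus"
        by (rule measurable_Rplus_borel) measurable
      show "(\<lambda>t. G t * of_real (exp (- (real k * t)))) \<in> borel_measurable Rplus" by measurable
    qed
    have fint: "integrable Rplus (f k)" for k
      unfolding f_eq by (intro integrable_mult_right int)
    have f0: "(LINT t|Rplus. f k t) = 0" for k
      unfolding f_eq by (subst integral_mult_right_zero) (simp only: zero mult_zero_right)
    have sums: "(\<lambda>k. f k t) sums (G t * of_real (exp (- exp (real n * (b - t)))))" for t
      unfolding f_def by (intro sums_mult sums_of_real exp_converges)
    have nf: "norm (f k t) = norm (G t) * (exp (real n * (b - t)) ^ k /\<^sub>R fact k)" for k t
      unfolding f_def norm_mult norm_of_real by (simp add: power_abs abs_mult)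
    have "(\<lambda>k. LINT t|Rplus. f k t) sums (LINT t|Rplus. (\<Sum>k. f k t))"
    proof (rule sums_integral[OF fint])
      show "AE t in Rplus. summable (\<lambda>k. norm (f k t))"
        unfolding nf by (intro AE_I2 summable_mult sums_summable[OF exp_converges])
      show "summable (\<lambda>k. LINT t|Rplus. norm (f k t))"
      proof (rule summable_comparison_test')
        show "summable (\<lambda>k. (LINT t|Rplus. norm (G t)) * (exp (real n * b) ^ k /\<^sub>R fact k))"
          by (intro summable_mult sums_summable[OF exp_converges])
        fix k :: nat
        \<comment> \<open>For positive \<open>t\<close> the factor \<open>exp (n * (b - t))\<close>
          is at most \<open>exp (n * b)\<close>, so an exponential series dominates the integrated
          norms.\<close>
        have "(LINT t|Rplus. norm (f k t)) \<le> (LINT t|Rplus. norm (G t) * (exp (real n * b) ^ k /\<^sub>R fact k))"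
        proof (rule integral_mono_AE)
          show "AE t in Rplus. norm (f k t) \<le> norm (G t) * (exp (real n * b) ^ k /\<^sub>R fact k)"
            unfolding nf AE_Rplus
            by (auto intro!: AE_I2 mult_left_mono power_mono)
        qed (use fint G in auto)
        thus "norm (LINT t|Rplus. norm (f k t)) \<le> (LINT t|Rplus. norm (G t)) * (exp (real n * b) ^ k /\<^sub>R fact k)"
          by simp
      qed
    qed
    moreover have "(\<Sum>k. f k t) = G t * of_real (exp (- exp (real n * (b - t))))" for t
      using sums[of t] by (rule sums_unique[symmetric])
    ultimately have "(\<lambda>k::nat. 0::complex) sums (LINT t|Rplus. G t * of_real (exp (- exp (real n * (b - t)))))"
      by (simp add: f0)
    thus ?thesis using sums_unique2[OF _ sums_zero] by blast
  qed
  have tail: "(LINT t|Rplus. G t * indicator {b<..} t) = 0" for b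
  proof -
    have "(\<lambda>n. LINT t|Rplus. G t * of_real (exp (- exp (real n * (b - t)))))
        \<longlonglongrightarrow> (LINT t|Rplus. G t * indicator {b<..} t)"
    proof (rule integral_dominated_convergence[where w = "\<lambda>t. norm (G t)"])
      have [measurable]: "(\<lambda>t::real. complex_of_real (exp (- exp (real n * (b - t))))) \<in> borel_measurable Rplus" for n
        by (rule measurable_Rplus_borel) measurable
      show "(\<lambda>t. G t * of_real (exp (- exp (real n * (b - t))))) \<in> borel_measurable Rplus" for n
        by measurable
      have [measurable]: "(\<lambda>t::real. indicator {b<..} t :: complex) \<in> borel_measurable Rplus"
        by (rule measurable_Rplus_borel) measurable
      show "(\<lambda>t. G t * indicator {b<..} t) \<in> borel_measurable Rplus" by measurable
      show "integrable Rplus (\<lambda>t. norm (G t))" using G by simp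
      show "AE t in Rplus. norm (G t * of_real (exp (- exp (real n * (b - t))))) \<le> norm (G t)" for n
        by (auto simp: norm_mult intro!: AE_I2 mult_right_le_one_le)
      \<comment> \<open>At \<open>t = b\<close> the sequence is constantly \<open>exp (- 1)\<close>,
        which is neither value of the indicator.\<close>
      have "AE t in lborel. t \<noteq> b" by (rule AE_lborel_singleton)
      hence "AE t in lborel. 0 < t \<longrightarrow> t \<noteq> b" by auto
      hence "AE t in Rplus. t \<noteq> b" by (simp add: AE_Rplus)
      thus "AE t in Rplus. (\<lambda>n. G t * of_real (exp (- exp (real n * (b - t))))) \<longlonglongrightarrow> G t * indicator {b<..} t"
      proof eventually_elim
        case (elim t)
        have "(\<lambda>n. exp (- exp (real n * (b - t)))) \<longlonglongrightarrow> indicator {b<..} t"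
        proof (cases "b < t")
          case True
          hence "b - t < 0" by simp
          hence "(\<lambda>n. exp (- exp (real n * (b - t)))) \<longlonglongrightarrow> 1" by real_asymp
          with True show ?thesis by simp
        next
          case False
          hence "0 < b - t" using elim by simp
          hence "(\<lambda>n. exp (- exp (real n * (b - t)))) \<longlonglongrightarrow> 0" by real_asymp
          with False show ?thesis by simp
        qed
        hence "(\<lambda>n. G t * of_real (exp (- exp (real n * (b - t))))) \<longlonglongrightarrow> G t * of_real (indicator {b<..} t)"
          by (intro tendsto_intros)
        moreover have "complex_of_real (indicator {b<..} t) = indicator {b<..} t"
          by (simp add: indicator_def)
        ultimately show ?case by simp
      qed
    qed
    hence "(\<lambda>n::nat. 0::complex) \<longlonglongrightarrow> (LINT t|Rplus. G t * indicator {b<..} t)"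
      by (simp add: smooth)
    thus ?thesis using LIMSEQ_unique tendsto_const by blast
  qed
  have int: "integrable Rplus (\<lambda>t. G t * indicator {b<..} t)" for b
  proof (rule Bochner_Integration.integrable_bound[OF G])
    have [measurable]: "(\<lambda>t::real. indicator {b<..} t :: complex) \<in> borel_measurable Rplus"
      by (rule measurable_Rplus_borel) measurable
    show "(\<lambda>t. G t * indicator {b<..} t) \<in> borel_measurable Rplus" by measurable
  qed (auto simp: indicator_def)
  have "AE t in lborel. indicator {0<..} t * Re (G t) = 0"
  proof (rule AE_zero_of_tail_integrals)
    show "integrable lborel (\<lambda>t. indicator {0<..} t * Re (G t))"
      using integrable_Re[OF G] by (simp add: integrable_Rplus)
    show "(LINT t|lborel. indicator {b<..} t * (indicator {0<..} t * Re (G t))) = 0" for b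
    proof -
      have "(LINT t|lborel. indicator {b<..} t * (indicator {0<..} t * Re (G t)))
          = (LINT t|Rplus. Re (G t * indicator {b<..} t))"
        unfolding integral_Rplus by (intro Bochner_Integration.integral_cong) (auto simp: indicator_def)
      thus ?thesis using tail[of b] int[of b] by (simp del: times_complex.sel)
    qed
  qed
  moreover have "AE t in lborel. indicator {0<..} t * Im (G t) = 0"
  proof (rule AE_zero_of_tail_integrals)
    show "integrable lborel (\<lambda>t. indicator {0<..} t * Im (G t))"
      using integrable_Im[OF G] by (simp add: integrable_Rplus)
    show "(LINT t|lborel. indicator {b<..} t * (indicator {0<..} t * Im (G t))) = 0" for b
    proof -
      have "(LINT t|lborel. indicator {b<..} t * (indicator {0<..} t * Im (G t)))
          = (LINT t|Rplus. Im (G t * indicator {b<..} t))"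
        unfolding integral_Rplus by (intro Bochner_Integration.integral_cong) (auto simp: indicator_def)
      thus ?thesis using tail[of b] int[of b] by (simp del: times_complex.sel)
    qed
  qed
  ultimately show ?thesis unfolding AE_Rplus
    by eventually_elim (auto simp: complex_eq_iff)
qed

text \<open>Multiplication by \<open>exp (- t)\<close> makes \<open>f\<close> integrable and shifts
  the exponents; the values of the transform at \<open>1, 2, 3, ...\<close> already determine
  \<open>f\<close>.\<close>

lemma laplace_inj:
  assumes f: "sq_int Rplus f" and zero: "\<And>a. 0 < a \<Longrightarrow> laplace f (of_real a) = 0"
  shows "AE t in Rplus. f t = 0"
proof -
  have "AE t in Rplus. f t * exp (- of_real t) = 0"
  proof (rule laplace_unique_nat)
    show "integrable Rplus (\<lambda>t. f t * exp (- of_real t))"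
      using integrable_inner2[OF f sq_int_exp[of 1]] by (simp add: exp_cnj)
    fix k :: nat
    have "exp (- complex_of_real t) * of_real (exp (- (real k * t))) = exp (- (of_real (1 + real k) * of_real t))" for t
      unfolding exp_of_real[symmetric] mult_exp_exp by (simp add: algebra_simps)
    hence "f t * exp (- of_real t) * of_real (exp (- (real k * t)))
        = f t * exp (- (of_real (1 + real k) * of_real t))" for t
      by (simp only: mult.assoc)
    thus "(LINT t|Rplus. f t * exp (- of_real t) * of_real (exp (- (real k * t)))) = 0"
      using zero[of "1 + real k"] by (simp only: laplace_def)
  qed
  thus ?thesis by simp
qed

section \<open>Sums of exponentials and their density\<close>

definition expsum :: "(complex \<times> real) list \<Rightarrow> real \<Rightarrow> complex" where
  "expsum xs t = (\<Sum>(c, a)\<leftarrow>xs. c * exp (- (of_real a * of_real t)))"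

definition pos_exponents :: "(complex \<times> real) list set" where
  "pos_exponents = {xs. \<forall>(c, a)\<in>set xs. 0 < a}"

lemma expsum_simps [simp]:
  "expsum [] t = 0"
  "expsum ((c, a) # xs) t = c * exp (- (of_real a * of_real t)) + expsum xs t"
  by (simp_all add: expsum_def)

lemma pos_exponents_simps [simp]:
  "[] \<in> pos_exponents"
  "(c, a) # xs \<in> pos_exponents \<longleftrightarrow> 0 < a \<and> xs \<in> pos_exponents"
  by (auto simp: pos_exponents_def)

lemma sq_int_expsum: "xs \<in> pos_exponents \<Longrightarrow> sq_int Rplus (expsum xs)"
proof (induction xs)
  case Nil
  have "expsum [] = (\<lambda>t. 0)" by (rule ext) simp
  thus ?case by simp
next
  case (Cons x xs)
  obtain c a where x: "x = (c, a)" by (cases x)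
  have "expsum (x # xs) = (\<lambda>t. c * exp (- (of_real a * of_real t)) + expsum xs t)"
    by (rule ext) (simp add: x)
  with Cons show ?case by (auto simp: x intro!: sq_int_add(1) sq_int_scale sq_int_exp)
qed

text \<open>
  On exponential sums every linear functional is determined by its values \<open>h a\<close> on exponentials.
\<close>

definition explin :: "(real \<Rightarrow> complex) \<Rightarrow> (complex \<times> real) list \<Rightarrow> complex" where
  "explin h xs = (\<Sum>(c, a)\<leftarrow>xs. c * h a)"

lemma explin_simps [simp]:
  "explin h [] = 0"
  "explin h ((c, a) # xs) = c * h a + explin h xs"
  by (simp_all add: explin_def)

lemma expsum_linear:
  assumes "xs \<in> pos_exponents" "ys \<in> pos_exponents"
  shows "\<exists>zs\<in>pos_exponents. (\<forall>t. expsum zs t = expsum xs t + c * expsum ys t)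
     \<and> (\<forall>h. explin h zs = explin h xs + c * explin h ys)"
proof (intro bexI conjI allI)
  let ?zs = "xs @ map (\<lambda>(d, a). (c * d, a)) ys"
  show "?zs \<in> pos_exponents" using assms by (auto simp: pos_exponents_def)
  have app: "expsum (xs @ zs) t = expsum xs t + expsum zs t" "explin h (xs @ zs) = explin h xs + explin h zs"
    for xs zs t h by (simp_all add: expsum_def explin_def)
  have mp: "expsum (map (\<lambda>(d, a). (c * d, a)) ys) t = c * expsum ys t"
    "explin h (map (\<lambda>(d, a). (c * d, a)) ys) = c * explin h ys" for t h
    by (induction ys) (auto simp: algebra_simps)
  show "expsum ?zs t = expsum xs t + c * expsum ys t" for t by (simp add: app mp)
  show "explin h ?zs = explin h xs + c * explin h ys" for h by (simp add: app mp)
qed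

lemma inner2_expsum:
  assumes "sq_int Rplus g"
  shows "xs \<in> pos_exponents \<Longrightarrow> inner2 Rplus (expsum xs) g = explin (\<lambda>a. cnj (laplace g (of_real a))) xs"
proof (induction xs)
  case Nil
  have "expsum [] = (\<lambda>t. 0)" by (rule ext) simp
  thus ?case by (simp add: inner2_def)
next
  case (Cons x xs)
  obtain c a where x: "x = (c, a)" by (cases x)
  have e: "expsum (x # xs) = (\<lambda>t. c * exp (- (of_real a * of_real t)) + expsum xs t)"
    by (rule ext) (simp add: x)
  have "inner2 Rplus (\<lambda>t. exp (- (of_real a * of_real t))) g = cnj (laplace g (of_real a))"
    unfolding laplace_eq_inner2 by (subst inner2_commute) simp
  with Cons show ?case unfolding e using assms
    by (subst inner2_add_left) (auto simp: x inner2_scale_left intro!: sq_int_scale sq_int_exp sq_int_expsum)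
qed

text \<open>Serves two purposes: with \<open>h\<close> read off from a square-integrable function it
  gives density of the exponential sums, and with \<open>h\<close> read off from a Hardy function it
  gives surjectivity of the transform. Different lists may denote the same function; by linearity
  the norm bound makes \<open>explin h\<close> depend on the function only.\<close>

lemma expsum_Riesz:
  assumes bd: "\<And>xs. xs \<in> pos_exponents \<Longrightarrow> cmod (explin h xs) \<le> B * norm2 Rplus (expsum xs)" and "0 \<le> B"
  obtains g xs where "sq_int Rplus g" "norm2 Rplus g \<le> B" "\<And>a. 0 < a \<Longrightarrow> laplace g (of_real a) = cnj (h a)"
    "\<And>n. xs n \<in> pos_exponents" "(\<lambda>n. norm2 Rplus (\<lambda>t. expsum (xs n) t - g t)) \<longlonglongrightarrow> 0"
proof -
  show thesis
  proof (rule Riesz_subspace[where I = pos_exponents and ?i0.0 = "[]" and v = expsum and \<phi> = "explin h"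
          and M = Rplus and B = B])
    fix g k
    assume g: "sq_int Rplus g" "norm2 Rplus g \<le> B"
      and rep: "\<And>xs. xs \<in> pos_exponents \<Longrightarrow> explin h xs = inner2 Rplus (expsum xs) g"
      and k: "\<And>n::nat. k n \<in> pos_exponents" "(\<lambda>n. norm2 Rplus (\<lambda>t. expsum (k n) t - g t)) \<longlonglongrightarrow> 0"
    have gL: "laplace g (of_real a) = cnj (h a)" if "0 < a" for a
      using rep[of "[(1, a)]"] that by (simp add: inner2_expsum[OF g(1)])
    show thesis
      by (rule that[of g k]) (fact g gL k)+
  next
    fix xs ys c assume "xs \<in> pos_exponents" "ys \<in> pos_exponents"
    from expsum_linear[OF this, of c]
    show "\<exists>k\<in>pos_exponents. (AE t in Rplus. expsum k t = expsum xs t + c * expsum ys t)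
        \<and> explin h k = explin h xs + c * explin h ys" by auto
  next
    show "[] \<in> pos_exponents" by simp
  next
    fix xs assume xs: "xs \<in> pos_exponents"
    show "sq_int Rplus (expsum xs)" by (rule sq_int_expsum[OF xs])
    show "cmod (explin h xs) \<le> B * norm2 Rplus (expsum xs)" by (rule bd[OF xs])
  qed (rule \<open>0 \<le> B\<close>)
qed

text \<open>Pairing with \<open>f\<close> is a bounded functional on exponential sums, represented
  by some limit \<open>g\<close> of such sums. Then \<open>f\<close> and \<open>g\<close> have the
  same transform on the positive reals and agree by Lerch's theorem.\<close>

lemma expsum_dense:
  assumes f: "sq_int Rplus f"
  obtains xs where "\<And>n. xs n \<in> pos_exponents" "(\<lambda>n. norm2 Rplus (\<lambda>t. expsum (xs n) t - f t)) \<longlonglongrightarrow> 0"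
proof -
  define h where "h a = cnj (laplace f (of_real a))" for a :: real
  have bd: "cmod (explin h xs) \<le> norm2 Rplus f * norm2 Rplus (expsum xs)" if "xs \<in> pos_exponents" for xs
    using inner2_le_norm2[OF sq_int_expsum[OF that] f] inner2_expsum[OF f that]
    by (simp add: h_def[abs_def] mult.commute)
  obtain g xs where g: "sq_int Rplus g" and gL: "\<And>a. 0 < a \<Longrightarrow> laplace g (of_real a) = cnj (h a)"
    and xs: "\<And>n. xs n \<in> pos_exponents" "(\<lambda>n. norm2 Rplus (\<lambda>t. expsum (xs n) t - g t)) \<longlonglongrightarrow> 0"
  proof (rule expsum_Riesz[where h = h and B = "norm2 Rplus f"])
    fix xs assume "xs \<in> pos_exponents"
    thus "cmod (explin h xs) \<le> norm2 Rplus f * norm2 Rplus (expsum xs)" by (rule bd)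
  next
    show "0 \<le> norm2 Rplus f" by simp
  next
    fix g xs
    assume "sq_int Rplus g" "\<And>a. 0 < a \<Longrightarrow> laplace g (of_real a) = cnj (h a)"
      "\<And>n::nat. xs n \<in> pos_exponents" "(\<lambda>n. norm2 Rplus (\<lambda>t. expsum (xs n) t - g t)) \<longlonglongrightarrow> 0"
    thus thesis by (rule that[of g xs])
  qed
  have "AE t in Rplus. f t - g t = 0"
  proof (rule laplace_inj)
    show "sq_int Rplus (\<lambda>t. f t - g t)" by (rule sq_int_diff[OF f g])
    fix a :: real assume a: "0 < a"
    have "laplace (\<lambda>t. f t - g t) (of_real a) = laplace f (of_real a) - laplace g (of_real a)"
      unfolding laplace_eq_inner2 using a by (intro inner2_diff_left f g sq_int_exp) simp
    thus "laplace (\<lambda>t. f t - g t) (of_real a) = 0" using gL[OF a] by (simp add: h_def)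
  qed
  hence eq: "AE t in Rplus. g t = f t" by eventually_elim simp
  have "norm2 Rplus (\<lambda>t. expsum (xs n) t - f t) = norm2 Rplus (\<lambda>t. expsum (xs n) t - g t)" for n
    using f g sq_int_expsum[OF xs(1)[of n]] eq
    by (intro norm2_cong_AE) (auto simp: sq_int_def)
  with xs show ?thesis using that[of xs] by simp
qed


section \<open>Averages of dilations\<close>

text \<open>A multiplicative convolution, written as an average of dilates.\<close>

definition dil_avg :: "(real \<Rightarrow> real) \<Rightarrow> (real \<Rightarrow> complex) \<Rightarrow> real \<Rightarrow> complex" where
  "dil_avg \<kappa> f s = (LINT r|Rplus. of_real (\<kappa> r) * f (r * s))"

text \<open>Dilation by \<open>r\<close> has norm \<open>1 / sqrt r\<close>, so the last condition
  is absolute convergence of the average in norm.\<close>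

definition dil_kernel :: "(real \<Rightarrow> real) \<Rightarrow> bool" where
  "dil_kernel \<kappa> \<longleftrightarrow> \<kappa> \<in> borel_measurable Rplus \<and> (\<forall>r. 0 \<le> \<kappa> r) \<and> integrable Rplus (\<lambda>r. \<kappa> r / sqrt r)"

lemma measurable_dil:
  assumes [measurable]: "\<kappa> \<in> borel_measurable Rplus" "f \<in> borel_measurable Rplus"
  shows "(\<lambda>(r, s). complex_of_real (\<kappa> r) * f (r * s)) \<in> borel_measurable (Rplus \<Otimes>\<^sub>M Rplus)"
proof -
  have [measurable]: "(\<lambda>p. f (fst p * snd p)) \<in> borel_measurable (Rplus \<Otimes>\<^sub>M Rplus)"
    by (rule measurable_compose[OF measurable_mult_Rplus]) measurable
  show ?thesis unfolding split_def by measurable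
qed

text \<open>The hypotheses of \<open>Minkowski_integral\<close> for the family of weighted dilates,
  in the order in which they are passed on, followed by the resulting norm integral.\<close>

lemma dil_avg_aux:
  assumes \<kappa>: "dil_kernel \<kappa>" and f: "sq_int Rplus f"
  shows "(\<lambda>(r, s). complex_of_real (\<kappa> r) * f (r * s)) \<in> borel_measurable (Rplus \<Otimes>\<^sub>M Rplus)"
    and "\<And>r. r \<in> space Rplus \<Longrightarrow> sq_int Rplus (\<lambda>s. complex_of_real (\<kappa> r) * f (r * s))"
    and "integrable Rplus (\<lambda>r. norm2 Rplus (\<lambda>s. complex_of_real (\<kappa> r) * f (r * s)))"
    and "(LINT r|Rplus. norm2 Rplus (\<lambda>s. complex_of_real (\<kappa> r) * f (r * s)))
        = (LINT r|Rplus. \<kappa> r / sqrt r) * norm2 Rplus f"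
proof -
  show "(\<lambda>(r, s). complex_of_real (\<kappa> r) * f (r * s)) \<in> borel_measurable (Rplus \<Otimes>\<^sub>M Rplus)"
    by (rule measurable_dil) (use \<kappa> f in \<open>auto simp: dil_kernel_def sq_int_def\<close>)
  show "sq_int Rplus (\<lambda>s. complex_of_real (\<kappa> r) * f (r * s))" if "r \<in> space Rplus" for r
    using that by (intro sq_int_scale sq_int_scale_arg f) auto
  have n: "norm2 Rplus (\<lambda>s. complex_of_real (\<kappa> r) * f (r * s)) = \<kappa> r / sqrt r * norm2 Rplus f"
    if "r \<in> space Rplus" for r
    using that \<kappa> by (simp add: norm2_scale norm2_scale_arg[OF f] dil_kernel_def)
  show "integrable Rplus (\<lambda>r. norm2 Rplus (\<lambda>s. complex_of_real (\<kappa> r) * f (r * s)))"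
    using \<kappa> by (intro iffD2[OF Bochner_Integration.integrable_cong[OF refl n]] integrable_mult_left)
      (simp_all add: dil_kernel_def)
  show "(LINT r|Rplus. norm2 Rplus (\<lambda>s. complex_of_real (\<kappa> r) * f (r * s)))
        = (LINT r|Rplus. \<kappa> r / sqrt r) * norm2 Rplus f"
    unfolding integral_mult_left_zero[symmetric] by (rule Bochner_Integration.integral_cong[OF refl n])
qed

lemma sq_int_dil_avg:
  assumes "dil_kernel \<kappa>" "sq_int Rplus f"
  shows "sq_int Rplus (dil_avg \<kappa> f)"
  using Minkowski_integral(1)[OF pair_sigma_finite_Rplus dil_avg_aux(1-3)[OF assms]]
  by (simp add: dil_avg_def[abs_def])

lemma AE_integrable_dil:
  assumes "dil_kernel \<kappa>" "sq_int Rplus f"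
  shows "AE s in Rplus. integrable Rplus (\<lambda>r. of_real (\<kappa> r) * f (r * s))"
  using Minkowski_integral(3)[OF pair_sigma_finite_Rplus dil_avg_aux(1-3)[OF assms]] .

lemma inner2_dil_avg:
  assumes "dil_kernel \<kappa>" "sq_int Rplus f" "sq_int Rplus h"
  shows "inner2 Rplus (dil_avg \<kappa> f) h = (LINT r|Rplus. of_real (\<kappa> r) * inner2 Rplus (\<lambda>s. f (r * s)) h)"
  using inner2_integral_left(2)[OF pair_sigma_finite_Rplus dil_avg_aux(1-3)[OF assms(1,2)] assms(3)]
  by (simp add: dil_avg_def[abs_def] inner2_scale_left)

lemma dil_avg_linear:
  assumes "dil_kernel \<kappa>" "sq_int Rplus f" "sq_int Rplus g"
  shows "AE s in Rplus. dil_avg \<kappa> (\<lambda>s. f s + c * g s) s = dil_avg \<kappa> f s + c * dil_avg \<kappa> g s"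
  using AE_integrable_dil[OF assms(1,2)] AE_integrable_dil[OF assms(1,3)]
proof eventually_elim
  case (elim s)
  have "dil_avg \<kappa> (\<lambda>s. f s + c * g s) s
      = (LINT r|Rplus. of_real (\<kappa> r) * f (r * s) + c * (of_real (\<kappa> r) * g (r * s)))"
    unfolding dil_avg_def by (intro Bochner_Integration.integral_cong) (auto simp: algebra_simps)
  also have "\<dots> = dil_avg \<kappa> f s + c * dil_avg \<kappa> g s"
    unfolding dil_avg_def
    by (simp only: Bochner_Integration.integral_add[OF elim(1) integrable_mult_right[OF elim(2)]] integral_mult_right_zero)
  finally show ?case .
qed

text \<open>Pairing with \<open>g\<close> turns both compositions into the double integral of
  \<open>\<kappa> r * \<mu> q * I (r * q)\<close>, which sees the dilation factors only through
  their product. Stating the claim against \<open>g\<close> leaves scalar integrals to be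
  exchanged.\<close>

lemma dil_avg_commute:
  assumes \<kappa>: "dil_kernel \<kappa>" and \<mu>: "dil_kernel \<mu>" and f: "sq_int Rplus f" and g: "sq_int Rplus g"
  shows "inner2 Rplus (dil_avg \<kappa> (dil_avg \<mu> f)) g = inner2 Rplus (dil_avg \<mu> (dil_avg \<kappa> f)) g"
proof -
  define I where "I p = inner2 Rplus (\<lambda>s. f (p * s)) g" for p
  have [measurable]: "f \<in> borel_measurable Rplus" "g \<in> borel_measurable Rplus"
      "\<kappa> \<in> borel_measurable Rplus" "\<mu> \<in> borel_measurable Rplus"
    using assms by (auto simp: sq_int_def dil_kernel_def)
  have [measurable]: "(\<lambda>p. f (fst p * snd p)) \<in> borel_measurable (Rplus \<Otimes>\<^sub>M Rplus)"
    by (rule measurable_compose[OF measurable_mult_Rplus]) measurable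
  have "(\<lambda>(p, s). f (p * s) * cnj (g s)) \<in> borel_measurable (Rplus \<Otimes>\<^sub>M Rplus)"
    unfolding split_def by measurable
  hence I_meas [measurable]: "I \<in> borel_measurable Rplus"
    unfolding I_def[abs_def] inner2_def by (rule Rplus.borel_measurable_lebesgue_integral)
  have [measurable]: "(\<lambda>p. I (fst p * snd p)) \<in> borel_measurable (Rplus \<Otimes>\<^sub>M Rplus)"
    by (rule measurable_compose[OF measurable_mult_Rplus]) measurable
  \<comment> \<open>Since \<open>sqrt (r * q)\<close> factors, this decay majorises the double
    integral by a product of the two convergent integrals of \<open>dil_kernel\<close>.\<close>
  have I_le: "cmod (I p) \<le> norm2 Rplus f * norm2 Rplus g / sqrt p" if "0 < p" for p
    using inner2_le_norm2[OF sq_int_scale_arg(1)[OF f that] g]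
    by (simp add: I_def norm2_scale_arg[OF f that])
  have expand: "inner2 Rplus (dil_avg \<kappa> (dil_avg \<mu> f)) g
      = (LINT r|Rplus. LINT q|Rplus. of_real (\<kappa> r * \<mu> q) * I (q * r))"
    if k: "dil_kernel \<kappa>" and m: "dil_kernel \<mu>" for \<kappa> \<mu>
  proof -
    have "inner2 Rplus (\<lambda>s. dil_avg \<mu> f (r * s)) g = (LINT q|Rplus. of_real (\<mu> q) * I (q * r))"
      if "r \<in> space Rplus" for r
    proof -
      have "(\<lambda>s. dil_avg \<mu> f (r * s)) = dil_avg \<mu> (\<lambda>s. f (r * s))"
        unfolding dil_avg_def[abs_def] by (simp add: mult.left_commute)
      thus ?thesis
        using inner2_dil_avg[OF m sq_int_scale_arg(1)[OF f] g, of r] that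
        by (simp add: I_def mult_ac)
    qed
    hence "inner2 Rplus (dil_avg \<kappa> (dil_avg \<mu> f)) g
        = (LINT r|Rplus. of_real (\<kappa> r) * (LINT q|Rplus. of_real (\<mu> q) * I (q * r)))"
      unfolding inner2_dil_avg[OF k sq_int_dil_avg[OF m f] g]
      by (intro Bochner_Integration.integral_cong) auto
    also have "\<dots> = (LINT r|Rplus. LINT q|Rplus. of_real (\<kappa> r * \<mu> q) * I (q * r))"
      by (simp add: mult.assoc)
    finally show ?thesis .
  qed
  have int: "integrable (Rplus \<Otimes>\<^sub>M Rplus) (\<lambda>(r, q). of_real (\<kappa> r * \<mu> q) * I (r * q))"
  proof (rule Bochner_Integration.integrable_bound)
    show "integrable (Rplus \<Otimes>\<^sub>M Rplus)
        (\<lambda>(r, q). \<kappa> r / sqrt r * (\<mu> q / sqrt q * (norm2 Rplus f * norm2 Rplus g)))"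
    proof (rule Rplus2.Fubini_integrable)
      show "integrable Rplus (\<lambda>r. LINT q|Rplus. norm (case (r, q) of (r, q) \<Rightarrow>
          \<kappa> r / sqrt r * (\<mu> q / sqrt q * (norm2 Rplus f * norm2 Rplus g))))"
        using \<kappa> unfolding prod.case real_norm_def abs_mult[of "\<kappa> _ / sqrt _"] integral_mult_right_zero
        by (intro integrable_mult_left integrable_abs) (simp add: dil_kernel_def)
      show "AE r in Rplus. integrable Rplus (\<lambda>q. case (r, q) of (r, q) \<Rightarrow>
          \<kappa> r / sqrt r * (\<mu> q / sqrt q * (norm2 Rplus f * norm2 Rplus g)))"
        using \<mu> unfolding prod.case
        by (intro AE_I2 integrable_mult_right integrable_mult_left) (simp add: dil_kernel_def)
      have K: "(\<lambda>r. \<kappa> r / sqrt r) \<in> borel_measurable Rplus" "(\<lambda>r. \<mu> r / sqrt r) \<in> borel_measurable Rplus"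
        using \<kappa> \<mu> by (auto simp: dil_kernel_def)
      show "(\<lambda>(r, q). \<kappa> r / sqrt r * (\<mu> q / sqrt q * (norm2 Rplus f * norm2 Rplus g)))
          \<in> borel_measurable (Rplus \<Otimes>\<^sub>M Rplus)"
        unfolding split_def
        by (intro borel_measurable_times borel_measurable_const measurable_compose[OF measurable_fst K(1)]
            measurable_compose[OF measurable_snd K(2)])
    qed
    show "(\<lambda>(r, q). complex_of_real (\<kappa> r * \<mu> q) * I (r * q)) \<in> borel_measurable (Rplus \<Otimes>\<^sub>M Rplus)"
      unfolding split_def by measurable
    have "norm (complex_of_real (\<kappa> r * \<mu> q) * I (r * q))
        \<le> norm (\<kappa> r / sqrt r * (\<mu> q / sqrt q * (norm2 Rplus f * norm2 Rplus g)))" if "0 < r" "0 < q" for r q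
    proof -
      have nn: "0 \<le> \<kappa> r" "0 \<le> \<mu> q" using \<kappa> \<mu> by (auto simp: dil_kernel_def)
      have "norm (complex_of_real (\<kappa> r * \<mu> q) * I (r * q)) = \<kappa> r * \<mu> q * cmod (I (r * q))"
        using nn by (simp add: norm_mult)
      also have "\<dots> \<le> \<kappa> r * \<mu> q * (norm2 Rplus f * norm2 Rplus g / sqrt (r * q))"
        using nn that by (intro mult_left_mono I_le) auto
      also have "\<dots> = \<kappa> r / sqrt r * (\<mu> q / sqrt q * (norm2 Rplus f * norm2 Rplus g))"
        by (simp add: real_sqrt_mult)
      also have "\<dots> \<le> norm (\<kappa> r / sqrt r * (\<mu> q / sqrt q * (norm2 Rplus f * norm2 Rplus g)))" by (simp only: real_norm_def abs_ge_self)
      finally show ?thesis .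
    qed
    thus "AE p in Rplus \<Otimes>\<^sub>M Rplus. norm (case p of (r, q) \<Rightarrow> complex_of_real (\<kappa> r * \<mu> q) * I (r * q))
      \<le> norm (case p of (r, q) \<Rightarrow> \<kappa> r / sqrt r * (\<mu> q / sqrt q * (norm2 Rplus f * norm2 Rplus g)))"
      by (intro AE_I2) (auto simp: space_pair_measure)
  qed
  have "inner2 Rplus (dil_avg \<mu> (dil_avg \<kappa> f)) g
      = (LINT q|Rplus. LINT r|Rplus. of_real (\<kappa> r * \<mu> q) * I (r * q))"
    unfolding expand[OF \<mu> \<kappa>] by (simp add: mult.commute)
  also have "\<dots> = (LINT r|Rplus. LINT q|Rplus. of_real (\<kappa> r * \<mu> q) * I (r * q))"
    by (rule Rplus2.Fubini_integral[OF int])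
  also have "\<dots> = inner2 Rplus (dil_avg \<kappa> (dil_avg \<mu> f)) g"
    unfolding expand[OF \<kappa> \<mu>] by (simp add: mult.commute)
  finally show ?thesis ..
qed

section \<open>The Cesaro operators as averages of dilations\<close>

text \<open>The density in \<open>r\<close> that the substitution \<open>u = r * s\<close> produces
  from the Cesaro integral; the next definition is its counterpart for the adjoint.\<close>

definition cesaro_ker :: "real \<Rightarrow> real \<Rightarrow> real" where
  "cesaro_ker \<alpha> r = (if r < 1 then \<alpha> * (1 - r) powr (\<alpha> - 1) else 0)"

definition cesaro_adj_ker :: "real \<Rightarrow> real \<Rightarrow> real" where
  "cesaro_adj_ker \<alpha> r = (if 1 < r then \<alpha> * (r - 1) powr (\<alpha> - 1) / r powr \<alpha> else 0)"

text \<open>The integral kernel of \<open>cesaro\<close> at \<open>s\<close> and \<open>u\<close>.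
  Exchanging its arguments gives the kernel of \<open>cesaro_adj\<close>, which reduces adjointness
  to Fubini.\<close>

definition cesaro_joint_ker :: "real \<Rightarrow> real \<Rightarrow> real \<Rightarrow> real" where
  "cesaro_joint_ker \<alpha> s u = (if u < s then \<alpha> / s powr \<alpha> * (s - u) powr (\<alpha> - 1) else 0)"

text \<open>The joint kernel is homogeneous of degree \<open>- 1\<close>, so up to the factor
  \<open>1 / s\<close> it depends on the ratio of its arguments only.\<close>

lemma cesaro_joint_ker_scale:
  assumes "0 < s"
  shows "cesaro_joint_ker \<alpha> s (s * r) = cesaro_ker \<alpha> r / s"
    and "0 < r \<Longrightarrow> cesaro_joint_ker \<alpha> (s * r) s = cesaro_adj_ker \<alpha> r / s"
proof -
  have p: "s powr (\<alpha> - 1) / s powr \<alpha> = 1 / s"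
    using assms by (simp add: powr_diff)
  show "cesaro_joint_ker \<alpha> s (s * r) = cesaro_ker \<alpha> r / s"
  proof (cases "r < 1")
    case True
    have "s - s * r = s * (1 - r)" by (simp add: algebra_simps)
    hence "(s - s * r) powr (\<alpha> - 1) = s powr (\<alpha> - 1) * (1 - r) powr (\<alpha> - 1)"
      using True assms by (simp add: powr_mult)
    thus ?thesis using True assms p
      by (simp add: cesaro_joint_ker_def cesaro_ker_def field_simps)
  qed (use assms in \<open>simp add: cesaro_joint_ker_def cesaro_ker_def\<close>)
  show "cesaro_joint_ker \<alpha> (s * r) s = cesaro_adj_ker \<alpha> r / s" if "0 < r"
  proof (cases "1 < r")
    case True
    have "s * r - s = s * (r - 1)" by (simp add: algebra_simps)
    hence "(s * r - s) powr (\<alpha> - 1) = s powr (\<alpha> - 1) * (r - 1) powr (\<alpha> - 1)"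
      using True assms by (simp add: powr_mult)
    moreover have "(s * r) powr \<alpha> = s powr \<alpha> * r powr \<alpha>"
      using that assms by (simp add: powr_mult)
    ultimately show ?thesis using True assms p that
      by (simp add: cesaro_joint_ker_def cesaro_adj_ker_def field_simps)
  qed (use assms in \<open>simp add: cesaro_joint_ker_def cesaro_adj_ker_def\<close>)
qed

lemma cesaro_eq_joint: "cesaro \<alpha> f s = (LINT u|Rplus. of_real (cesaro_joint_ker \<alpha> s u) * f u)"
proof -
  have "cesaro \<alpha> f s = (LINT u|lborel. (\<alpha> / s powr \<alpha>) *\<^sub>R (indicator {0<..<s} u *\<^sub>R ((s - u) powr (\<alpha> - 1)) *\<^sub>R f u))"
    unfolding cesaro_def set_lebesgue_integral_def by (rule integral_scaleR_right[symmetric])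
  also have "\<dots> = (LINT u|Rplus. of_real (cesaro_joint_ker \<alpha> s u) * f u)"
    unfolding integral_Rplus
    by (intro Bochner_Integration.integral_cong) (auto simp: indicator_def cesaro_joint_ker_def scaleR_conv_of_real)
  finally show ?thesis .
qed

lemma cesaro_adj_eq_joint:
  assumes "0 < s"
  shows "cesaro_adj \<alpha> f s = (LINT u|Rplus. of_real (cesaro_joint_ker \<alpha> u s) * f u)"
proof -
  have "cesaro_adj \<alpha> f s = (LINT u|lborel. \<alpha> *\<^sub>R (indicator {s<..} u *\<^sub>R ((u - s) powr (\<alpha> - 1) / u powr \<alpha>) *\<^sub>R f u))"
    unfolding cesaro_adj_def set_lebesgue_integral_def by (rule integral_scaleR_right[symmetric])
  also have "\<dots> = (LINT u|Rplus. of_real (cesaro_joint_ker \<alpha> u s) * f u)"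
    unfolding integral_Rplus using assms
    by (intro Bochner_Integration.integral_cong) (auto simp: indicator_def cesaro_joint_ker_def scaleR_conv_of_real)
  finally show ?thesis .
qed

lemma cesaro_eq_dil_avg:
  assumes "0 < s"
  shows "cesaro \<alpha> f s = dil_avg (cesaro_ker \<alpha>) f s"
proof -
  have "dil_avg (cesaro_ker \<alpha>) f s = s *\<^sub>R (LINT r|Rplus. of_real (cesaro_joint_ker \<alpha> s (s * r)) * f (s * r))"
    unfolding dil_avg_def cesaro_joint_ker_scale(1)[OF assms] integral_scaleR_right[symmetric] using assms
    by (intro Bochner_Integration.integral_cong) (auto simp: scaleR_conv_of_real mult.commute[of s])
  thus ?thesis
    using integral_Rplus_scale[OF assms, of "\<lambda>u. of_real (cesaro_joint_ker \<alpha> s u) * f u"] assms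
    by (simp add: cesaro_eq_joint)
qed

lemma cesaro_adj_eq_dil_avg:
  assumes "0 < s"
  shows "cesaro_adj \<alpha> f s = dil_avg (cesaro_adj_ker \<alpha>) f s"
proof -
  have "dil_avg (cesaro_adj_ker \<alpha>) f s = s *\<^sub>R (LINT r|Rplus. of_real (cesaro_joint_ker \<alpha> (s * r) s) * f (s * r))"
    unfolding dil_avg_def integral_scaleR_right[symmetric]
  proof (intro Bochner_Integration.integral_cong refl)
    fix r assume "r \<in> space Rplus"
    thus "of_real (cesaro_adj_ker \<alpha> r) * f (r * s) = s *\<^sub>R (of_real (cesaro_joint_ker \<alpha> (s * r) s) * f (s * r))"
      using cesaro_joint_ker_scale(2)[OF assms, of r \<alpha>] assms
      by (simp add: scaleR_conv_of_real mult.commute[of r s])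
  qed
  thus ?thesis
    using integral_Rplus_scale[OF assms, of "\<lambda>u. of_real (cesaro_joint_ker \<alpha> u s) * f u"] assms
    by (simp add: cesaro_adj_eq_joint[OF assms])
qed

text \<open>Divided by \<open>sqrt r\<close>, the kernel is \<open>\<alpha>\<close> times the
  integrand of the Beta integral with parameters \<open>1/2\<close> and
  \<open>\<alpha>\<close>.\<close>

lemma dil_kernel_cesaro:
  assumes "0 < \<alpha>"
  shows "dil_kernel (cesaro_ker \<alpha>)"
  unfolding dil_kernel_def
proof (intro conjI allI)
  have [measurable]: "cesaro_ker \<alpha> \<in> borel_measurable borel" unfolding cesaro_ker_def[abs_def] by measurable
  show m: "cesaro_ker \<alpha> \<in> borel_measurable Rplus" by (rule measurable_Rplus_borel) measurable
  show nn: "0 \<le> cesaro_ker \<alpha> r" for r using assms by (simp add: cesaro_ker_def)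
  have "integrable lborel (\<lambda>t. indicator {0..1} t *\<^sub>R (t powr (1/2 - 1) * (1 - t) powr (\<alpha> - 1)))"
    using integrable_Beta[of "1/2" \<alpha>] assms by (simp add: set_integrable_def)
  hence "integrable lborel (\<lambda>t. \<alpha> * (indicator {0..1} t *\<^sub>R (t powr (1/2 - 1) * (1 - t) powr (\<alpha> - 1))))"
    by (rule integrable_mult_right)
  moreover have "\<alpha> * (indicator {0..1} t *\<^sub>R (t powr (1/2 - 1) * (1 - t) powr (\<alpha> - 1)))
      = indicator {0<..} t *\<^sub>R (cesaro_ker \<alpha> t / sqrt t)" for t :: real
  proof -
    have "t powr (1/2 - 1) = 1 / sqrt t" if "0 < t"
      using that by (simp add: powr_minus powr_half_sqrt field_simps)
    thus ?thesis by (auto simp: indicator_def cesaro_ker_def)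
  qed
  ultimately show "integrable Rplus (\<lambda>r. cesaro_ker \<alpha> r / sqrt r)"
    by (simp only: integrable_Rplus)
qed

text \<open>Between \<open>1\<close> and \<open>2\<close> the integrand is controlled by the
  integrable singularity \<open>(r - 1) powr (\<alpha> - 1)\<close>, from \<open>2\<close> on by a
  multiple of \<open>r powr (- (3/2))\<close>. \<open>A\<close>, shifted by one, and
  \<open>B\<close> are these two majorants.\<close>

lemma dil_kernel_cesaro_adj:
  assumes "0 < \<alpha>"
  shows "dil_kernel (cesaro_adj_ker \<alpha>)"
  unfolding dil_kernel_def
proof (intro conjI allI)
  have [measurable]: "cesaro_adj_ker \<alpha> \<in> borel_measurable borel" unfolding cesaro_adj_ker_def[abs_def] by measurable
  show "cesaro_adj_ker \<alpha> \<in> borel_measurable Rplus" by (rule measurable_Rplus_borel) measurable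
  have m: "(\<lambda>r. indicator {0<..} r *\<^sub>R (cesaro_adj_ker \<alpha> r / sqrt r)) \<in> borel_measurable borel"
    unfolding cesaro_adj_ker_def by measurable
  show nn: "0 \<le> cesaro_adj_ker \<alpha> r" for r using assms by (simp add: cesaro_adj_ker_def)
  define A where "A t = indicator {0..1} t *\<^sub>R (t powr (\<alpha> - 1) * (1 - t) powr (1 - 1))" for t :: real
  define B where "B t = indicator {2..} t *\<^sub>R t powr (- (3/2))" for t :: real
  \<comment> \<open>The price of replacing \<open>r - 1\<close> by \<open>r\<close> in the power for
    \<open>r \<ge> 2\<close>: none if the exponent is nonnegative, and otherwise the factor coming
    from \<open>r / 2 \<le> r - 1\<close>.\<close>
  define c where "c = max 1 (2 powr (1 - \<alpha>))"
  have iA: "integrable lborel A"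
    using integrable_Beta[of \<alpha> 1] assms by (simp add: set_integrable_def A_def[abs_def])
  have iA': "integrable lborel (\<lambda>t. A (- 1 + 1 * t))"
    by (rule lborel_integrable_real_affine[OF iA]) simp
  have "(\<lambda>t::real. t powr (- (3/2))) absolutely_integrable_on {2..}"
    using has_integral_powr_to_inf[of "- (3/2)" 2]
    by (intro nonnegative_absolutely_integrable_1) (auto simp: integrable_on_def)
  hence iB: "integrable lborel B"
    unfolding set_integrable_def B_def[abs_def] by (subst (asm) integrable_completion) auto
  have "integrable lborel (\<lambda>t. \<alpha> * A (- 1 + 1 * t) + \<alpha> * c * B t)"
    using iA' iB by (intro Bochner_Integration.integrable_add integrable_mult_right)
  hence "integrable lborel (\<lambda>r. indicator {0<..} r *\<^sub>R (cesaro_adj_ker \<alpha> r / sqrt r))"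
  proof (rule Bochner_Integration.integrable_bound)
    have le: "cesaro_adj_ker \<alpha> r / sqrt r \<le> \<alpha> * A (- 1 + 1 * r) + \<alpha> * c * B r" if "0 < r" for r
    proof -
      have AB: "0 \<le> A t" "0 \<le> B t" for t by (auto simp: A_def B_def indicator_def)
      have c: "1 \<le> c" by (simp add: c_def)
      consider "r \<le> 1" | "1 < r" "r < 2" | "2 \<le> r" by linarith
      thus ?thesis
      proof cases
        case 1
        thus ?thesis using AB[of "- 1 + 1 * r"] AB[of r] assms c by (simp add: cesaro_adj_ker_def)
      next
        case 2
        have "1 \<le> r powr \<alpha>" using 2 assms by (simp add: ge_one_powr_ge_zero)
        moreover have "1 \<le> sqrt r" using 2 by simp
        ultimately have "1 \<le> r powr \<alpha> * sqrt r" using mult_mono[of 1 "r powr \<alpha>" 1 "sqrt r"] by simp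
        hence "\<alpha> * (r - 1) powr (\<alpha> - 1) / (r powr \<alpha> * sqrt r) \<le> \<alpha> * (r - 1) powr (\<alpha> - 1) / 1"
          using assms by (intro divide_left_mono) auto
        moreover have "A (- 1 + 1 * r) = (r - 1) powr (\<alpha> - 1)" using 2 by (simp add: A_def)
        ultimately show ?thesis using 2 AB[of r] assms c
          by (simp add: cesaro_adj_ker_def add_increasing2)
      next
        case 3
        have "(r - 1) powr (\<alpha> - 1) \<le> c * r powr (\<alpha> - 1)"
        proof (cases "1 \<le> \<alpha>")
          case True
          hence "(r - 1) powr (\<alpha> - 1) \<le> 1 * r powr (\<alpha> - 1)" using 3 by (simp add: powr_mono2)
          also have "\<dots> \<le> c * r powr (\<alpha> - 1)" using c by (intro mult_right_mono) auto
          finally show ?thesis .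
        next
          case False
          have "(r - 1) powr (\<alpha> - 1) \<le> (r / 2) powr (\<alpha> - 1)"
            using 3 False by (intro powr_mono2') auto
          also have "\<dots> = 2 powr (1 - \<alpha>) * r powr (\<alpha> - 1)"
            using 3 by (simp add: powr_divide powr_diff field_simps)
          also have "\<dots> \<le> c * r powr (\<alpha> - 1)" by (intro mult_right_mono) (auto simp: c_def)
          finally show ?thesis .
        qed
        hence "\<alpha> * (r - 1) powr (\<alpha> - 1) / (r powr \<alpha> * sqrt r) \<le> \<alpha> * (c * r powr (\<alpha> - 1)) / (r powr \<alpha> * sqrt r)"
          using assms 3 by (intro divide_right_mono mult_left_mono) auto
        also have "\<dots> = \<alpha> * c * (r powr (\<alpha> - 1) / (r powr \<alpha> * r powr (1/2)))"
          using 3 by (simp add: powr_half_sqrt)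
        also have "r powr (\<alpha> - 1) / (r powr \<alpha> * r powr (1/2)) = B r"
          using 3 by (simp add: B_def powr_add[symmetric] powr_diff[symmetric])
        finally show ?thesis using 3 AB[of "- 1 + 1 * r"] assms
          by (simp add: cesaro_adj_ker_def add_increasing)
      qed
    qed
    have "norm (indicator {0<..} r *\<^sub>R (cesaro_adj_ker \<alpha> r / sqrt r)) \<le> norm (\<alpha> * A (- 1 + 1 * r) + \<alpha> * c * B r)" for r
    proof (cases "0 < r")
      case True
      thus ?thesis using le[OF True] nn[of r] by simp
    qed simp
    thus "AE r in lborel. norm (indicator {0<..} r *\<^sub>R (cesaro_adj_ker \<alpha> r / sqrt r))
        \<le> norm (\<alpha> * A (- 1 + 1 * r) + \<alpha> * c * B r)" by simp
  qed (use m in simp)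
  thus "integrable Rplus (\<lambda>r. cesaro_adj_ker \<alpha> r / sqrt r)" by (simp add: integrable_Rplus)
qed

section \<open>Mapping properties of the Cesaro operators: adjointness, normality, injectivity and
  ranges\<close>

lemma measurable_cesaro:
  assumes "sq_int Rplus f" "0 < \<alpha>"
  shows "cesaro \<alpha> f \<in> borel_measurable Rplus" "cesaro_adj \<alpha> f \<in> borel_measurable Rplus"
proof -
  have "cesaro \<alpha> f \<in> borel_measurable Rplus \<longleftrightarrow> dil_avg (cesaro_ker \<alpha>) f \<in> borel_measurable Rplus"
    by (rule measurable_cong) (simp add: cesaro_eq_dil_avg)
  thus "cesaro \<alpha> f \<in> borel_measurable Rplus"
    using sq_int_dil_avg[OF dil_kernel_cesaro assms(1)] assms(2) by (simp add: sq_int_def)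
  have "cesaro_adj \<alpha> f \<in> borel_measurable Rplus \<longleftrightarrow> dil_avg (cesaro_adj_ker \<alpha>) f \<in> borel_measurable Rplus"
    by (rule measurable_cong) (simp add: cesaro_adj_eq_dil_avg)
  thus "cesaro_adj \<alpha> f \<in> borel_measurable Rplus"
    using sq_int_dil_avg[OF dil_kernel_cesaro_adj assms(1)] assms(2) by (simp add: sq_int_def)
qed

lemma AE_cesaro:
  "AE s in Rplus. dil_avg (cesaro_ker \<alpha>) f s = cesaro \<alpha> f s"
  "AE s in Rplus. dil_avg (cesaro_adj_ker \<alpha>) f s = cesaro_adj \<alpha> f s"
  by (auto intro!: AE_I2 simp: cesaro_eq_dil_avg cesaro_adj_eq_dil_avg)

lemma sq_int_cesaro:
  assumes "sq_int Rplus f" "0 < \<alpha>"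
  shows "sq_int Rplus (cesaro \<alpha> f)" "sq_int Rplus (cesaro_adj \<alpha> f)"
  by (rule sq_int_cong_AE[OF sq_int_dil_avg[OF dil_kernel_cesaro assms(1)] measurable_cesaro(1) AE_cesaro(1)]
           sq_int_cong_AE[OF sq_int_dil_avg[OF dil_kernel_cesaro_adj assms(1)] measurable_cesaro(2) AE_cesaro(2)];
      fact assms)+

lemma cesaro_linear:
  assumes "sq_int Rplus f" "sq_int Rplus g" "0 < \<alpha>"
  shows "AE s in Rplus. cesaro \<alpha> (\<lambda>s. f s + c * g s) s = cesaro \<alpha> f s + c * cesaro \<alpha> g s"
    and "AE s in Rplus. cesaro_adj \<alpha> (\<lambda>s. f s + c * g s) s = cesaro_adj \<alpha> f s + c * cesaro_adj \<alpha> g s"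
  using dil_avg_linear[OF dil_kernel_cesaro[OF assms(3)] assms(1,2), of c]
    dil_avg_linear[OF dil_kernel_cesaro_adj[OF assms(3)] assms(1,2), of c]
  by (auto simp: AE_Rplus cesaro_eq_dil_avg cesaro_adj_eq_dil_avg elim!: eventually_mono)

text \<open>Fubini for the joint kernel. Positivity of the kernel provides the absolute
  convergence.\<close>

lemma cesaro_adjoint:
  assumes f: "sq_int Rplus f" and g: "sq_int Rplus g" and \<alpha>: "0 < \<alpha>"
  shows "inner2 Rplus (cesaro \<alpha> f) g = inner2 Rplus f (cesaro_adj \<alpha> g)"
proof -
  let ?k = "cesaro_joint_ker \<alpha>"
  have [measurable]: "f \<in> borel_measurable Rplus" "g \<in> borel_measurable Rplus"
    using f g by (auto simp: sq_int_def)
  have "case_prod ?k \<in> borel_measurable (borel \<Otimes>\<^sub>M borel)"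
    unfolding cesaro_joint_ker_def[abs_def] by measurable
  moreover have "(\<lambda>p. (fst p, snd p)) \<in> Rplus \<Otimes>\<^sub>M Rplus \<rightarrow>\<^sub>M borel \<Otimes>\<^sub>M (borel :: real measure)"
    by (intro measurable_Pair measurable_compose[OF measurable_fst] measurable_compose[OF measurable_snd]
        measurable_ident_Rplus)
  ultimately have [measurable]: "(\<lambda>p. ?k (fst p) (snd p)) \<in> borel_measurable (Rplus \<Otimes>\<^sub>M Rplus)"
    by (auto dest: measurable_compose)
  have k0: "0 \<le> ?k s u" for s u using \<alpha> by (simp add: cesaro_joint_ker_def)
  \<comment> \<open>For the modulus of \<open>f\<close> the inner integral of absolute values is
    itself a Cesaro transform, hence square-integrable, and pairs integrably with
    \<open>g\<close>.\<close>
  define F where "F u = complex_of_real (cmod (f u))" for u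
  have F: "sq_int Rplus F" using f by (auto simp: sq_int_def F_def[abs_def])
  have int: "integrable (Rplus \<Otimes>\<^sub>M Rplus) (\<lambda>(s, u). of_real (?k s u) * f u * cnj (g s))"
  proof (rule Rplus2.Fubini_integrable)
    have "(LINT u|Rplus. norm (case (s, u) of (s, u) \<Rightarrow> of_real (?k s u) * f u * cnj (g s)))
        = cmod (cesaro \<alpha> F s) * cmod (g s)" for s
    proof -
      have "cesaro \<alpha> F s = of_real (LINT u|Rplus. ?k s u * cmod (f u))"
        unfolding cesaro_eq_joint F_def integral_complex_of_real[symmetric] by simp
      hence "cmod (cesaro \<alpha> F s) = (LINT u|Rplus. ?k s u * cmod (f u))"
        using k0 by (simp add: integral_nonneg_AE)
      thus ?thesis using k0 by (simp add: norm_mult)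
    qed
    thus "integrable Rplus (\<lambda>s. LINT u|Rplus. norm (case (s, u) of (s, u) \<Rightarrow> of_real (?k s u) * f u * cnj (g s)))"
      using integrable_norm_mult(1)[OF sq_int_cesaro(1)[OF F \<alpha>] g] by simp
    show "AE s in Rplus. integrable Rplus (\<lambda>u. case (s, u) of (s, u) \<Rightarrow> of_real (?k s u) * f u * cnj (g s))"
      using AE_integrable_dil[OF dil_kernel_cesaro[OF \<alpha>] f] AE_space
    proof eventually_elim
      case (elim s)
      hence s: "0 < s" by simp
      have "integrable Rplus (\<lambda>r. of_real (?k s (s * r)) * f (s * r))"
        unfolding cesaro_joint_ker_scale(1)[OF s] using elim
        by (simp add: mult.commute[of s])
      hence "integrable Rplus (\<lambda>u. of_real (?k s u) * f u)"
        using integrable_Rplus_scale[OF s, of "\<lambda>u. of_real (?k s u) * f u"] by simp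
      thus ?case by simp
    qed
    show "(\<lambda>(s, u). of_real (?k s u) * f u * cnj (g s)) \<in> borel_measurable (Rplus \<Otimes>\<^sub>M Rplus)"
      unfolding split_def by measurable
  qed
  have "inner2 Rplus (cesaro \<alpha> f) g = (LINT s|Rplus. LINT u|Rplus. of_real (?k s u) * f u * cnj (g s))"
    unfolding inner2_def cesaro_eq_joint by simp
  also have "\<dots> = (LINT u|Rplus. LINT s|Rplus. of_real (?k s u) * f u * cnj (g s))"
    by (rule Rplus2.Fubini_integral[OF int, symmetric])
  also have "\<dots> = (LINT u|Rplus. f u * cnj (cesaro_adj \<alpha> g u))"
  proof (intro Bochner_Integration.integral_cong refl)
    fix u :: real assume "u \<in> space Rplus"
    hence "cnj (cesaro_adj \<alpha> g u) = (LINT s|Rplus. of_real (?k s u) * cnj (g s))"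
      by (simp add: cesaro_adj_eq_joint Bochner_Integration.integral_cnj[symmetric] del: Bochner_Integration.integral_cnj)
    hence eq: "f u * cnj (cesaro_adj \<alpha> g u) = (LINT s|Rplus. f u * (of_real (?k s u) * cnj (g s)))" by simp
    show "(LINT s|Rplus. of_real (?k s u) * f u * cnj (g s)) = f u * cnj (cesaro_adj \<alpha> g u)"
      unfolding eq by (simp only: mult_ac)
  qed
  finally show ?thesis by (simp add: inner2_def)
qed

lemma cesaro_commute:
  assumes "sq_int Rplus f" "sq_int Rplus g" "0 < \<alpha>"
  shows "inner2 Rplus (cesaro \<alpha> (cesaro_adj \<alpha> f)) g = inner2 Rplus (cesaro_adj \<alpha> (cesaro \<alpha> f)) g"
proof -
  have g: "g \<in> borel_measurable Rplus" using assms by (simp add: sq_int_def)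
  \<comment> \<open>The operators equal averages of dilations at positive points only, and these are
    the only points at which the outer average looks.\<close>
  have dil_cong: "dil_avg \<kappa> h s = dil_avg \<kappa> h' s" if "\<And>s. 0 < s \<Longrightarrow> h s = h' s" "0 < s" for \<kappa> h h' s
    unfolding dil_avg_def using that by (intro Bochner_Integration.integral_cong) auto
  have "inner2 Rplus (cesaro \<alpha> (cesaro_adj \<alpha> f)) g
      = inner2 Rplus (dil_avg (cesaro_ker \<alpha>) (dil_avg (cesaro_adj_ker \<alpha>) f)) g"
    unfolding inner2_def
    by (intro Bochner_Integration.integral_cong)
       (auto simp: cesaro_eq_dil_avg cesaro_adj_eq_dil_avg intro!: dil_cong)
  moreover have "inner2 Rplus (cesaro_adj \<alpha> (cesaro \<alpha> f)) g
      = inner2 Rplus (dil_avg (cesaro_adj_ker \<alpha>) (dil_avg (cesaro_ker \<alpha>) f)) g"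
    unfolding inner2_def
    by (intro Bochner_Integration.integral_cong)
       (auto simp: cesaro_eq_dil_avg cesaro_adj_eq_dil_avg intro!: dil_cong)
  ultimately show ?thesis
    using dil_avg_commute[OF dil_kernel_cesaro dil_kernel_cesaro_adj assms(1,2), of \<alpha> \<alpha>] assms(3) by simp
qed

lemma norm2_cesaro_adj:
  assumes f: "sq_int Rplus f" and \<alpha>: "0 < \<alpha>"
  shows "norm2 Rplus (cesaro_adj \<alpha> f) = norm2 Rplus (cesaro \<alpha> f)"
proof -
  note c = sq_int_cesaro[OF f \<alpha>]
  have "inner2 Rplus (cesaro_adj \<alpha> f) (cesaro_adj \<alpha> f) = inner2 Rplus (cesaro \<alpha> (cesaro_adj \<alpha> f)) f"
    by (rule cesaro_adjoint[OF c(2) f \<alpha>, symmetric])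
  also have "\<dots> = inner2 Rplus (cesaro_adj \<alpha> (cesaro \<alpha> f)) f"
    by (rule cesaro_commute[OF f f \<alpha>])
  also have "\<dots> = cnj (inner2 Rplus f (cesaro_adj \<alpha> (cesaro \<alpha> f)))" by (rule inner2_commute)
  also have "\<dots> = cnj (inner2 Rplus (cesaro \<alpha> f) (cesaro \<alpha> f))"
    by (simp add: cesaro_adjoint[OF f c(1) \<alpha>])
  finally have "(norm2 Rplus (cesaro_adj \<alpha> f))\<^sup>2 = (norm2 Rplus (cesaro \<alpha> f))\<^sup>2"
    unfolding inner2_self[OF c(1)] inner2_self[OF c(2)] complex_cnj_complex_of_real of_real_eq_iff .
  thus ?thesis by simp
qed

lemma Gamma_integral_Rplus:
  assumes "0 < a"
  shows "integrable Rplus (\<lambda>v. v powr (a - 1) * exp (- v))" "(LINT v|Rplus. v powr (a - 1) * exp (- v)) = Gamma a"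
proof -
  have "(\<integral>\<^sup>+t. ennreal (indicator {0<..} t *\<^sub>R (t powr (a - 1) * exp (- t))) \<partial>lborel) = ennreal (Gamma a)"
    unfolding Gamma_conv_nn_integral_real[OF assms]
    by (intro nn_integral_cong) (auto simp: indicator_def exp_minus field_simps)
  hence "has_bochner_integral lborel (\<lambda>t. indicator {0<..} t *\<^sub>R (t powr (a - 1) * exp (- t))) (Gamma a)"
    using assms by (intro has_bochner_integral_nn_integral) (auto simp: less_imp_le[OF Gamma_real_pos])
  thus "integrable Rplus (\<lambda>v. v powr (a - 1) * exp (- v))" "(LINT v|Rplus. v powr (a - 1) * exp (- v)) = Gamma a"
    by (auto simp: integrable_Rplus integral_Rplus has_bochner_integral_iff)
qed

text \<open>The factor \<open>u powr \<alpha>\<close> cancels the denominator of the kernel, and the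
  substitution \<open>u = s + v / x\<close> leaves a Gamma integral. Every decaying real exponential
  thus lies in the range of \<open>cesaro_adj\<close>.\<close>

lemma cesaro_adj_powr_exp:
  assumes \<alpha>: "0 < \<alpha>" and x: "0 < x"
  defines "g \<equiv> \<lambda>u. complex_of_real (u powr \<alpha> * exp (- (x * u)))"
  shows "sq_int Rplus g"
    and "\<And>s. 0 < s \<Longrightarrow> cesaro_adj \<alpha> g s = of_real (\<alpha> * Gamma \<alpha> / x powr \<alpha>) * exp (- (of_real x * of_real s))"
proof -
  \<comment> \<open>Up to a constant the squared modulus of \<open>g\<close> is the Gamma integrand
    with parameter \<open>2 * \<alpha> + 1\<close>, rescaled by \<open>2 * x\<close>.\<close>
  have "integrable Rplus (\<lambda>u. (2 * x * u) powr (2 * \<alpha> + 1 - 1) * exp (- (2 * x * u)))"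
    using Gamma_integral_Rplus(1)[of "2 * \<alpha> + 1"] \<alpha> x
    by (subst integrable_Rplus_scale[of "2 * x" "\<lambda>v. v powr (2 * \<alpha> + 1 - 1) * exp (- v)"]) auto
  hence "integrable Rplus (\<lambda>u. (1 / (2 * x) powr (2 * \<alpha>)) * ((2 * x * u) powr (2 * \<alpha> + 1 - 1) * exp (- (2 * x * u))))"
    by (rule integrable_mult_right)
  moreover have "(1 / (2 * x) powr (2 * \<alpha>)) * ((2 * x * u) powr (2 * \<alpha> + 1 - 1) * exp (- (2 * x * u)))
      = (cmod (g u))\<^sup>2" if "u \<in> space Rplus" for u
  proof -
    have "(2 * x * u) powr (2 * \<alpha>) = (2 * x) powr (2 * \<alpha>) * (u powr \<alpha>)\<^sup>2"
      using that x by (simp add: powr_mult powr_power[symmetric] power2_eq_square powr_add[symmetric])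
    moreover have "exp (- (2 * x * u)) = (exp (- (x * u)))\<^sup>2" by (simp add: exp_double[symmetric])
    ultimately show ?thesis using x
      by (simp add: g_def norm_mult power_mult_distrib)
  qed
  ultimately have "integrable Rplus (\<lambda>u. (cmod (g u))\<^sup>2)"
    by (subst (asm) Bochner_Integration.integrable_cong[OF refl]) auto
  moreover have "g \<in> borel_measurable Rplus"
    unfolding g_def by (rule measurable_Rplus_borel) measurable
  ultimately show "sq_int Rplus g" by (simp add: sq_int_def)
  fix s :: real assume s: "0 < s"
  have "cesaro_adj \<alpha> g s = \<alpha> *\<^sub>R (LINT u|lborel. of_real (indicator {s<..} u * ((u - s) powr (\<alpha> - 1) * exp (- (x * u)))))"
    unfolding cesaro_adj_def set_lebesgue_integral_def using s
    by (intro arg_cong[where f = "\<lambda>z. \<alpha> *\<^sub>R z"] Bochner_Integration.integral_cong)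
       (auto simp: indicator_def g_def scaleR_conv_of_real)
  also have "\<dots> = of_real (\<alpha> * (LINT u|lborel. indicator {s<..} u * ((u - s) powr (\<alpha> - 1) * exp (- (x * u)))))"
    unfolding integral_complex_of_real by (simp add: scaleR_conv_of_real)
  also have "(LINT u|lborel. indicator {s<..} u * ((u - s) powr (\<alpha> - 1) * exp (- (x * u))))
     = \<bar>1 / x\<bar> *\<^sub>R (LINT v|lborel. indicator {s<..} (s + 1 / x * v) * ((s + 1 / x * v - s) powr (\<alpha> - 1) * exp (- (x * (s + 1 / x * v)))))"
    by (rule lborel_integral_real_affine) (use x in simp)
  also have "(LINT v|lborel. indicator {s<..} (s + 1 / x * v) * ((s + 1 / x * v - s) powr (\<alpha> - 1) * exp (- (x * (s + 1 / x * v)))))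
     = (LINT v|lborel. exp (- (x * s)) / x powr (\<alpha> - 1) * (indicator {0<..} v *\<^sub>R (v powr (\<alpha> - 1) * exp (- v))))"
  proof (intro Bochner_Integration.integral_cong refl)
    fix v :: real
    have "x * (s + 1 / x * v) = x * s + v" using x by (simp add: field_simps)
    hence "exp (- (x * (s + 1 / x * v))) = exp (- (x * s)) * exp (- v)" by (simp add: exp_add[symmetric])
    moreover have "indicator {s<..} (s + 1 / x * v) = (indicator {0<..} v :: real)"
      using x by (auto simp: indicator_def zero_less_divide_iff)
    moreover have "(s + 1 / x * v - s) powr (\<alpha> - 1) = v powr (\<alpha> - 1) / x powr (\<alpha> - 1)" if "0 < v"
      using x that by (simp add: powr_divide)
    ultimately show "indicator {s<..} (s + 1 / x * v) * ((s + 1 / x * v - s) powr (\<alpha> - 1) * exp (- (x * (s + 1 / x * v))))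
        = exp (- (x * s)) / x powr (\<alpha> - 1) * (indicator {0<..} v *\<^sub>R (v powr (\<alpha> - 1) * exp (- v)))"
      by (cases "0 < v") simp_all
  qed
  also have "\<dots> = exp (- (x * s)) / x powr (\<alpha> - 1) * Gamma \<alpha>"
    using Gamma_integral_Rplus(2)[OF \<alpha>] unfolding integral_Rplus by simp
  also have "\<alpha> * (\<bar>1 / x\<bar> *\<^sub>R (exp (- (x * s)) / x powr (\<alpha> - 1) * Gamma \<alpha>))
      = \<alpha> * Gamma \<alpha> / x powr \<alpha> * exp (- (x * s))"
    using x by (simp add: powr_diff field_simps)
  finally show "cesaro_adj \<alpha> g s = of_real (\<alpha> * Gamma \<alpha> / x powr \<alpha>) * exp (- (of_real x * of_real s))"
    by (simp add: exp_of_real[symmetric])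
qed

text \<open>A function with vanishing Cesaro transform is orthogonal to the range of the adjoint,
  which contains enough exponentials for Lerch's theorem.\<close>

lemma cesaro_inj:
  assumes f: "sq_int Rplus f" and \<alpha>: "0 < \<alpha>" and zero: "norm2 Rplus (cesaro \<alpha> f) = 0"
  shows "AE s in Rplus. f s = 0"
proof (rule laplace_inj[OF f])
  fix x :: real assume x: "0 < x"
  let ?c = "complex_of_real (\<alpha> * Gamma \<alpha> / x powr \<alpha>)"
  let ?g = "\<lambda>u. complex_of_real (u powr \<alpha> * exp (- (x * u)))"
  note g = cesaro_adj_powr_exp[OF \<alpha> x]
  have "cnj ?c * laplace f (of_real x) = inner2 Rplus f (\<lambda>t. ?c * exp (- (of_real x * of_real t)))"
    by (simp only: inner2_scale_right laplace_eq_inner2 complex_cnj_complex_of_real)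
  also have "\<dots> = inner2 Rplus f (cesaro_adj \<alpha> ?g)"
    unfolding inner2_def using g(2) by (intro Bochner_Integration.integral_cong) auto
  also have "\<dots> = inner2 Rplus (cesaro \<alpha> f) ?g" by (rule cesaro_adjoint[OF f g(1) \<alpha>, symmetric])
  also have "\<dots> = 0"
    using inner2_le_norm2[OF sq_int_cesaro(1)[OF f \<alpha>] g(1)] zero by simp
  finally show "laplace f (of_real x) = 0"
    using \<alpha> x Gamma_real_pos[OF \<alpha>] by simp
qed

text \<open>
  If \<open>B\<close> is the adjoint of the normal operator \<open>A\<close>, then \<open>B h \<mapsto> A h\<close> is isometric, so
  \<open>B h \<mapsto> \<langle>A h, f\<rangle>\<close> is bounded by the norm of \<open>f\<close> and is represented by some \<open>g\<close>; then \<open>A g = B f\<close>.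
\<close>

lemma normal_range_subset:
  assumes sq: "\<And>f. sq_int M f \<Longrightarrow> sq_int M (A f)" "\<And>f. sq_int M f \<Longrightarrow> sq_int M (B f)"
    and lin: "\<And>f g c. sq_int M f \<Longrightarrow> sq_int M g \<Longrightarrow> AE x in M. A (\<lambda>x. f x + c * g x) x = A f x + c * A g x"
      "\<And>f g c. sq_int M f \<Longrightarrow> sq_int M g \<Longrightarrow> AE x in M. B (\<lambda>x. f x + c * g x) x = B f x + c * B g x"
    and adj: "\<And>f g. sq_int M f \<Longrightarrow> sq_int M g \<Longrightarrow> inner2 M (A f) g = inner2 M f (B g)"
    and normal: "\<And>f. sq_int M f \<Longrightarrow> norm2 M (A f) = norm2 M (B f)"
    and f: "sq_int M f"
  shows "\<exists>g. sq_int M g \<and> norm2 M g \<le> norm2 M f \<and> (AE x in M. A g x = B f x)"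
proof (rule Riesz_subspace[where I = "{h. sq_int M h}" and ?i0.0 = "\<lambda>_. 0" and v = B and M = M
      and \<phi> = "\<lambda>h. inner2 M (A h) f" and B = "norm2 M f"])
  show "(\<lambda>_. 0) \<in> {h. sq_int M h}" by simp
  show "sq_int M (B h)" if "h \<in> {h. sq_int M h}" for h using that sq(2) by simp
  show "0 \<le> norm2 M f" by simp
  show "cmod (inner2 M (A h) f) \<le> norm2 M f * norm2 M (B h)" if "h \<in> {h. sq_int M h}" for h
    using inner2_le_norm2[OF sq(1)[of h] f] normal[of h] that by (simp add: mult.commute)
  show "\<exists>k\<in>{h. sq_int M h}. (AE x in M. B k x = B i x + c * B j x)
        \<and> inner2 M (A k) f = inner2 M (A i) f + c * inner2 M (A j) f"
    if ij: "i \<in> {h. sq_int M h}" "j \<in> {h. sq_int M h}" for i j c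
  proof (intro bexI conjI)
    have s: "sq_int M i" "sq_int M j" using ij by auto
    show k: "(\<lambda>x. i x + c * j x) \<in> {h. sq_int M h}" using s by (simp add: sq_int_add sq_int_scale)
    show "AE x in M. B (\<lambda>x. i x + c * j x) x = B i x + c * B j x" by (rule lin(2)[OF s])
    have "inner2 M (A (\<lambda>x. i x + c * j x)) f = inner2 M (\<lambda>x. A i x + c * A j x) f"
      using k s f sq_int_add(1)[OF sq(1)[OF s(1)] sq_int_scale[OF sq(1)[OF s(2)], of c]] sq(1)
      by (intro inner2_cong_AE lin(1)[OF s]) (auto simp: sq_int_def)
    also have "\<dots> = inner2 M (A i) f + c * inner2 M (A j) f"
      using s f by (simp add: inner2_add_left inner2_scale_left sq sq_int_scale)
    finally show "inner2 M (A (\<lambda>x. i x + c * j x)) f = inner2 M (A i) f + c * inner2 M (A j) f" .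
  qed
next
  fix g k
  assume g: "sq_int M g" "norm2 M g \<le> norm2 M f"
    and rep: "\<And>i. i \<in> {h. sq_int M h} \<Longrightarrow> inner2 M (A i) f = inner2 M (B i) g"
  \<comment> \<open>Moving the operators across, \<open>A g\<close> and \<open>B f\<close> pair
    equally with \<open>d\<close>, because the representation equates the pairing of
    \<open>A d\<close> with \<open>f\<close> and that of \<open>B d\<close> with \<open>g\<close>.
    Hence \<open>d\<close> is orthogonal to itself.\<close>
  define d where "d x = A g x - B f x" for x
  have d: "sq_int M d" unfolding d_def[abs_def] by (intro sq_int_diff sq g f)
  have "inner2 M d d = inner2 M (A g) d - inner2 M (B f) d"
    unfolding d_def[abs_def] by (intro inner2_diff_left sq sq_int_diff g f)
  also have "inner2 M (A g) d = cnj (inner2 M (B d) g)"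
    using adj[OF g(1) d] inner2_commute by metis
  also have "inner2 M (B d) g = inner2 M (A d) f" using rep[of d] d by simp
  also have "cnj (inner2 M (A d) f) = inner2 M (B f) d"
    using adj[OF d f] inner2_commute by metis
  finally have "norm2 M d = 0" by (simp add: inner2_self[OF d])
  from norm2_eq_0[OF d this] have "AE x in M. A g x = B f x"
    by eventually_elim (simp add: d_def)
  with g show ?thesis by blast
qed

text \<open>Normality is symmetric in an operator and its adjoint, so the argument applies in both
  directions. The two norm bounds together will give equality of the range norms.\<close>

lemma cesaro_range:
  assumes f: "sq_int Rplus f" and \<alpha>: "0 < \<alpha>"
  shows "\<exists>g. sq_int Rplus g \<and> norm2 Rplus g \<le> norm2 Rplus f \<and> (AE s in Rplus. cesaro \<alpha> g s = cesaro_adj \<alpha> f s)"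
    and "\<exists>g. sq_int Rplus g \<and> norm2 Rplus g \<le> norm2 Rplus f \<and> (AE s in Rplus. cesaro_adj \<alpha> g s = cesaro \<alpha> f s)"
proof -
  have adj: "inner2 Rplus (cesaro_adj \<alpha> f) g = inner2 Rplus f (cesaro \<alpha> g)"
    if "sq_int Rplus f" "sq_int Rplus g" for f g
    using cesaro_adjoint[OF that(2,1) \<alpha>] inner2_commute by metis
  show "\<exists>g. sq_int Rplus g \<and> norm2 Rplus g \<le> norm2 Rplus f \<and> (AE s in Rplus. cesaro \<alpha> g s = cesaro_adj \<alpha> f s)"
    by (rule normal_range_subset)
       (auto simp: norm2_cesaro_adj \<alpha> f intro: sq_int_cesaro cesaro_linear cesaro_adjoint)
  show "\<exists>g. sq_int Rplus g \<and> norm2 Rplus g \<le> norm2 Rplus f \<and> (AE s in Rplus. cesaro_adj \<alpha> g s = cesaro \<alpha> f s)"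
    by (rule normal_range_subset)
       (auto simp: norm2_cesaro_adj \<alpha> f intro: sq_int_cesaro cesaro_linear adj)
qed

text \<open>The adjoint inherits injectivity from \<open>cesaro\<close> because the two images of a
  function have equal norms.\<close>

lemma AE_diff_of_cesaro_eq:
  assumes fg: "sq_int Rplus f" "sq_int Rplus g" and \<alpha>: "0 < \<alpha>"
    and eq: "(AE s in Rplus. cesaro \<alpha> f s = cesaro \<alpha> g s) \<or> (AE s in Rplus. cesaro_adj \<alpha> f s = cesaro_adj \<alpha> g s)"
  shows "AE s in Rplus. f s = g s"
proof -
  let ?d = "\<lambda>s. f s + (- 1) * g s"
  have d: "sq_int Rplus ?d" by (intro sq_int_add sq_int_scale fg)
  note lin = cesaro_linear[OF fg \<alpha>, of "- 1"]
  have "norm2 Rplus (cesaro \<alpha> ?d) = 0"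
    using eq
  proof
    assume "AE s in Rplus. cesaro \<alpha> f s = cesaro \<alpha> g s"
    with lin(1) have "AE s in Rplus. cesaro \<alpha> ?d s = 0" by eventually_elim simp
    hence "norm2 Rplus (cesaro \<alpha> ?d) = norm2 Rplus (\<lambda>_. 0)"
      by (intro norm2_cong_AE measurable_cesaro[OF d \<alpha>]) auto
    thus ?thesis by simp
  next
    assume "AE s in Rplus. cesaro_adj \<alpha> f s = cesaro_adj \<alpha> g s"
    with lin(2) have "AE s in Rplus. cesaro_adj \<alpha> ?d s = 0" by eventually_elim simp
    hence "norm2 Rplus (cesaro_adj \<alpha> ?d) = norm2 Rplus (\<lambda>_. 0)"
      by (intro norm2_cong_AE measurable_cesaro[OF d \<alpha>]) auto
    thus ?thesis using norm2_cesaro_adj[OF d \<alpha>] by simp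
  qed
  from cesaro_inj[OF d \<alpha> this] show ?thesis by eventually_elim simp
qed


section \<open>The Laplace transform as an isometry into the Hardy space\<close>

lemma norm2_exp:
  assumes "0 < Re z"
  shows "norm2 Rplus (\<lambda>t. exp (- (z * of_real t))) = 1 / sqrt (2 * Re z)"
proof -
  have "complex_of_real ((norm2 Rplus (\<lambda>t. exp (- (z * of_real t))))\<^sup>2) = 1 / (z + cnj z)"
    using inner2_self[OF sq_int_exp[OF assms]] inner2_exp[OF assms assms] by simp
  also have "\<dots> = complex_of_real (1 / (2 * Re z))" by (simp add: complex_add_cnj)
  finally have "(norm2 Rplus (\<lambda>t. exp (- (z * of_real t))))\<^sup>2 = 1 / (2 * Re z)"
    by (simp only: of_real_eq_iff)
  thus ?thesis
    by (metis norm2_nonneg real_sqrt_divide real_sqrt_one real_sqrt_unique)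
qed

text \<open>Cauchy-Schwarz against the exponential. The bound is uniform on half-planes away from
  the imaginary axis, so norm convergence gives locally uniform convergence of transforms.\<close>

lemma cmod_laplace_le:
  assumes "sq_int Rplus f" "0 < Re z"
  shows "cmod (laplace f z) \<le> norm2 Rplus f / sqrt (2 * Re z)"
  using inner2_le_norm2[OF assms(1) sq_int_exp[of "cnj z"]] norm2_exp[of "cnj z"] assms
  by (simp add: laplace_eq_inner2)

lemma laplace_add:
  assumes "sq_int Rplus f" "sq_int Rplus g" "0 < Re z"
  shows "laplace (\<lambda>t. f t + g t) z = laplace f z + laplace g z"
  unfolding laplace_eq_inner2 by (intro inner2_add_left sq_int_exp assms) (use assms in simp)

lemma laplace_diff:
  assumes "sq_int Rplus f" "sq_int Rplus g" "0 < Re z"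
  shows "laplace (\<lambda>t. f t - g t) z = laplace f z - laplace g z"
  unfolding laplace_eq_inner2 by (intro inner2_diff_left sq_int_exp assms) (use assms in simp)

lemma laplace_scale: "laplace (\<lambda>t. c * f t) z = c * laplace f z"
  unfolding laplace_eq_inner2 by (rule inner2_scale_left)

lemma laplace_cong_AE:
  assumes "sq_int Rplus f" "g \<in> borel_measurable Rplus" "AE t in Rplus. f t = g t"
  shows "laplace f z = laplace g z"
proof -
  have [measurable]: "f \<in> borel_measurable Rplus" "g \<in> borel_measurable Rplus"
    using assms by (auto simp: sq_int_def)
  have [measurable]: "(\<lambda>t. exp (- (z * complex_of_real t))) \<in> borel_measurable Rplus"
    by (intro measurable_Rplus_borel borel_measurable_continuous_onI continuous_intros)
  show ?thesis unfolding laplace_def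
    by (rule integral_cong_AE) (use assms(3) in auto)
qed

lemma laplace_expsum:
  assumes "0 < Re z"
  shows "xs \<in> pos_exponents \<Longrightarrow> laplace (expsum xs) z = explin (\<lambda>a. 1 / (of_real a + z)) xs"
proof (induction xs)
  case Nil
  thus ?case by (simp add: laplace_def)
next
  case (Cons x xs)
  obtain c a where x: "x = (c, a)" by (cases x)
  have e: "expsum (x # xs) = (\<lambda>t. c * exp (- (of_real a * of_real t)) + expsum xs t)"
    by (rule ext) (simp add: x)
  have "laplace (\<lambda>t. exp (- (of_real a * of_real t))) z = 1 / (of_real a + z)"
    unfolding laplace_eq_inner2 using Cons.prems assms by (subst inner2_exp) (auto simp: x)
  with Cons show ?case unfolding e using assms
    by (subst laplace_add) (auto simp: x laplace_scale intro!: sq_int_scale sq_int_exp sq_int_expsum)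
qed

lemma open_Cplus: "open Cplus"
  unfolding Cplus_def by (rule open_halfspace_Re_gt)

lemma convex_Cplus: "convex Cplus"
  unfolding Cplus_def by (rule convex_halfspace_Re_gt)

lemma explin_holomorphic:
  assumes "xs \<in> pos_exponents"
  shows "(\<lambda>z. explin (\<lambda>a. 1 / (of_real a + z)) xs) holomorphic_on Cplus"
  using assms
proof (induction xs)
  case (Cons x xs)
  obtain c a where x: "x = (c, a)" by (cases x)
  have "(\<lambda>z. 1 / (complex_of_real a + z)) holomorphic_on Cplus"
    using Cons.prems x by (intro holomorphic_intros) (auto simp: Cplus_def complex_eq_iff)
  moreover have "(\<lambda>z. explin (\<lambda>a. 1 / (of_real a + z)) xs) holomorphic_on Cplus"
    using Cons x by simp
  ultimately show ?case
    unfolding x explin_simps by (intro holomorphic_on_add holomorphic_on_mult holomorphic_on_const)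
qed simp

text \<open>Transforms of exponential sums are rational with poles on the negative real axis, and
  transforms of general functions are locally uniform limits of these.\<close>

lemma laplace_holomorphic:
  assumes f: "sq_int Rplus f"
  shows "laplace f holomorphic_on Cplus"
proof -
  obtain xs where xs: "\<And>n. xs n \<in> pos_exponents"
    and lim: "(\<lambda>n. norm2 Rplus (\<lambda>t. expsum (xs n) t - f t)) \<longlonglongrightarrow> 0"
    using expsum_dense[OF f] by blast
  show ?thesis
  proof (rule holomorphic_uniform_sequence[OF open_Cplus])
    show "laplace (expsum (xs n)) holomorphic_on Cplus" for n
      using explin_holomorphic[OF xs[of n]]
      by (rule holomorphic_transform) (simp add: Cplus_def laplace_expsum[OF _ xs])
    fix z assume "z \<in> Cplus"
    hence z: "0 < Re z" by (simp add: Cplus_def)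
    have Re_ge: "Re z / 2 \<le> Re w" if "w \<in> cball z (Re z / 2)" for w
      using that abs_Re_le_cmod[of "z - w"] by (auto simp: dist_norm)
    show "\<exists>d>0. cball z d \<subseteq> Cplus \<and> uniform_limit (cball z d) (\<lambda>n. laplace (expsum (xs n))) (laplace f) sequentially"
    proof (intro exI conjI)
      show "0 < Re z / 2" using z by simp
      show "cball z (Re z / 2) \<subseteq> Cplus" using Re_ge z by (force simp: Cplus_def)
      show "uniform_limit (cball z (Re z / 2)) (\<lambda>n. laplace (expsum (xs n))) (laplace f) sequentially"
      proof (rule uniform_limitI)
        fix e :: real assume e: "0 < e"
        have "\<forall>\<^sub>F n in sequentially. norm2 Rplus (\<lambda>t. expsum (xs n) t - f t) < e * sqrt (Re z)"
          using lim e z by (intro order_tendstoD(2)) auto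
        thus "\<forall>\<^sub>F n in sequentially. \<forall>w\<in>cball z (Re z / 2). dist (laplace (expsum (xs n)) w) (laplace f w) < e"
        proof eventually_elim
          case (elim n)
          show ?case
          proof
            fix w assume w: "w \<in> cball z (Re z / 2)"
            have w0: "0 < Re w" using Re_ge[OF w] z by linarith
            have "dist (laplace (expsum (xs n)) w) (laplace f w) = cmod (laplace (\<lambda>t. expsum (xs n) t - f t) w)"
              by (simp add: dist_norm laplace_diff[OF sq_int_expsum[OF xs] f w0])
            also have "\<dots> \<le> norm2 Rplus (\<lambda>t. expsum (xs n) t - f t) / sqrt (2 * Re w)"
              by (rule cmod_laplace_le[OF sq_int_diff[OF sq_int_expsum[OF xs] f] w0])
            also have "\<dots> \<le> norm2 Rplus (\<lambda>t. expsum (xs n) t - f t) / sqrt (Re z)"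
              using Re_ge[OF w] z by (intro divide_left_mono) auto
            also have "\<dots> < e" using elim z by (simp add: divide_less_eq)
            finally show "dist (laplace (expsum (xs n)) w) (laplace f w) < e" .
          qed
        qed
      qed
    qed
  qed
qed

section \<open>Cauchy kernels and the Plancherel identity on vertical lines\<close>

text \<open>
  On a vertical line the exponential \<open>exp (- b t)\<close> becomes the Cauchy kernel; partial fractions
  give the Gram matrix of these kernels.
\<close>

definition cauchy_ker :: "real \<Rightarrow> real \<Rightarrow> complex" where
  "cauchy_ker b y = 1 / (of_real b + \<i> * of_real y)"

lemma cauchy_ker_denom: "0 < b \<Longrightarrow> complex_of_real b + \<i> * of_real y \<noteq> 0"
  by (simp add: complex_eq_iff)

lemma cmod_cauchy_ker: "(cmod (cauchy_ker b y))\<^sup>2 = 1 / (b\<^sup>2 + y\<^sup>2)"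
  by (simp add: cauchy_ker_def norm_divide cmod_power2 power_divide)

lemma continuous_cauchy_ker: "0 < b \<Longrightarrow> continuous_on UNIV (cauchy_ker b)"
  unfolding cauchy_ker_def[abs_def] by (intro continuous_intros ballI cauchy_ker_denom)

text \<open>The Poisson kernel of the half-plane up to the factor \<open>pi\<close>, obtained by
  rescaling the derivative of the arctangent.\<close>

lemma integral_Poisson:
  fixes b :: real
  assumes b: "0 < b"
  shows "integrable lborel (\<lambda>y. b / (b\<^sup>2 + y\<^sup>2))" "(LINT y|lborel. b / (b\<^sup>2 + y\<^sup>2)) = pi"
proof -
  have i: "integrable lborel (\<lambda>x::real. inverse (1 + x\<^sup>2))"
    using integrable_inverse_1_plus_square by (simp add: set_integrable_def)
  have v: "(LINT x|lborel. inverse (1 + (x::real)\<^sup>2)) = pi"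
    using LBINT_inverse_1_plus_square
    by (simp add: interval_lebesgue_integral_def set_lebesgue_integral_def)
  have e: "b / (b\<^sup>2 + y\<^sup>2) = (1 / b) * inverse (1 + (0 + 1 / b * y)\<^sup>2)" for y
  proof -
    have "b\<^sup>2 + y\<^sup>2 = b\<^sup>2 * (1 + (0 + 1 / b * y)\<^sup>2)" using b by (simp add: field_simps)
    thus ?thesis using b by (simp add: power2_eq_square divide_inverse)
  qed
  show "integrable lborel (\<lambda>y. b / (b\<^sup>2 + y\<^sup>2))"
    unfolding e using b by (intro integrable_mult_right lborel_integrable_real_affine i) auto
  have "pi = \<bar>1 / b\<bar> *\<^sub>R (LINT y|lborel. inverse (1 + (0 + 1 / b * y)\<^sup>2))"
    unfolding v[symmetric] using b by (intro lborel_integral_real_affine) auto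
  thus "(LINT y|lborel. b / (b\<^sup>2 + y\<^sup>2)) = pi"
    unfolding e using b by simp
qed

lemma sq_int_cauchy_ker:
  assumes b: "0 < b"
  shows "sq_int lborel (cauchy_ker b)"
proof -
  have "integrable lborel (\<lambda>y. (1 / b) * (b / (b\<^sup>2 + y\<^sup>2)))"
    by (intro integrable_mult_right integral_Poisson b)
  moreover have "cauchy_ker b \<in> borel_measurable lborel"
    using borel_measurable_continuous_onI[OF continuous_cauchy_ker[OF b]] by simp
  ultimately show ?thesis using b by (simp add: sq_int_def cmod_cauchy_ker)
qed

text \<open>The real part is a sum of two Poisson kernels and the imaginary part is odd. Up to
  \<open>2 * pi\<close> the value is that of \<open>inner2_exp\<close> for the exponents
  \<open>a\<close> and \<open>b\<close>; this coincidence is the isometry on exponential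
  sums.\<close>

lemma inner2_cauchy_ker:
  assumes a: "0 < a" and b: "0 < b"
  shows "inner2 lborel (cauchy_ker a) (cauchy_ker b) = of_real (2 * pi / (a + b))"
proof -
  let ?k = "\<lambda>y. cauchy_ker a y * cnj (cauchy_ker b y)"
  have i: "integrable lborel ?k"
    by (intro integrable_inner2 sq_int_cauchy_ker a b)
  have pos: "a\<^sup>2 + y\<^sup>2 > 0" "b\<^sup>2 + y\<^sup>2 > 0" for y :: real
    using a b by (simp_all add: add_pos_nonneg)
  have k: "?k y = Complex ((a * b + y\<^sup>2) / ((a\<^sup>2 + y\<^sup>2) * (b\<^sup>2 + y\<^sup>2))) ((a - b) * y / ((a\<^sup>2 + y\<^sup>2) * (b\<^sup>2 + y\<^sup>2)))" for y
  proof -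
    have "cauchy_ker a y = Complex (a / (a\<^sup>2 + y\<^sup>2)) (- y / (a\<^sup>2 + y\<^sup>2))" for a
      by (simp add: cauchy_ker_def complex_eq_iff Re_divide Im_divide)
    thus ?thesis
      by (simp add: complex_eq_iff power2_eq_square)
         (simp add: algebra_simps add_divide_distrib diff_divide_distrib)
  qed
  have Re: "Re (?k y) = (1 / (a + b)) * (a / (a\<^sup>2 + y\<^sup>2) + b / (b\<^sup>2 + y\<^sup>2))" for y
  proof -
    have "a / (a\<^sup>2 + y\<^sup>2) + b / (b\<^sup>2 + y\<^sup>2) = (a * (b\<^sup>2 + y\<^sup>2) + b * (a\<^sup>2 + y\<^sup>2)) / ((a\<^sup>2 + y\<^sup>2) * (b\<^sup>2 + y\<^sup>2))"
      using pos[of y] by (subst add_frac_eq) auto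
    also have "a * (b\<^sup>2 + y\<^sup>2) + b * (a\<^sup>2 + y\<^sup>2) = (a + b) * (a * b + y\<^sup>2)"
      by (simp add: power2_eq_square algebra_simps)
    finally show ?thesis unfolding k using a b by simp
  qed
  have "(LINT y|lborel. Re (?k y)) = (1 / (a + b)) * (pi + pi)"
    unfolding Re using integral_Poisson[OF a] integral_Poisson[OF b] by simp
  moreover have "(LINT y|lborel. Im (?k y)) = 0"
  proof -
    have "(LINT y|lborel. Im (?k y)) = \<bar>- 1\<bar> *\<^sub>R (LINT y|lborel. Im (?k (0 + (- 1) * y)))"
      by (rule lborel_integral_real_affine) simp
    also have "\<dots> = - (LINT y|lborel. Im (?k y))" unfolding k by simp
    finally show ?thesis by simp
  qed
  moreover have "inner2 lborel (cauchy_ker a) (cauchy_ker b)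
      = Complex (LINT y|lborel. Re (?k y)) (LINT y|lborel. Im (?k y))"
    unfolding inner2_def complex_eq_iff complex.sel using integral_Re[OF i] integral_Im[OF i] by metis
  ultimately show ?thesis by (simp add: complex_eq_iff)
qed

lemma norm2_cauchy_ker:
  assumes "0 < b"
  shows "norm2 lborel (cauchy_ker b) = sqrt (pi / b)"
proof -
  have "(norm2 lborel (cauchy_ker b))\<^sup>2 = pi / b"
    using inner2_self[OF sq_int_cauchy_ker[OF assms]] inner2_cauchy_ker[OF assms assms]
    by (metis (no_types, lifting) mult_2 mult_divide_mult_cancel_left_if of_real_eq_iff zero_neq_numeral)
  thus ?thesis by (metis norm2_nonneg real_sqrt_unique)
qed

definition cauchy_sum :: "(complex \<times> real) list \<Rightarrow> real \<Rightarrow> complex" where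
  "cauchy_sum xs y = explin (\<lambda>b. cauchy_ker b y) xs"

lemma sq_int_cauchy_sum: "xs \<in> pos_exponents \<Longrightarrow> sq_int lborel (cauchy_sum xs)"
proof (induction xs)
  case Nil
  thus ?case by (simp add: cauchy_sum_def[abs_def])
next
  case (Cons x xs)
  obtain c a where x: "x = (c, a)" by (cases x)
  have "cauchy_sum (x # xs) = (\<lambda>y. c * cauchy_ker a y + cauchy_sum xs y)"
    by (rule ext) (simp add: x cauchy_sum_def)
  with Cons show ?case by (auto simp: x intro!: sq_int_add(1) sq_int_scale sq_int_cauchy_ker)
qed

lemma inner2_cauchy_sum_left:
  assumes g: "sq_int lborel g"
  shows "xs \<in> pos_exponents \<Longrightarrow> inner2 lborel (cauchy_sum xs) g = explin (\<lambda>b. inner2 lborel (cauchy_ker b) g) xs"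
proof (induction xs)
  case Nil
  thus ?case by (simp add: cauchy_sum_def[abs_def] inner2_def)
next
  case (Cons x xs)
  obtain c a where x: "x = (c, a)" by (cases x)
  have e: "cauchy_sum (x # xs) = (\<lambda>y. c * cauchy_ker a y + cauchy_sum xs y)"
    by (rule ext) (simp add: x cauchy_sum_def)
  from Cons show ?case unfolding e using g
    by (subst inner2_add_left)
       (auto simp: x inner2_scale_left intro!: sq_int_scale sq_int_cauchy_ker sq_int_cauchy_sum)
qed

lemma explin_cong: "(\<And>a. 0 < a \<Longrightarrow> h a = h' a) \<Longrightarrow> xs \<in> pos_exponents \<Longrightarrow> explin h xs = explin h' xs"
  by (induction xs) auto

lemma explin_scale: "explin (\<lambda>a. c * h a) xs = c * explin h xs"
  by (induction xs) (auto simp: algebra_simps)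

lemma inner2_cauchy_sum:
  assumes xs: "xs \<in> pos_exponents" and ys: "ys \<in> pos_exponents"
  shows "inner2 lborel (cauchy_sum xs) (cauchy_sum ys) = of_real (2 * pi) * inner2 Rplus (expsum xs) (expsum ys)"
proof -
  have 1: "inner2 lborel (cauchy_ker b) (cauchy_sum ys)
      = of_real (2 * pi) * cnj (laplace (expsum ys) (of_real b))" if b: "0 < b" for b
  proof -
    have "inner2 lborel (cauchy_sum ys) (cauchy_ker b) = explin (\<lambda>a. inner2 lborel (cauchy_ker a) (cauchy_ker b)) ys"
      by (intro inner2_cauchy_sum_left sq_int_cauchy_ker b ys)
    also have "\<dots> = explin (\<lambda>a. of_real (2 * pi) * (1 / (of_real a + of_real b))) ys"
      by (rule explin_cong[OF _ ys]) (simp add: inner2_cauchy_ker b)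
    also have "\<dots> = of_real (2 * pi) * laplace (expsum ys) (of_real b)"
      unfolding explin_scale using b by (simp add: laplace_expsum[OF _ ys])
    finally show ?thesis by (subst inner2_commute) simp
  qed
  have "inner2 lborel (cauchy_sum xs) (cauchy_sum ys) = explin (\<lambda>b. inner2 lborel (cauchy_ker b) (cauchy_sum ys)) xs"
    by (intro inner2_cauchy_sum_left sq_int_cauchy_sum xs ys)
  also have "\<dots> = explin (\<lambda>b. of_real (2 * pi) * cnj (laplace (expsum ys) (of_real b))) xs"
    by (rule explin_cong[OF 1 xs])
  also have "\<dots> = of_real (2 * pi) * inner2 Rplus (expsum xs) (expsum ys)"
    unfolding explin_scale inner2_expsum[OF sq_int_expsum[OF ys] xs] ..
  finally show ?thesis .
qed

lemma norm2_cauchy_sum: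
  assumes xs: "xs \<in> pos_exponents"
  shows "norm2 lborel (cauchy_sum xs) = sqrt (2 * pi) * norm2 Rplus (expsum xs)"
proof -
  have "complex_of_real ((norm2 lborel (cauchy_sum xs))\<^sup>2) = of_real (2 * pi * (norm2 Rplus (expsum xs))\<^sup>2)"
    using inner2_cauchy_sum[OF xs xs]
    unfolding inner2_self[OF sq_int_expsum[OF xs]] inner2_self[OF sq_int_cauchy_sum[OF xs]] by simp
  hence "(norm2 lborel (cauchy_sum xs))\<^sup>2 = (sqrt (2 * pi) * norm2 Rplus (expsum xs))\<^sup>2"
    unfolding of_real_eq_iff by (simp add: power_mult_distrib)
  thus ?thesis by (rule power2_eq_imp_eq) auto
qed

text \<open>Adding \<open>x\<close> to all exponents multiplies the function by
  \<open>exp (- x t)\<close>, and on the other side restricts the transform to the line of abscissa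
  \<open>x\<close>.\<close>

definition shift_exponents :: "real \<Rightarrow> (complex \<times> real) list \<Rightarrow> (complex \<times> real) list" where
  "shift_exponents x = map (\<lambda>(c, a). (c, a + x))"

lemma shift_exponents_pos: "0 \<le> x \<Longrightarrow> xs \<in> pos_exponents \<Longrightarrow> shift_exponents x xs \<in> pos_exponents"
  by (auto simp: shift_exponents_def pos_exponents_def)

lemma explin_shift: "explin h (shift_exponents x xs) = explin (\<lambda>a. h (a + x)) xs"
  by (induction xs) (auto simp: shift_exponents_def)

lemma expsum_shift: "expsum (shift_exponents x xs) t = exp (- (of_real x * of_real t)) * expsum xs t"
  by (induction xs) (auto simp: shift_exponents_def distrib_left distrib_right exp_add exp_diff exp_minus field_simps)

lemma laplace_expsum_line:
  assumes "xs \<in> pos_exponents" "0 < x"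
  shows "laplace (expsum xs) (Complex x y) = cauchy_sum (shift_exponents x xs) y"
proof -
  have "laplace (expsum xs) (Complex x y) = explin (\<lambda>a. 1 / (of_real a + Complex x y)) xs"
    by (rule laplace_expsum) (use assms in auto)
  also have "\<dots> = cauchy_sum (shift_exponents x xs) y"
    by (simp add: cauchy_sum_def explin_shift cauchy_ker_def Complex_eq add.assoc)
  finally show ?thesis .
qed

lemma sq_int_exp_mult:
  assumes "sq_int Rplus f" "0 \<le> x"
  shows "sq_int Rplus (\<lambda>t. exp (- (of_real x * of_real t)) * f t)"
    and norm2_exp_mult_le: "norm2 Rplus (\<lambda>t. exp (- (of_real x * of_real t)) * f t) \<le> norm2 Rplus f"
proof -
  have [measurable]: "f \<in> borel_measurable Rplus" using assms by (simp add: sq_int_def)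
  have [measurable]: "(\<lambda>t. exp (- (complex_of_real x * complex_of_real t))) \<in> borel_measurable Rplus"
    by (intro measurable_Rplus_borel borel_measurable_continuous_onI continuous_intros)
  have m: "(\<lambda>t. exp (- (complex_of_real x * of_real t)) * f t) \<in> borel_measurable Rplus" by measurable
  have le: "(\<integral>\<^sup>+t. ennreal ((cmod (exp (- (complex_of_real x * of_real t)) * f t))\<^sup>2) \<partial>Rplus) \<le> ennreal ((norm2 Rplus f)\<^sup>2)"
    unfolding nn_integral_sq_int[OF assms(1), symmetric]
    by (intro nn_integral_mono ennreal_leI power_mono)
       (auto simp: norm_mult assms intro!: mult_left_le_one_le)
  show "sq_int Rplus (\<lambda>t. exp (- (of_real x * of_real t)) * f t)"
    by (rule sq_intI(1)[OF m le])
  show "norm2 Rplus (\<lambda>t. exp (- (of_real x * of_real t)) * f t) \<le> norm2 Rplus f"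
    by (rule sq_intI(2)[OF m le norm2_nonneg])
qed

lemma continuous_on_line:
  assumes "F holomorphic_on Cplus" "0 < x"
  shows "continuous_on UNIV (\<lambda>y. F (Complex x y))"
  unfolding Complex_eq
  by (rule continuous_on_compose2[OF holomorphic_on_imp_continuous_on[OF assms(1)]])
     (use assms(2) in \<open>auto intro!: continuous_intros simp: Cplus_def\<close>)

lemma measurable_line:
  assumes "F holomorphic_on Cplus" "0 < x"
  shows "(\<lambda>y. F (Complex x y)) \<in> borel_measurable lborel"
  using borel_measurable_continuous_onI[OF continuous_on_line[OF assms]] by simp

text \<open>Plancherel on a line. For exponential sums it is the Gram matrix identity. Approximating
  sums are Cauchy in the norm of the line and converge pointwise to the transform of
  \<open>f\<close>; Fatou's lemma identifies this pointwise limit with the norm limit.\<close>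

lemma laplace_line:
  assumes f: "sq_int Rplus f" and x: "0 < x"
  shows "sq_int lborel (\<lambda>y. laplace f (Complex x y))"
    and "norm2 lborel (\<lambda>y. laplace f (Complex x y)) = sqrt (2 * pi) * norm2 Rplus (\<lambda>t. exp (- (of_real x * of_real t)) * f t)"
proof -
  obtain xs where xs: "\<And>n. xs n \<in> pos_exponents"
    and lim: "(\<lambda>n. norm2 Rplus (\<lambda>t. expsum (xs n) t - f t)) \<longlonglongrightarrow> 0"
    using expsum_dense[OF f] by blast
  let ?e = "\<lambda>t. exp (- (complex_of_real x * complex_of_real t))"
  define E where "E n = cauchy_sum (shift_exponents x (xs n))" for n
  define L where "L y = laplace f (Complex x y)" for y
  have Ls: "L \<in> borel_measurable lborel"
    unfolding L_def[abs_def] by (rule measurable_line[OF laplace_holomorphic[OF f] x])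
  have spos: "shift_exponents x (xs n) \<in> pos_exponents" for n
    using shift_exponents_pos xs x by simp
  have E: "sq_int lborel (E n)" for n
    unfolding E_def by (rule sq_int_cauchy_sum[OF spos])
  have EE: "norm2 lborel (\<lambda>y. E n y - E m y) \<le> sqrt (2 * pi) * norm2 Rplus (\<lambda>t. expsum (xs n) t - expsum (xs m) t)" for n m
  proof -
    obtain zs where zs: "zs \<in> pos_exponents"
      and zt: "\<And>t. expsum zs t = expsum (shift_exponents x (xs n)) t + (- 1) * expsum (shift_exponents x (xs m)) t"
      and zh: "\<And>h. explin h zs = explin h (shift_exponents x (xs n)) + (- 1) * explin h (shift_exponents x (xs m))"
      using expsum_linear[OF spos[of n] spos[of m], of "- 1"] by blast
    have "norm2 lborel (\<lambda>y. E n y - E m y) = norm2 lborel (cauchy_sum zs)"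
      by (simp add: cauchy_sum_def[abs_def] zh E_def)
    also have "\<dots> = sqrt (2 * pi) * norm2 Rplus (expsum zs)" by (rule norm2_cauchy_sum[OF zs])
    also have "expsum zs = (\<lambda>t. ?e t * (expsum (xs n) t - expsum (xs m) t))"
      by (rule ext) (simp add: zt expsum_shift algebra_simps)
    also have "norm2 Rplus (\<lambda>t. ?e t * (expsum (xs n) t - expsum (xs m) t)) \<le> norm2 Rplus (\<lambda>t. expsum (xs n) t - expsum (xs m) t)"
      using x by (intro norm2_exp_mult_le sq_int_diff sq_int_expsum xs) auto
    finally show ?thesis by simp
  qed
  have ptw: "(\<lambda>n. E n y) \<longlonglongrightarrow> L y" for y
  proof -
    have "(\<lambda>n. inner2 Rplus (expsum (xs n)) (\<lambda>t. exp (- (cnj (Complex x y) * of_real t))))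
        \<longlonglongrightarrow> inner2 Rplus f (\<lambda>t. exp (- (cnj (Complex x y) * of_real t)))"
      using x by (intro inner2_tendsto[OF sq_int_expsum[OF xs] f _ lim] sq_int_exp) simp
    moreover have "inner2 Rplus (expsum (xs n)) (\<lambda>t. exp (- (cnj (Complex x y) * of_real t))) = E n y" for n
      using laplace_expsum_line[OF xs x, of n y] by (simp add: laplace_eq_inner2 E_def)
    ultimately show ?thesis unfolding L_def laplace_eq_inner2[symmetric] by simp
  qed
  have tail: "sq_int lborel (\<lambda>y. E n y - L y) \<and> norm2 lborel (\<lambda>y. E n y - L y) \<le> e"
    if N: "\<And>n. N \<le> n \<Longrightarrow> sqrt (2 * pi) * norm2 Rplus (\<lambda>t. expsum (xs n) t - f t) \<le> e / 2" and n: "N \<le> n" for e N n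
  proof -
    have bd: "norm2 lborel (\<lambda>y. E n y - E (m + N) y) \<le> e" for m
    proof -
      have "norm2 lborel (\<lambda>y. E n y - E (m + N) y) \<le> sqrt (2 * pi) * norm2 Rplus (\<lambda>t. expsum (xs n) t - expsum (xs (m + N)) t)"
        by (rule EE)
      also have "norm2 Rplus (\<lambda>t. expsum (xs n) t - expsum (xs (m + N)) t)
          \<le> norm2 Rplus (\<lambda>t. expsum (xs n) t - f t) + norm2 Rplus (\<lambda>t. f t - expsum (xs (m + N)) t)"
        by (intro norm2_triangle sq_int_expsum xs f)
      finally have "norm2 lborel (\<lambda>y. E n y - E (m + N) y) \<le> sqrt (2 * pi) * norm2 Rplus (\<lambda>t. expsum (xs n) t - f t)
          + sqrt (2 * pi) * norm2 Rplus (\<lambda>t. expsum (xs (m + N)) t - f t)"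
        by (simp add: distrib_left norm2_minus[of Rplus f])
      also have "\<dots> \<le> e / 2 + e / 2" by (intro add_mono N n) simp
      finally show ?thesis by simp
    qed
    have e0: "0 \<le> e" using bd[of 0] norm2_nonneg order_trans by blast
    have [measurable]: "E n \<in> borel_measurable lborel" "L \<in> borel_measurable lborel"
      using E Ls by (auto simp: sq_int_def)
    have "AE y in lborel. (\<lambda>m. E n y - E (m + N) y) \<longlonglongrightarrow> E n y - L y"
      by (intro AE_I2 tendsto_diff tendsto_const LIMSEQ_ignore_initial_segment ptw)
    from sq_int_Fatou[OF sq_int_diff[OF E E] bd e0 _ this] show ?thesis by simp
  qed
  have ev: "\<exists>N. \<forall>n\<ge>N. sqrt (2 * pi) * norm2 Rplus (\<lambda>t. expsum (xs n) t - f t) \<le> e / 2" if "0 < e" for e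
  proof -
    have "(\<lambda>n. sqrt (2 * pi) * norm2 Rplus (\<lambda>t. expsum (xs n) t - f t)) \<longlonglongrightarrow> sqrt (2 * pi) * 0"
      by (intro tendsto_mult tendsto_const lim)
    from order_tendstoD(2)[OF this, of "e / 2"] that
    have "\<forall>\<^sub>F n in sequentially. sqrt (2 * pi) * norm2 Rplus (\<lambda>t. expsum (xs n) t - f t) < e / 2" by simp
    thus ?thesis unfolding eventually_sequentially by (meson less_imp_le)
  qed
  obtain N1 where N1: "\<And>n. N1 \<le> n \<Longrightarrow> sqrt (2 * pi) * norm2 Rplus (\<lambda>t. expsum (xs n) t - f t) \<le> 1 / 2"
    using ev[of 1] by auto
  have "sq_int lborel (\<lambda>y. E N1 y - (E N1 y - L y))"
    by (rule sq_int_diff[OF E]) (use tail[of N1 1 N1] N1 in auto)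
  hence L: "sq_int lborel L" by simp
  thus "sq_int lborel (\<lambda>y. laplace f (Complex x y))" by (simp add: L_def[abs_def])
  have "(\<lambda>n. norm2 lborel (\<lambda>y. E n y - L y)) \<longlonglongrightarrow> 0"
  proof (rule LIMSEQ_I)
    fix e :: real assume "0 < e"
    then obtain N where "\<And>n. N \<le> n \<Longrightarrow> sqrt (2 * pi) * norm2 Rplus (\<lambda>t. expsum (xs n) t - f t) \<le> (e / 2) / 2"
      using ev[of "e / 2"] by auto
    from tail[OF this] \<open>0 < e\<close> show "\<exists>no. \<forall>n\<ge>no. norm (norm2 lborel (\<lambda>y. E n y - L y) - 0) < e"
      by (intro exI[of _ N]) force
  qed
  from norm2_tendsto[OF E L this] have 1: "(\<lambda>n. norm2 lborel (E n)) \<longlonglongrightarrow> norm2 lborel L" .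
  have ef: "sq_int Rplus (\<lambda>t. ?e t * f t)" using x by (intro sq_int_exp_mult f) auto
  have ex: "sq_int Rplus (\<lambda>t. ?e t * expsum (xs n) t)" for n
    using x by (intro sq_int_exp_mult sq_int_expsum xs) auto
  have "(\<lambda>n. norm2 Rplus (\<lambda>t. ?e t * expsum (xs n) t - ?e t * f t)) \<longlonglongrightarrow> 0"
  proof (rule Lim_null_comparison[OF _ lim])
    have "norm2 Rplus (\<lambda>t. ?e t * (expsum (xs n) t - f t)) \<le> norm2 Rplus (\<lambda>t. expsum (xs n) t - f t)" for n
      using x by (intro norm2_exp_mult_le sq_int_diff sq_int_expsum xs f) auto
    thus "\<forall>\<^sub>F n in sequentially. norm (norm2 Rplus (\<lambda>t. ?e t * expsum (xs n) t - ?e t * f t))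
        \<le> norm2 Rplus (\<lambda>t. expsum (xs n) t - f t)"
      by (simp add: right_diff_distrib)
  qed
  from norm2_tendsto[OF ex ef this]
  have "(\<lambda>n. norm2 Rplus (\<lambda>t. ?e t * expsum (xs n) t)) \<longlonglongrightarrow> norm2 Rplus (\<lambda>t. ?e t * f t)" .
  hence "(\<lambda>n. sqrt (2 * pi) * norm2 Rplus (\<lambda>t. ?e t * expsum (xs n) t)) \<longlonglongrightarrow> sqrt (2 * pi) * norm2 Rplus (\<lambda>t. ?e t * f t)"
    by (intro tendsto_intros)
  moreover have "norm2 lborel (E n) = sqrt (2 * pi) * norm2 Rplus (\<lambda>t. ?e t * expsum (xs n) t)" for n
    unfolding E_def norm2_cauchy_sum[OF spos] by (simp add: expsum_shift[abs_def])
  ultimately have "norm2 lborel L = sqrt (2 * pi) * norm2 Rplus (\<lambda>t. ?e t * f t)"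
    using LIMSEQ_unique[OF 1] by simp
  thus "norm2 lborel (\<lambda>y. laplace f (Complex x y)) = sqrt (2 * pi) * norm2 Rplus (\<lambda>t. ?e t * f t)"
    by (simp add: L_def[abs_def])
qed

lemma line_norm_eq: "line_norm F x = norm2 lborel (\<lambda>y. F (Complex x y)) / sqrt (2 * pi)"
  by (simp add: line_norm_def norm2_def real_sqrt_mult real_sqrt_divide)

text \<open>On the line of abscissa \<open>x\<close> the norm is that of
  \<open>exp (- x t) * f t\<close>, which is at most the norm of \<open>f\<close>. Fatou's lemma
  along \<open>x = 1 / Suc n\<close> shows that the supremum attains this bound.\<close>

lemma hardy_laplace:
  assumes f: "sq_int Rplus f" and F: "\<And>z. z \<in> Cplus \<Longrightarrow> F z = laplace f z"
  shows "F \<in> hardy" and "hardy_norm F = norm2 Rplus f"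
proof -
  let ?e = "\<lambda>x t. exp (- (complex_of_real x * complex_of_real t))"
  have FL: "F (Complex x y) = laplace f (Complex x y)" if "0 < x" for x y
    using F that by (simp add: Cplus_def)
  have line: "line_norm F x = norm2 Rplus (\<lambda>t. ?e x t * f t)" if "0 < x" for x
    unfolding line_norm_eq FL[OF that] laplace_line(2)[OF f that] by simp
  have le: "line_norm F x \<le> norm2 Rplus f" if "0 < x" for x
    unfolding line[OF that] using that by (intro norm2_exp_mult_le f) simp
  have bdd: "bdd_above (line_norm F ` {0<..})"
    using le by (intro bdd_aboveI[of _ "norm2 Rplus f"]) auto
  have "F holomorphic_on Cplus"
    using laplace_holomorphic[OF f] by (rule holomorphic_transform) (simp add: F)
  moreover have "integrable lborel (\<lambda>y. (cmod (F (Complex x y)))\<^sup>2)" if "0 < x" for x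
    using laplace_line(1)[OF f that] unfolding FL[OF that] by (simp add: sq_int_def)
  ultimately show "F \<in> hardy" using bdd by (simp add: hardy_def)
  show "hardy_norm F = norm2 Rplus f"
  proof (rule antisym)
    show "hardy_norm F \<le> norm2 Rplus f"
      unfolding hardy_norm_def using le by (intro cSUP_least) auto
    have bd: "norm2 Rplus (\<lambda>t. ?e (1 / real (Suc n)) t * f t) \<le> hardy_norm F" for n
    proof -
      have pos: "0 < 1 / real (Suc n)" by simp
      show ?thesis
        unfolding hardy_norm_def line[OF pos, symmetric] by (rule cSUP_upper[OF _ bdd]) simp
    qed
    have "AE t in Rplus. (\<lambda>n. ?e (1 / real (Suc n)) t * f t) \<longlonglongrightarrow> f t"
    proof (rule AE_I2)
      fix t :: real
      have "(\<lambda>n. ?e (1 / real (Suc n)) t * f t) \<longlonglongrightarrow> exp (- (complex_of_real 0 * complex_of_real t)) * f t"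
        by (intro tendsto_intros LIMSEQ_inverse_real_of_nat[unfolded inverse_eq_divide])
      thus "(\<lambda>n. ?e (1 / real (Suc n)) t * f t) \<longlonglongrightarrow> f t" by simp
    qed
    moreover have "0 \<le> hardy_norm F" using bd[of 0] norm2_nonneg order_trans by blast
    ultimately show "norm2 Rplus f \<le> hardy_norm F"
      using f by (intro sq_int_Fatou(2)[OF sq_int_exp_mult(1)[OF f] bd]) (auto simp: sq_int_def)
  qed
qed


section \<open>Surjectivity of the Laplace transform\<close>

lemma LIMSEQ_integral_symmetric_interval:
  fixes q :: "real \<Rightarrow> complex"
  assumes q: "integrable lborel q" and Y: "filterlim Y at_top sequentially"
  shows "(\<lambda>n. LINT y|lborel. indicator {- Y n..Y n} y *\<^sub>R q y) \<longlonglongrightarrow> (LINT y|lborel. q y)"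
proof (rule integral_dominated_convergence[where w = "\<lambda>y. norm (q y)"])
  show "AE y in lborel. (\<lambda>n. indicator {- Y n..Y n} y *\<^sub>R q y) \<longlonglongrightarrow> q y"
  proof (rule AE_I2)
    fix y :: real
    have "\<forall>\<^sub>F n in sequentially. \<bar>y\<bar> \<le> Y n" using Y unfolding filterlim_at_top by blast
    hence "\<forall>\<^sub>F n in sequentially. indicator {- Y n..Y n} y *\<^sub>R q y = q y"
      by eventually_elim (auto simp: indicator_def)
    thus "(\<lambda>n. indicator {- Y n..Y n} y *\<^sub>R q y) \<longlonglongrightarrow> q y"
      by (rule tendsto_eventually)
  qed
qed (use q in \<open>auto simp: indicator_def\<close>)

text \<open>In terms of a primitive, Cauchy's theorem on a rectangle is a cancellation of corner
  values. This treats the vertical sides, the next lemma the horizontal ones.\<close>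

lemma vertical_integral_primitive:
  assumes P: "\<And>z. z \<in> Cplus \<Longrightarrow> (P has_field_derivative Q z) (at z)"
    and Q: "Q holomorphic_on Cplus" and s: "0 < s" and Y: "0 \<le> Y"
  shows "(LINT y|lborel. indicator {- Y..Y} y *\<^sub>R (\<i> * Q (Complex s y))) = P (Complex s Y) - P (Complex s (- Y))"
proof (rule integral_FTC_atLeastAtMost)
  show "- Y \<le> Y" using Y by simp
  fix y
  have v: "((\<lambda>y. of_real s + \<i> * of_real y) has_vector_derivative \<i>) (at y within {- Y..Y})"
    unfolding has_vector_derivative_def
    by (auto intro!: derivative_eq_intros simp: scaleR_conv_of_real)
  have z: "of_real s + \<i> * of_real y \<in> Cplus" using s by (simp add: Cplus_def)
  have "(P \<circ> (\<lambda>y. of_real s + \<i> * of_real y) has_vector_derivative \<i> * Q (of_real s + \<i> * of_real y)) (at y within {- Y..Y})"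
    by (rule field_vector_diff_chain_within[OF v has_field_derivative_at_within[OF P[OF z]]])
  thus "((\<lambda>y. P (Complex s y)) has_vector_derivative \<i> * Q (Complex s y)) (at y within {- Y..Y})"
    by (simp add: o_def Complex_eq)
next
  show "continuous_on {- Y..Y} (\<lambda>y. \<i> * Q (Complex s y))"
    by (intro continuous_intros continuous_on_subset[OF continuous_on_line[OF Q s]]) simp
qed

lemma horizontal_integral_primitive:
  assumes P: "\<And>z. z \<in> Cplus \<Longrightarrow> (P has_field_derivative Q z) (at z)"
    and Q: "Q holomorphic_on Cplus" and x: "0 < x" "x \<le> X"
  shows "(LINT s|lborel. indicator {x..X} s *\<^sub>R Q (Complex s y)) = P (Complex X y) - P (Complex x y)"
proof (rule integral_FTC_atLeastAtMost)
  show "x \<le> X" by (rule x)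
  fix s assume "x \<le> s" "s \<le> X"
  hence z: "of_real s + \<i> * of_real y \<in> Cplus" using x by (simp add: Cplus_def)
  have v: "((\<lambda>s. of_real s + \<i> * of_real y) has_vector_derivative 1) (at s within {x..X})"
    unfolding has_vector_derivative_def
    by (auto intro!: derivative_eq_intros simp: scaleR_conv_of_real)
  have "(P \<circ> (\<lambda>s. of_real s + \<i> * of_real y) has_vector_derivative 1 * Q (of_real s + \<i> * of_real y)) (at s within {x..X})"
    by (rule field_vector_diff_chain_within[OF v has_field_derivative_at_within[OF P[OF z]]])
  thus "((\<lambda>s. P (Complex s y)) has_vector_derivative Q (Complex s y)) (at s within {x..X})"
    by (simp add: o_def Complex_eq)
next
  show "continuous_on {x..X} (\<lambda>s. Q (Complex s y))"
    unfolding Complex_eq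
    by (rule continuous_on_compose2[OF holomorphic_on_imp_continuous_on[OF Q]])
       (use x in \<open>auto intro!: continuous_intros simp: Cplus_def\<close>)
qed

text \<open>
  Square integrability over the strip makes the horizontal sides of suitable rectangles negligible:
  the energy \<open>M y\<close> on the horizontal segment at height \<open>y\<close> is at most \<open>1\<close> for arbitrarily large \<open>y\<close>.
\<close>

lemma vertical_integral_shift:
  assumes Q: "Q holomorphic_on Cplus" and H: "H holomorphic_on Cplus" and x: "0 < x" "x \<le> X"
    and QH: "\<And>s y. s \<in> {x..X} \<Longrightarrow> y \<noteq> 0 \<Longrightarrow> cmod (Q (Complex s y)) \<le> cmod (H (Complex s y)) / \<bar>y\<bar>"
    and HK: "\<And>s. s \<in> {x..X} \<Longrightarrow> (\<integral>\<^sup>+y. ennreal ((cmod (H (Complex s y)))\<^sup>2) \<partial>lborel) \<le> ennreal K"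
    and int: "integrable lborel (\<lambda>y. Q (Complex x y))" "integrable lborel (\<lambda>y. Q (Complex X y))"
  shows "(LINT y|lborel. Q (Complex x y)) = (LINT y|lborel. Q (Complex X y))"
proof -
  obtain P where P0: "\<And>z. z \<in> Cplus \<Longrightarrow> (P has_field_derivative Q z) (at z within Cplus)"
    using holomorphic_convex_primitive'[OF convex_Cplus open_Cplus Q] by blast
  have P: "(P has_field_derivative Q z) (at z)" if "z \<in> Cplus" for z
    using P0[OF that] at_within_open[OF that open_Cplus] by simp
  \<comment> \<open>Cut off to the closed strip, on which the energy density is continuous and
    therefore Borel; nothing is known about \<open>H\<close> outside of
    \<open>Cplus\<close>.\<close>
  define g where "g p = indicator ({x..X} \<times> UNIV) p *\<^sub>R (cmod (H (Complex (fst p) (snd p))))\<^sup>2" for p :: "real \<times> real"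
  have g_meas: "g \<in> borel_measurable (borel \<Otimes>\<^sub>M borel)"
  proof -
    have "continuous_on ({x..X} \<times> UNIV) (\<lambda>p. H (of_real (fst p) + \<i> * of_real (snd p)))"
      by (rule continuous_on_compose2[OF holomorphic_on_imp_continuous_on[OF H]])
         (use x in \<open>auto intro!: continuous_intros simp: Cplus_def\<close>)
    hence "continuous_on ({x..X} \<times> UNIV) (\<lambda>p. (cmod (H (Complex (fst p) (snd p))))\<^sup>2)"
      unfolding Complex_eq by (intro continuous_intros)
    moreover have "closed ({x..X} \<times> (UNIV :: real set))" by (intro closed_Times) auto
    hence "{x..X} \<times> UNIV \<in> sets (borel :: (real \<times> real) measure)" by (rule borel_closed)
    ultimately have "g \<in> borel_measurable borel"
      unfolding g_def[abs_def] by (intro borel_measurable_continuous_on_indicator)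
    thus ?thesis by (simp add: borel_prod)
  qed
  hence [measurable]: "case_prod (\<lambda>s y. g (s, y)) \<in> borel_measurable (borel \<Otimes>\<^sub>M borel)" by simp
  have g_eq: "g (s, y) = indicator {x..X} s * (cmod (H (Complex s y)))\<^sup>2" for s y
    by (simp add: g_def indicator_def)
  have [measurable]: "(\<lambda>p. g (snd p, fst p)) \<in> borel_measurable (borel \<Otimes>\<^sub>M borel)"
    by (rule measurable_compose[OF _ g_meas, of "\<lambda>p. (snd p, fst p)"]) measurable
  define M where "M y = (\<integral>\<^sup>+s. ennreal (g (s, y)) \<partial>lborel)" for y
  have [measurable]: "M \<in> borel_measurable borel"
    unfolding M_def by (rule lborel.borel_measurable_nn_integral) (simp add: split_def)
  have "(\<integral>\<^sup>+y. M y \<partial>lborel) = (\<integral>\<^sup>+s. \<integral>\<^sup>+y. ennreal (g (s, y)) \<partial>lborel \<partial>lborel)"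
    unfolding M_def by (rule lborel_pair.Fubini') simp
  also have "\<dots> \<le> (\<integral>\<^sup>+s. ennreal K * indicator {x..X} s \<partial>lborel)"
  proof (rule nn_integral_mono)
    fix s :: real
    show "(\<integral>\<^sup>+y. ennreal (g (s, y)) \<partial>lborel) \<le> ennreal K * indicator {x..X} s"
      using HK[of s] by (cases "s \<in> {x..X}") (simp_all add: g_eq)
  qed
  also have "\<dots> < \<infinity>" using x by (simp add: nn_integral_cmult ennreal_mult_less_top)
  finally have M_fin: "(\<integral>\<^sup>+y. M y \<partial>lborel) < \<infinity>" .
  have "(\<integral>\<^sup>+y. M y \<partial>lborel) = (\<integral>\<^sup>+y. M (- y) \<partial>lborel)"
    by (subst nn_integral_real_affine[where c = "- 1" and t = 0]) auto
  hence MM_fin: "(\<integral>\<^sup>+y. M y + M (- y) \<partial>lborel) < \<infinity>"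
    using M_fin by (subst nn_integral_add) auto
  \<comment> \<open>Otherwise a function with finite integral would be at least \<open>1\<close> on
    a half-line. Adding \<open>M (- y)\<close> makes one height serve both the upper and the lower
    side.\<close>
  have "\<exists>y\<ge>real (Suc n). M y + M (- y) \<le> 1" for n
  proof (rule ccontr)
    assume "\<not> ?thesis"
    hence ge: "1 \<le> M y + M (- y)" if "real (Suc n) \<le> y" for y
      using that by (meson less_imp_le not_le)
    obtain c where c: "(\<integral>\<^sup>+y. M y + M (- y) \<partial>lborel) = ennreal c" "0 \<le> c"
      using MM_fin by (cases "\<integral>\<^sup>+y. M y + M (- y) \<partial>lborel") auto
    obtain k where k: "c < real k" using reals_Archimedean2 by blast
    have "(\<integral>\<^sup>+y. indicator {real (Suc n)..real (Suc n) + real k} y \<partial>lborel) \<le> ennreal c"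
      unfolding c(1)[symmetric]
    proof (rule nn_integral_mono)
      fix y
      show "indicator {real (Suc n)..real (Suc n) + real k} y \<le> M y + M (- y)"
        using ge[of y] by (cases "y \<in> {real (Suc n)..real (Suc n) + real k}") auto
    qed
    hence "ennreal (real k) \<le> ennreal c" by simp
    thus False using k c(2) by (simp add: ennreal_le_iff)
  qed
  then obtain Y where Y: "\<And>n. real (Suc n) \<le> Y n" and MY: "\<And>n. M (Y n) + M (- Y n) \<le> 1" by metis
  have Y_lim: "filterlim Y at_top sequentially"
    by (rule filterlim_at_top_mono[OF filterlim_compose[OF filterlim_real_sequentially filterlim_Suc]])
       (use Y in auto)
  have M1: "M (Y n) \<le> 1" "M (- Y n) \<le> 1" for n
    using MY[of n] by (auto intro: order_trans[rotated])
  \<comment> \<open>The decay of \<open>Q\<close> relative to \<open>H\<close> and the inequality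
    \<open>a \<le> a^2 + 1\<close> reduce the integral of the modulus to the energy and the length
    of the segment.\<close>
  have hor: "cmod (P (Complex X y) - P (Complex x y)) \<le> (1 + (X - x)) / \<bar>y\<bar>" if y: "y \<noteq> 0" and My: "M y \<le> 1" for y
  proof -
    let ?h = "\<lambda>s. indicator {x..X} s *\<^sub>R Q (Complex s y)"
    have "continuous_on {x..X} (\<lambda>s. Q (of_real s + \<i> * of_real y))"
      by (rule continuous_on_compose2[OF holomorphic_on_imp_continuous_on[OF Q]])
         (use x in \<open>auto intro!: continuous_intros simp: Cplus_def\<close>)
    hence i: "integrable lborel ?h"
      using borel_integrable_atLeastAtMost' unfolding set_integrable_def Complex_eq by blast
    have [measurable]: "(\<lambda>s. g (s, y)) \<in> borel_measurable borel"
      using measurable_compose[OF measurable_Pair2' g_meas, of y] by simp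
    have "ennreal (cmod (P (Complex X y) - P (Complex x y))) \<le> (\<integral>\<^sup>+s. ennreal (norm (?h s)) \<partial>lborel)"
      using integral_norm_bound_ennreal[OF i] by (simp only: horizontal_integral_primitive[OF P Q x])
    also have "\<dots> \<le> (\<integral>\<^sup>+s. (ennreal (g (s, y)) + indicator {x..X} s) * ennreal (1 / \<bar>y\<bar>) \<partial>lborel)"
    proof (rule nn_integral_mono)
      fix s :: real
      show "ennreal (norm (?h s)) \<le> (ennreal (g (s, y)) + indicator {x..X} s) * ennreal (1 / \<bar>y\<bar>)"
      proof (cases "s \<in> {x..X}")
        case True
        let ?a = "cmod (H (Complex s y))"
        have "2 * ?a \<le> ?a\<^sup>2 + 1" using sum_squares_bound[of ?a 1] by simp
        hence "?a \<le> ?a\<^sup>2 + 1" using norm_ge_zero[of "H (Complex s y)"] by linarith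
        hence "?a / \<bar>y\<bar> \<le> (?a\<^sup>2 + 1) / \<bar>y\<bar>" by (intro divide_right_mono) auto
        with QH[OF True y] have "cmod (Q (Complex s y)) \<le> (?a\<^sup>2 + 1) * (1 / \<bar>y\<bar>)" by simp
        hence "ennreal (cmod (Q (Complex s y))) \<le> ennreal ((?a\<^sup>2 + 1) * (1 / \<bar>y\<bar>))" by (rule ennreal_leI)
        also have "\<dots> = (ennreal (?a\<^sup>2) + 1) * ennreal (1 / \<bar>y\<bar>)"
          by (subst ennreal_mult) (auto simp: ennreal_plus)
        finally show ?thesis using True by (simp add: g_eq)
      qed simp
    qed
    also have "\<dots> = (M y + ennreal (X - x)) * ennreal (1 / \<bar>y\<bar>)"
      using x by (simp add: nn_integral_multc nn_integral_add M_def)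
    also have "\<dots> \<le> (1 + ennreal (X - x)) * ennreal (1 / \<bar>y\<bar>)"
      using My by (intro mult_right_mono add_mono) auto
    also have "\<dots> = ennreal ((1 + (X - x)) / \<bar>y\<bar>)"
      using x by (simp add: ennreal_mult[symmetric] ennreal_1[symmetric] ennreal_plus[symmetric] del: ennreal_1 ennreal_plus)
    finally show ?thesis using x by (subst (asm) ennreal_le_iff) auto
  qed
  have hor_lim: "(\<lambda>n. P (Complex X (\<sigma> * Y n)) - P (Complex x (\<sigma> * Y n))) \<longlonglongrightarrow> 0" if "\<sigma> = 1 \<or> \<sigma> = - 1" for \<sigma>
  proof (rule Lim_null_comparison)
    show "\<forall>\<^sub>F n in sequentially. norm (P (Complex X (\<sigma> * Y n)) - P (Complex x (\<sigma> * Y n))) \<le> (1 + (X - x)) / real (Suc n)"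
    proof (intro always_eventually allI)
      fix n
      have Yn: "0 < Y n" using Y[of n] by simp
      hence "\<sigma> * Y n \<noteq> 0" "\<bar>\<sigma> * Y n\<bar> = Y n" "M (\<sigma> * Y n) \<le> 1" using that M1[of n] by auto
      with hor[of "\<sigma> * Y n"] have "norm (P (Complex X (\<sigma> * Y n)) - P (Complex x (\<sigma> * Y n))) \<le> (1 + (X - x)) / Y n" by simp
      also have "\<dots> \<le> (1 + (X - x)) / real (Suc n)" using x Y[of n] by (intro divide_left_mono) auto
      finally show "norm (P (Complex X (\<sigma> * Y n)) - P (Complex x (\<sigma> * Y n))) \<le> (1 + (X - x)) / real (Suc n)" .
    qed
    have "(\<lambda>n. (1 + (X - x)) * inverse (real (Suc n))) \<longlonglongrightarrow> (1 + (X - x)) * 0"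
      by (intro tendsto_intros LIMSEQ_inverse_real_of_nat)
    thus "(\<lambda>n. (1 + (X - x)) / real (Suc n)) \<longlonglongrightarrow> 0" by (simp add: divide_inverse)
  qed
  have vert: "(\<lambda>n. P (Complex s (Y n)) - P (Complex s (- Y n))) \<longlonglongrightarrow> (LINT y|lborel. \<i> * Q (Complex s y))"
    if "0 < s" "integrable lborel (\<lambda>y. Q (Complex s y))" for s
  proof -
    have "0 \<le> Y n" for n using Y[of n] by simp
    thus ?thesis
      using LIMSEQ_integral_symmetric_interval[OF _ Y_lim, of "\<lambda>y. \<i> * Q (Complex s y)"] that
      by (simp add: vertical_integral_primitive[OF P Q])
  qed
  have "(\<lambda>n. (P (Complex X (Y n)) - P (Complex X (- Y n))) - (P (Complex x (Y n)) - P (Complex x (- Y n))))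
      \<longlonglongrightarrow> (LINT y|lborel. \<i> * Q (Complex X y)) - (LINT y|lborel. \<i> * Q (Complex x y))"
    using x by (intro tendsto_diff vert int) auto
  moreover have "(\<lambda>n. (P (Complex X (Y n)) - P (Complex X (- Y n))) - (P (Complex x (Y n)) - P (Complex x (- Y n)))) \<longlonglongrightarrow> 0"
    using tendsto_diff[OF hor_lim[of 1] hor_lim[of "- 1"]] by (simp add: algebra_simps)
  ultimately have "(LINT y|lborel. \<i> * Q (Complex X y)) - (LINT y|lborel. \<i> * Q (Complex x y)) = 0"
    using LIMSEQ_unique by blast
  thus ?thesis by simp
qed

lemma hardy_line:
  assumes G: "G \<in> hardy" and x: "0 < x"
  shows "sq_int lborel (\<lambda>y. G (Complex x y))"
    and "norm2 lborel (\<lambda>y. G (Complex x y)) \<le> sqrt (2 * pi) * hardy_norm G"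
proof -
  show "sq_int lborel (\<lambda>y. G (Complex x y))"
    using G x measurable_line[of G x] by (auto simp: hardy_def sq_int_def)
  have "line_norm G x \<le> hardy_norm G"
    unfolding hardy_norm_def using G x by (intro cSUP_upper) (auto simp: hardy_def)
  thus "norm2 lborel (\<lambda>y. G (Complex x y)) \<le> sqrt (2 * pi) * hardy_norm G"
    by (simp add: line_norm_eq pos_divide_le_eq mult.commute)
qed

text \<open>
  Subtracting the multiple \<open>G p * p / z\<close> of a Cauchy kernel makes \<open>G\<close> vanish at \<open>p\<close>; the quotient
  by \<open>z - p\<close> then has vanishing integral over vertical lines, since these can be moved to infinity.
\<close>

lemma hardy_Cauchy:
  assumes G: "G \<in> hardy" and x: "0 < x" and p: "x < p"
  shows "inner2 lborel (\<lambda>y. G (Complex x y)) (cauchy_ker (p - x)) = of_real (2 * pi) * G (of_real p)"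
proof -
  have p0: "0 < p" using x p by simp
  have Ghol: "G holomorphic_on Cplus" using G by (simp add: hardy_def)
  \<comment> \<open>Subtracting the constant \<open>G p\<close> would destroy square integrability
    on lines; a multiple of \<open>1 / z\<close> preserves it, and this multiple makes
    \<open>H\<close> vanish at \<open>p\<close>.\<close>
  define c where "c = G (of_real p) * of_real p"
  define H where "H z = G z - c / z" for z
  \<comment> \<open>This is \<open>H z / (z - p)\<close> with its singularity removed, since
    \<open>H\<close> vanishes at \<open>p\<close>.\<close>
  define Q where "Q z = (if z = of_real p then deriv H (of_real p) else (H z - H (of_real p)) / (z - of_real p))" for z
  have H: "H holomorphic_on Cplus"
    unfolding H_def using Ghol by (intro holomorphic_intros) (auto simp: Cplus_def)
  have Q: "Q holomorphic_on Cplus"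
    unfolding Q_def by (rule pole_lemma_open[OF H open_Cplus])
  have Hp: "H (of_real p) = 0" using p0 by (simp add: H_def c_def)
  have H_line: "(\<lambda>y. H (Complex s y)) = (\<lambda>y. G (Complex s y) - c * cauchy_ker s y)" for s
    by (rule ext) (simp add: H_def cauchy_ker_def Complex_eq)
  \<comment> \<open>The Cauchy kernel of a line has norm decreasing in the abscissa, so its norm at
    \<open>x\<close> serves for all lines further to the right.\<close>
  define B where "B = sqrt (2 * pi) * hardy_norm G + cmod c * sqrt (pi / x)"
  have B0: "0 \<le> B"
    unfolding B_def using hardy_line(2)[OF G x] x by (intro add_nonneg_nonneg) (auto intro: order_trans[OF norm2_nonneg])
  have Hs: "sq_int lborel (\<lambda>y. H (Complex s y))" "norm2 lborel (\<lambda>y. H (Complex s y)) \<le> B" if s: "x \<le> s" for s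
  proof -
    have s0: "0 < s" using s x by simp
    note sq = hardy_line(1)[OF G s0] sq_int_scale[OF sq_int_cauchy_ker[OF s0], of c]
    show "sq_int lborel (\<lambda>y. H (Complex s y))" unfolding H_line by (rule sq_int_diff[OF sq])
    have "norm2 lborel (\<lambda>y. H (Complex s y)) \<le> norm2 lborel (\<lambda>y. G (Complex s y)) + norm2 lborel (\<lambda>y. c * cauchy_ker s y)"
      unfolding H_line by (rule norm2_diff_le[OF sq])
    also have "norm2 lborel (\<lambda>y. c * cauchy_ker s y) = cmod c * sqrt (pi / s)"
      by (simp add: norm2_scale norm2_cauchy_ker[OF s0])
    also have "\<dots> \<le> cmod c * sqrt (pi / x)"
      using s x by (intro mult_left_mono real_sqrt_le_mono divide_left_mono) auto
    finally show "norm2 lborel (\<lambda>y. H (Complex s y)) \<le> B"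
      using hardy_line(2)[OF G s0] by (simp add: B_def)
  qed
  \<comment> \<open>To the left of \<open>p\<close> the factor \<open>1 / (z - p)\<close> is minus a
    conjugated Cauchy kernel, which produces the pairing in the claim; to the right it is a Cauchy
    kernel, whose norm tends to zero.\<close>
  have Q_left: "Q (Complex x y) = - (H (Complex x y) * cnj (cauchy_ker (p - x) y))" for y
  proof -
    have ne: "Complex x y \<noteq> of_real p" using p by (auto simp: complex_eq_iff)
    define d where "d = of_real (p - x) - \<i> * of_real y"
    have "Complex x y - of_real p = - d" by (simp add: d_def complex_eq_iff)
    moreover have "cnj (cauchy_ker (p - x) y) = 1 / d"
      by (simp add: cauchy_ker_def d_def)
    ultimately show ?thesis using ne by (simp add: Q_def Hp)
  qed
  have Q_right: "Q (Complex X y) = H (Complex X y) * cauchy_ker (X - p) y" if "p < X" for X y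
  proof -
    have ne: "Complex X y \<noteq> of_real p" using that by (auto simp: complex_eq_iff)
    have "Complex X y - of_real p = of_real (X - p) + \<i> * of_real y" by (simp add: complex_eq_iff)
    thus ?thesis using ne by (simp add: Q_def Hp cauchy_ker_def del: of_real_diff)
  qed
  have px: "0 < p - x" using p by simp
  have iL: "integrable lborel (\<lambda>y. Q (Complex x y))"
    unfolding Q_left by (intro Bochner_Integration.integrable_minus integrable_inner2 Hs sq_int_cauchy_ker px order_refl)
  have iR: "integrable lborel (\<lambda>y. Q (Complex X y))"
    and bR: "cmod (LINT y|lborel. Q (Complex X y)) \<le> B * sqrt (pi / (X - p))" if X: "p < X" for X
  proof -
    have X': "0 < X - p" "x \<le> X" using X p by auto
    note i = integrable_norm_mult[OF Hs(1)[OF X'(2)] sq_int_cauchy_ker[OF X'(1)]]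
    have [measurable]: "(\<lambda>y. H (Complex X y)) \<in> borel_measurable lborel" "cauchy_ker (X - p) \<in> borel_measurable lborel"
      using Hs(1)[OF X'(2)] sq_int_cauchy_ker[OF X'(1)] by (auto simp: sq_int_def)
    show "integrable lborel (\<lambda>y. Q (Complex X y))"
      unfolding Q_right[OF X]
      by (rule Bochner_Integration.integrable_bound[OF i(1)]) (auto simp: norm_mult)
    have "cmod (LINT y|lborel. Q (Complex X y)) \<le> (LINT y|lborel. cmod (Q (Complex X y)))"
      by (rule integral_norm_bound)
    also have "\<dots> \<le> norm2 lborel (\<lambda>y. H (Complex X y)) * norm2 lborel (cauchy_ker (X - p))"
      unfolding Q_right[OF X] norm_mult by (rule i(2))
    also have "\<dots> \<le> B * sqrt (pi / (X - p))"
      unfolding norm2_cauchy_ker[OF X'(1)] using Hs(2)[OF X'(2)] X' by (intro mult_right_mono) auto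
    finally show "cmod (LINT y|lborel. Q (Complex X y)) \<le> B * sqrt (pi / (X - p))" .
  qed
  have shift: "(LINT y|lborel. Q (Complex x y)) = (LINT y|lborel. Q (Complex X y))" if X: "p < X" for X
  proof (rule vertical_integral_shift[OF Q H x])
    show "x \<le> X" using p X by simp
    fix s y assume s: "s \<in> {x..X}" and y: "y \<noteq> (0::real)"
    have ne: "Complex s y \<noteq> of_real p" using y by (auto simp: complex_eq_iff)
    have "\<bar>y\<bar> \<le> cmod (Complex s y - of_real p)" using abs_Im_le_cmod[of "Complex s y - of_real p"] by simp
    thus "cmod (Q (Complex s y)) \<le> cmod (H (Complex s y)) / \<bar>y\<bar>"
      using ne y by (auto simp: Q_def Hp norm_divide intro!: divide_left_mono mult_pos_pos)
  next
    fix s assume "s \<in> {x..X}"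
    hence s: "x \<le> s" by simp
    show "(\<integral>\<^sup>+y. ennreal ((cmod (H (Complex s y)))\<^sup>2) \<partial>lborel) \<le> ennreal (B\<^sup>2)"
      unfolding nn_integral_sq_int[OF Hs(1)[OF s]] by (intro ennreal_leI power_mono Hs(2) s) auto
  qed (use iL iR[OF X] in auto)
  \<comment> \<open>The line is moved to the abscissa \<open>p + Suc n\<close>, and then
    \<open>n\<close> tends to infinity.\<close>
  have "cmod (LINT y|lborel. Q (Complex x y)) \<le> B * sqrt (pi / real (Suc n))" for n
    using bR[of "p + real (Suc n)"] shift[of "p + real (Suc n)"] by simp
  moreover have "(\<lambda>n. B * sqrt (pi * inverse (real (Suc n)))) \<longlonglongrightarrow> B * sqrt (pi * 0)"
    by (intro tendsto_intros LIMSEQ_inverse_real_of_nat)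
  hence "(\<lambda>n. B * sqrt (pi / real (Suc n))) \<longlonglongrightarrow> 0" by (simp add: divide_inverse)
  ultimately have "cmod (LINT y|lborel. Q (Complex x y)) \<le> 0"
    by (intro LIMSEQ_le_const[of "\<lambda>n. B * sqrt (pi / real (Suc n))"]) auto
  hence "inner2 lborel (\<lambda>y. H (Complex x y)) (cauchy_ker (p - x)) = 0"
    unfolding Q_left by (simp add: inner2_def)
  moreover have "inner2 lborel (\<lambda>y. H (Complex x y)) (cauchy_ker (p - x))
      = inner2 lborel (\<lambda>y. G (Complex x y)) (cauchy_ker (p - x)) - c * inner2 lborel (cauchy_ker x) (cauchy_ker (p - x))"
    unfolding H_line using x px
    by (simp add: inner2_diff_left inner2_scale_left hardy_line(1)[OF G x] sq_int_cauchy_ker sq_int_scale)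
  \<comment> \<open>The parameters of the two kernels add up to \<open>p\<close>, which cancels the
    factor \<open>p\<close> in \<open>c\<close>.\<close>
  moreover have "c * inner2 lborel (cauchy_ker x) (cauchy_ker (p - x)) = of_real (2 * pi) * G (of_real p)"
    unfolding inner2_cauchy_ker[OF x px] c_def using p0 by simp
  ultimately show ?thesis by simp
qed

text \<open>Cauchy's formula works on lines inside the half-plane, so the functional is first
  bounded for shifted values of \<open>G\<close>, and the shift then tends to zero. The representing
  function has transform \<open>G\<close> on the positive reals, and the identity theorem extends
  this to \<open>Cplus\<close>.\<close>

lemma hardy_is_laplace:
  assumes G: "G \<in> hardy"
  obtains f where "sq_int Rplus f" "\<And>z. z \<in> Cplus \<Longrightarrow> G z = laplace f z"
proof -
  have Ghol: "G holomorphic_on Cplus" using G by (simp add: hardy_def)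
  define h where "h a = cnj (G (of_real a))" for a :: real
  have norm0: "0 \<le> hardy_norm G"
    using order_trans[OF norm2_nonneg hardy_line(2)[OF G zero_less_one]] pi_gt_zero
    by (auto simp: zero_le_mult_iff)
  \<comment> \<open>In \<open>2 * x + a\<close> one \<open>x\<close> is the abscissa of the line and
    the other the shift of the exponents.\<close>
  have bdx: "cmod (explin (\<lambda>a. h (2 * x + a)) xs) \<le> hardy_norm G * norm2 Rplus (expsum xs)"
    if xs: "xs \<in> pos_exponents" and x: "0 < x" for xs x
  proof -
    let ?Gx = "\<lambda>y. G (Complex x y)"
    note spos = shift_exponents_pos[OF less_imp_le[OF x] xs]
    have "inner2 lborel (cauchy_sum (shift_exponents x xs)) ?Gx = explin (\<lambda>b. inner2 lborel (cauchy_ker b) ?Gx) (shift_exponents x xs)"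
      by (rule inner2_cauchy_sum_left[OF hardy_line(1)[OF G x] spos])
    also have "\<dots> = explin (\<lambda>a. of_real (2 * pi) * h (2 * x + a)) xs"
      unfolding explin_shift
    proof (rule explin_cong[OF _ xs])
      fix a :: real assume a: "0 < a"
      have "inner2 lborel ?Gx (cauchy_ker (2 * x + a - x)) = of_real (2 * pi) * G (of_real (2 * x + a))"
        by (rule hardy_Cauchy[OF G x]) (use a x in simp)
      hence "inner2 lborel ?Gx (cauchy_ker (a + x)) = of_real (2 * pi) * G (of_real (2 * x + a))"
        by (simp add: algebra_simps)
      thus "inner2 lborel (cauchy_ker (a + x)) ?Gx = of_real (2 * pi) * h (2 * x + a)"
        by (subst inner2_commute) (simp add: h_def)
    qed
    finally have eq: "inner2 lborel (cauchy_sum (shift_exponents x xs)) ?Gx = of_real (2 * pi) * explin (\<lambda>a. h (2 * x + a)) xs"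
      by (simp only: explin_scale)
    have "2 * pi * cmod (explin (\<lambda>a. h (2 * x + a)) xs) = cmod (inner2 lborel (cauchy_sum (shift_exponents x xs)) ?Gx)"
      unfolding eq norm_mult by simp
    also have "\<dots> \<le> norm2 lborel (cauchy_sum (shift_exponents x xs)) * norm2 lborel ?Gx"
      by (intro inner2_le_norm2 sq_int_cauchy_sum spos hardy_line G x)
    also have "\<dots> \<le> (sqrt (2 * pi) * norm2 Rplus (expsum xs)) * (sqrt (2 * pi) * hardy_norm G)"
    proof (rule mult_mono)
      show "norm2 lborel (cauchy_sum (shift_exponents x xs)) \<le> sqrt (2 * pi) * norm2 Rplus (expsum xs)"
        unfolding norm2_cauchy_sum[OF spos] expsum_shift[abs_def]
        using x by (intro mult_left_mono norm2_exp_mult_le sq_int_expsum xs) auto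
      show "norm2 lborel ?Gx \<le> sqrt (2 * pi) * hardy_norm G" by (rule hardy_line[OF G x])
    qed auto
    also have "\<dots> = 2 * pi * (hardy_norm G * norm2 Rplus (expsum xs))"
      using real_sqrt_mult_self[of "2 * pi"] by (simp add: algebra_simps)
    finally show ?thesis by simp
  qed
  have bd: "cmod (explin h xs) \<le> hardy_norm G * norm2 Rplus (expsum xs)" if xs: "xs \<in> pos_exponents" for xs
  proof -
    have "(\<lambda>n. explin (\<lambda>a. h (2 * inverse (real (Suc n)) + a)) xs) \<longlonglongrightarrow> explin h xs"
      using xs
    proof (induction xs)
      case (Cons ca xs)
      obtain c a where ca: "ca = (c, a)" by (cases ca)
      have a: "0 < a" using Cons.prems ca by simp
      have "continuous_on Cplus G" by (rule holomorphic_on_imp_continuous_on[OF Ghol])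
      hence "isCont G (of_real a)"
        using a continuous_on_eq_continuous_at[OF open_Cplus, of G] by (auto simp: Cplus_def)
      moreover have "(\<lambda>n. complex_of_real (2 * inverse (real (Suc n)) + a)) \<longlonglongrightarrow> of_real (2 * 0 + a)"
        by (intro tendsto_of_real tendsto_add tendsto_mult tendsto_const LIMSEQ_inverse_real_of_nat)
      ultimately have "(\<lambda>n. G (of_real (2 * inverse (real (Suc n)) + a))) \<longlonglongrightarrow> G (of_real a)"
        by (intro isCont_tendsto_compose[where g = G]) auto
      hence "(\<lambda>n. h (2 * inverse (real (Suc n)) + a)) \<longlonglongrightarrow> h a"
        unfolding h_def by (rule tendsto_cnj)
      with Cons ca show ?case by (auto intro!: tendsto_intros)
    qed simp
    from tendsto_norm[OF this] show ?thesis
      using bdx[OF xs, of "inverse (real (Suc n))" for n] by (intro LIMSEQ_le_const2) auto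
  qed
  show thesis
  proof (rule expsum_Riesz[where h = h and B = "hardy_norm G"])
    show "cmod (explin h xs) \<le> hardy_norm G * norm2 Rplus (expsum xs)" if "xs \<in> pos_exponents" for xs
      by (rule bd[OF that])
    show "0 \<le> hardy_norm G" by (rule norm0)
  next
    fix f and xs :: "nat \<Rightarrow> (complex \<times> real) list"
    assume f: "sq_int Rplus f" and fh: "\<And>a. 0 < a \<Longrightarrow> laplace f (of_real a) = cnj (h a)"
    have "G z = laplace f z" if z: "z \<in> Cplus" for z
    proof -
      have "G z - laplace f z = 0"
      proof (rule analytic_continuation[where f = "\<lambda>z. G z - laplace f z" and w = z and S = Cplus and U = "of_real ` {0<..}" and \<xi> = 1])
        show "(\<lambda>z. G z - laplace f z) holomorphic_on Cplus"
          by (intro holomorphic_intros Ghol laplace_holomorphic f)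
        show "1 islimpt complex_of_real ` {0<..}"
          unfolding islimpt_sequential
        proof (intro exI conjI allI)
          have "(\<lambda>n. complex_of_real (1 + inverse (real (Suc n)))) \<longlonglongrightarrow> complex_of_real (1 + 0)"
            by (intro tendsto_of_real tendsto_add tendsto_const LIMSEQ_inverse_real_of_nat)
          thus "(\<lambda>n. complex_of_real (1 + inverse (real (Suc n)))) \<longlonglongrightarrow> 1" by simp
          show "complex_of_real (1 + inverse (real (Suc n))) \<in> complex_of_real ` {0<..} - {1}" for n
          proof -
            have "0 < inverse (real (Suc n))" by simp
            hence "1 + inverse (real (Suc n)) \<noteq> 1" "1 + inverse (real (Suc n)) \<in> {0<..}"
              unfolding greaterThan_iff by linarith+
            thus ?thesis using of_real_eq_1_iff by blast
          qed
        qed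
        show "open Cplus" by (rule open_Cplus)
        show "connected Cplus" by (rule convex_connected[OF convex_Cplus])
      qed (use z fh in \<open>auto simp: Cplus_def h_def\<close>)
      thus ?thesis by simp
    qed
    thus thesis by (rule that[OF f])
  qed
qed

lemma hardy_iff_laplace: "F \<in> hardy \<longleftrightarrow> (\<exists>f. sq_int Rplus f \<and> (\<forall>z\<in>Cplus. F z = laplace f z))"
  using hardy_is_laplace hardy_laplace(1) by metis


section \<open>The Cesaro operator as an integral over dilations\<close>

text \<open>The substitution \<open>r = exp (- t)\<close> as an identity of finite measures, which
  is decided on half-lines and then serves integrands with values in any Banach space.\<close>

lemma distr_exp_minus:
  "distr (density Rplus (\<lambda>t. ennreal (exp (- t)))) borel (\<lambda>t. exp (- t))
    = density lborel (\<lambda>r. ennreal (indicator {0<..<1} r))" (is "?N = ?N'")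
proof (rule measure_eqI_lessThan)
  have em [measurable]: "(\<lambda>t::real. exp (- t)) \<in> borel_measurable Rplus"
    by (rule measurable_Rplus_borel) measurable
  have ex: "emeasure ?N {b<..} = (\<integral>\<^sup>+t. ennreal (exp (- t)) * indicator {t. 0 < t \<and> b < exp (- t)} t \<partial>lborel)" for b
  proof -
    have "(\<lambda>t::real. exp (- t)) -` {b<..} \<inter> space Rplus \<in> sets Rplus"
      by (rule measurable_sets[OF em]) simp
    hence "emeasure ?N {b<..} = (\<integral>\<^sup>+t. ennreal (exp (- t)) * indicator ((\<lambda>t. exp (- t)) -` {b<..} \<inter> {0<..}) t \<partial>Rplus)"
      by (simp add: emeasure_distr emeasure_density)
    also have "\<dots> = (\<integral>\<^sup>+t. ennreal (exp (- t)) * indicator {t. 0 < t \<and> b < exp (- t)} t \<partial>lborel)"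
      unfolding Rplus_def by (subst nn_integral_restrict_space) (auto intro!: nn_integral_cong simp: indicator_def)
    finally show ?thesis .
  qed
  have ex': "emeasure ?N' {b<..} = emeasure lborel ({0<..<1} \<inter> {b<..})" for b :: real
  proof -
    have "emeasure ?N' {b<..} = (\<integral>\<^sup>+r. ennreal (indicator {0<..<1} r) * indicator {b<..} r \<partial>lborel)"
      by (rule emeasure_density) auto
    also have "\<dots> = (\<integral>\<^sup>+r. indicator ({0<..<1} \<inter> {b<..}) r \<partial>lborel)"
      by (rule nn_integral_cong) (auto simp: indicator_def)
    finally show ?thesis by simp
  qed
  have tot: "(\<integral>\<^sup>+t. ennreal (exp (- t)) * indicator {0<..} t \<partial>lborel) = 1"
  proof -
    have "(\<integral>\<^sup>+t. ennreal (t powr (1 - 1) * exp (- t)) \<partial>Rplus) = ennreal (Gamma 1)"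
      using Gamma_integral_Rplus[of 1] by (subst nn_integral_eq_integral) auto
    moreover have "(\<integral>\<^sup>+t. ennreal (t powr (1 - 1) * exp (- t)) \<partial>Rplus) = (\<integral>\<^sup>+t. ennreal (exp (- t)) * indicator {0<..} t \<partial>lborel)"
      unfolding Rplus_def
      by (subst nn_integral_restrict_space) (auto intro!: nn_integral_cong simp: indicator_def)
    ultimately show ?thesis by simp
  qed
  show "emeasure ?N {b<..} = emeasure ?N' {b<..}" for b
  proof -
    consider "b \<le> 0" | "0 < b" "b < 1" | "1 \<le> b" by linarith
    thus ?thesis
    proof cases
      case 1
      hence "{t. 0 < t \<and> b < exp (- t)} = {0<..}" by (auto intro: le_less_trans)
      moreover have "{0<..<1} \<inter> {b<..} = {0<..<1}" using 1 by auto
      ultimately show ?thesis unfolding ex ex' using tot by simp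
    next
      case 2
      have eq: "{t. 0 < t \<and> b < exp (- t)} = {0<..<- ln b}"
      proof -
        have "b < exp (- t) \<longleftrightarrow> t < - ln b" for t
          using 2 ln_less_cancel_iff[of b "exp (- t)"] by auto
        thus ?thesis by (simp only: set_eq_iff mem_Collect_eq greaterThanLessThan_iff simp_thms)
      qed
      have l: "0 < - ln b" using 2 by simp
      have "(\<integral>\<^sup>+t. ennreal (exp (- t)) * indicator {0<..<- ln b} t \<partial>lborel)
          = (\<integral>\<^sup>+t. ennreal (exp (- t)) * indicator {0..- ln b} t \<partial>lborel)"
      proof (rule nn_integral_cong_AE)
        have "AE t in lborel. t \<noteq> 0 \<and> t \<noteq> - ln b" using AE_lborel_singleton[of 0] AE_lborel_singleton[of "- ln b"] by auto
        thus "AE t in lborel. ennreal (exp (- t)) * indicator {0<..<- ln b} t = ennreal (exp (- t)) * indicator {0..- ln b} t"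
          by eventually_elim (auto simp: indicator_def)
      qed
      also have "\<dots> = ennreal ((- exp (- (- ln b))) - (- exp (- 0)))"
        by (rule nn_integral_FTC_Icc) (use l in \<open>auto intro!: derivative_eq_intros\<close>)
      also have "\<dots> = ennreal (1 - b)" using 2 by simp
      finally have "emeasure ?N {b<..} = ennreal (1 - b)" unfolding ex eq .
      moreover have "{0<..<1} \<inter> {b<..} = {b<..<1}" using 2 by auto
      ultimately show ?thesis unfolding ex' using 2 by simp
    next
      case 3
      have "{t. 0 < t \<and> b < exp (- t)} = {}"
      proof -
        have "\<not> b < exp (- t)" if "0 < t" for t :: real
        proof -
          have "exp (- t) < 1" using that by simp
          thus ?thesis using 3 by linarith
        qed
        thus ?thesis by blast
      qed
      moreover have "{0<..<1} \<inter> {b<..} = {}" using 3 by auto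
      ultimately show ?thesis unfolding ex ex' by simp
    qed
  qed
  show "emeasure ?N {b<..} < \<infinity>" for b
  proof -
    have "emeasure ?N {b<..} \<le> 1"
      unfolding ex tot[symmetric] by (intro nn_integral_mono) (auto simp: indicator_def)
    thus ?thesis by (rule order_le_less_trans) simp
  qed
qed auto

lemma integral_exp_substitution:
  fixes f :: "real \<Rightarrow> 'b :: {banach, second_countable_topology}"
  assumes f [measurable]: "f \<in> borel_measurable borel"
  shows "(LINT t|Rplus. exp (- t) *\<^sub>R f (exp (- t))) = (LINT r|lborel. indicator {0<..<1} r *\<^sub>R f r)"
    and "integrable Rplus (\<lambda>t. exp (- t) *\<^sub>R f (exp (- t))) \<longleftrightarrow> integrable lborel (\<lambda>r. indicator {0<..<1} r *\<^sub>R f r)"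
proof -
  have [measurable]: "(\<lambda>t::real. exp (- t)) \<in> borel_measurable Rplus"
    by (rule measurable_Rplus_borel) measurable
  let ?D = "density Rplus (\<lambda>t. ennreal (exp (- t)))"
  have m: "(\<lambda>t. exp (- t)) \<in> borel_measurable ?D" by measurable
  have fe: "(\<lambda>t. f (exp (- t))) \<in> borel_measurable Rplus" by measurable
  have "(LINT t|Rplus. exp (- t) *\<^sub>R f (exp (- t))) = integral\<^sup>L (distr ?D borel (\<lambda>t. exp (- t))) f"
    by (simp add: integral_distr[OF m f] integral_density fe)
  also have "\<dots> = (LINT r|lborel. indicator {0<..<1} r *\<^sub>R f r)"
    unfolding distr_exp_minus by (subst integral_density) auto
  finally show "(LINT t|Rplus. exp (- t) *\<^sub>R f (exp (- t))) = (LINT r|lborel. indicator {0<..<1} r *\<^sub>R f r)" .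
  have "integrable Rplus (\<lambda>t. exp (- t) *\<^sub>R f (exp (- t))) \<longleftrightarrow> integrable (distr ?D borel (\<lambda>t. exp (- t))) f"
    by (simp add: integrable_distr_eq[OF m f] integrable_density fe)
  also have "\<dots> \<longleftrightarrow> integrable lborel (\<lambda>r. indicator {0<..<1} r *\<^sub>R f r)"
    unfolding distr_exp_minus by (subst integrable_density) auto
  finally show "integrable Rplus (\<lambda>t. exp (- t) *\<^sub>R f (exp (- t))) \<longleftrightarrow> integrable lborel (\<lambda>r. indicator {0<..<1} r *\<^sub>R f r)" .
qed

section \<open>The integrand of the Hardy operator, described on the half-line\<close>

definition exp_weight :: "real \<Rightarrow> real \<Rightarrow> real" where
  "exp_weight \<alpha> t = \<alpha> * (1 - exp (- t)) powr (\<alpha> - 1)"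

text \<open>The function on the half-line whose transform is the integrand of
  \<open>hardy_cesaro_adj\<close>. The factor \<open>exp (- t)\<close> is the Jacobian of
  \<open>r = exp (- t)\<close> and also compensates the factor that the transform acquires from the
  dilation.\<close>

definition dil_path :: "real \<Rightarrow> (real \<Rightarrow> complex) \<Rightarrow> real \<Rightarrow> real \<Rightarrow> complex" where
  "dil_path \<alpha> g t v = of_real (exp_weight \<alpha> t * exp (- t)) * g (exp (- t) * v)"

lemma exp_weight_nonneg: "0 < \<alpha> \<Longrightarrow> 0 \<le> exp_weight \<alpha> t"
  by (simp add: exp_weight_def)

lemma measurable_exp_weight [measurable]: "exp_weight \<alpha> \<in> borel_measurable borel"
  unfolding exp_weight_def[abs_def] by measurable

lemma exp_weight_eq_cesaro_ker: "0 < t \<Longrightarrow> exp_weight \<alpha> t = cesaro_ker \<alpha> (exp (- t))"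
  by (simp add: exp_weight_def cesaro_ker_def)

lemma measurable_cesaro_ker [measurable]: "cesaro_ker \<alpha> \<in> borel_measurable borel"
  unfolding cesaro_ker_def[abs_def] by measurable

lemma cesaro_eq_dil_path:
  assumes g: "g \<in> borel_measurable Rplus" and v: "0 < v"
  shows "cesaro \<alpha> g v = (LINT t|Rplus. dil_path \<alpha> g t v)"
proof -
  \<comment> \<open>Extended by zero to the whole line, because
    \<open>integral_exp_substitution\<close> asks for a Borel function.\<close>
  define f where "f r = indicator {0<..} r *\<^sub>R (of_real (cesaro_ker \<alpha> r) * g (r * v))" for r
  have "(\<lambda>r. g (v * r)) \<in> borel_measurable Rplus"
    by (rule measurable_compose[OF measurable_scale_Rplus[OF v] g])
  moreover have "(\<lambda>r. complex_of_real (cesaro_ker \<alpha> r)) \<in> borel_measurable Rplus"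
    by (rule measurable_Rplus_borel) measurable
  ultimately have "(\<lambda>r. of_real (cesaro_ker \<alpha> r) * g (r * v)) \<in> borel_measurable Rplus"
    by (simp add: mult.commute[of v])
  hence f_meas: "f \<in> borel_measurable borel"
    unfolding f_def[abs_def] Rplus_def
    by (subst (asm) borel_measurable_restrict_space_iff) auto
  have "(LINT t|Rplus. dil_path \<alpha> g t v) = (LINT t|Rplus. exp (- t) *\<^sub>R f (exp (- t)))"
    by (intro Bochner_Integration.integral_cong)
       (auto simp: dil_path_def f_def exp_weight_eq_cesaro_ker scaleR_conv_of_real)
  also have "\<dots> = (LINT r|lborel. indicator {0<..<1} r *\<^sub>R f r)"
    by (rule integral_exp_substitution(1)[OF f_meas])
  also have "\<dots> = (LINT r|Rplus. of_real (cesaro_ker \<alpha> r) * g (r * v))"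
    unfolding integral_Rplus
    by (intro Bochner_Integration.integral_cong) (auto simp: f_def indicator_def cesaro_ker_def)
  finally show ?thesis using cesaro_eq_dil_avg[OF v] by (simp add: dil_avg_def)
qed

text \<open>Under \<open>r = exp (- t)\<close> this is the integrability condition of
  \<open>dil_kernel\<close> for \<open>cesaro_ker\<close>: \<open>sqrt r\<close> becomes
  \<open>exp (- t / 2)\<close>.\<close>

lemma integrable_exp_weight:
  assumes "0 < \<alpha>"
  shows "integrable Rplus (\<lambda>t. exp_weight \<alpha> t * exp (- t / 2))"
proof -
  define f where "f r = indicator {0<..} r * (cesaro_ker \<alpha> r / sqrt r)" for r
  have [measurable]: "f \<in> borel_measurable borel" unfolding f_def[abs_def] by measurable
  have "integrable lborel f"
    using dil_kernel_cesaro[OF assms] by (simp add: dil_kernel_def integrable_Rplus f_def[abs_def])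
  moreover have "(\<lambda>r. indicator {0<..<1} r *\<^sub>R f r) = f"
    by (auto simp: fun_eq_iff f_def indicator_def cesaro_ker_def)
  moreover have "f \<in> borel_measurable borel" by measurable
  ultimately have i: "integrable Rplus (\<lambda>t. exp (- t) *\<^sub>R f (exp (- t)))"
    using integral_exp_substitution(2)[of f] by simp
  have eq: "exp (- t) *\<^sub>R f (exp (- t)) = exp_weight \<alpha> t * exp (- t / 2)" if "t \<in> space Rplus" for t
  proof -
    have "sqrt (exp (- t)) = exp (- t / 2)"
      by (rule real_sqrt_unique) (auto simp: exp_double[symmetric])
    moreover have "exp (- t) = exp (- t / 2) * exp (- t / 2)" by (simp add: exp_add[symmetric])
    ultimately show ?thesis using that by (simp add: f_def exp_weight_eq_cesaro_ker)
  qed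
  show ?thesis by (rule iffD1[OF Bochner_Integration.integrable_cong[OF refl eq] i]) auto
qed

lemma sq_int_dil_path:
  assumes g: "sq_int Rplus g" and \<alpha>: "0 < \<alpha>"
  shows "sq_int Rplus (dil_path \<alpha> g t)"
    and "norm2 Rplus (dil_path \<alpha> g t) = exp_weight \<alpha> t * exp (- t / 2) * norm2 Rplus g"
proof -
  have e: "0 < exp (- t)" by simp
  show "sq_int Rplus (dil_path \<alpha> g t)"
    unfolding dil_path_def[abs_def] by (intro sq_int_scale sq_int_scale_arg g e)
  have s: "sqrt (exp (- t)) = exp (- t / 2)"
    by (rule real_sqrt_unique) (auto simp: exp_double[symmetric])
  have h: "exp (- t) = exp (- t / 2) * exp (- t / 2)" by (simp add: exp_add[symmetric])
  have "norm2 Rplus (dil_path \<alpha> g t) = exp_weight \<alpha> t * exp (- t) * (norm2 Rplus g / sqrt (exp (- t)))"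
    unfolding dil_path_def[abs_def] norm2_scale norm2_scale_arg[OF g e] norm_of_real
    using exp_weight_nonneg[OF \<alpha>, of t] by simp
  also have "\<dots> = exp_weight \<alpha> t * exp (- t / 2) * norm2 Rplus g"
    unfolding s by (subst h) simp
  finally show "norm2 Rplus (dil_path \<alpha> g t) = exp_weight \<alpha> t * exp (- t / 2) * norm2 Rplus g" .
qed

lemma measurable_dil_path:
  assumes g: "g \<in> borel_measurable Rplus" and q: "q \<in> borel_measurable Rplus"
  shows "(\<lambda>(t, v). dil_path \<alpha> g (q t) v) \<in> borel_measurable (Rplus \<Otimes>\<^sub>M Rplus)"
proof -
  have q' [measurable]: "(\<lambda>p. q (fst p)) \<in> borel_measurable (Rplus \<Otimes>\<^sub>M Rplus)"
    by (rule measurable_compose[OF measurable_fst q])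
  have s [measurable]: "snd \<in> borel_measurable (Rplus \<Otimes>\<^sub>M Rplus)"
    by (rule measurable_compose[OF measurable_snd measurable_ident_Rplus])
  have "(\<lambda>p. exp (- q (fst p)) * snd p) \<in> Rplus \<Otimes>\<^sub>M Rplus \<rightarrow>\<^sub>M Rplus"
    by (rule measurable_into_Rplus) (auto intro!: borel_measurable_times measurable_compose[OF q'] s simp: space_pair_measure)
  hence [measurable]: "(\<lambda>p. g (exp (- q (fst p)) * snd p)) \<in> borel_measurable (Rplus \<Otimes>\<^sub>M Rplus)"
    by (rule measurable_compose[OF _ g])
  show ?thesis unfolding split_def dil_path_def by measurable
qed

lemma laplace_scale_arg:
  assumes "0 < r"
  shows "laplace (\<lambda>v. g (r * v)) z = laplace g (z / of_real r) / of_real r"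
proof -
  have "laplace (\<lambda>v. g (r * v)) z = (LINT v|Rplus. g (r * v) * exp (- (z / of_real r * of_real (r * v))))"
    using assms by (simp add: laplace_def)
  also have "\<dots> = (1 / r) *\<^sub>R (LINT u|Rplus. g u * exp (- (z / of_real r * of_real u)))"
    by (rule integral_Rplus_scale[OF assms])
  finally show ?thesis by (simp add: laplace_def scaleR_conv_of_real)
qed

lemma laplace_dil_path:
  "laplace (dil_path \<alpha> g t) z = (exp_weight \<alpha> t * exp (- t / 2)) *\<^sub>R dilation (- t) (laplace g) z"
proof -
  have "laplace (dil_path \<alpha> g t) z = of_real (exp_weight \<alpha> t) * laplace g (of_real (exp t) * z)"
    unfolding dil_path_def[abs_def] laplace_scale laplace_scale_arg[OF exp_gt_zero]
    by (simp add: exp_minus divide_inverse mult.commute)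
  \<comment> \<open>The factor in the weight cancels the normalisation contained in
    \<open>dilation (- t)\<close>.\<close>
  moreover have "exp (- t / 2) * exp (t / 2) = 1" by (simp add: exp_add[symmetric])
  ultimately show ?thesis
    by (simp add: dilation_def scaleR_conv_of_real mult.assoc[symmetric] of_real_mult[symmetric] del: of_real_mult)
qed

section \<open>Hardy-space valued integrals\<close>

text \<open>The representation by transforms reduces the vector space structure of the Hardy space
  to that of the square-integrable functions.\<close>

lemma hardy_diff:
  assumes "F \<in> hardy" "G \<in> hardy"
  shows "(\<lambda>z. F z - G z) \<in> hardy"
proof -
  from assms obtain f g where fg: "sq_int Rplus f" "sq_int Rplus g"
    and "\<forall>z\<in>Cplus. F z = laplace f z" "\<forall>z\<in>Cplus. G z = laplace g z"
    unfolding hardy_iff_laplace by blast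
  hence "\<forall>z\<in>Cplus. F z - G z = laplace (\<lambda>t. f t - g t) z"
    by (simp add: Cplus_def laplace_diff)
  thus ?thesis unfolding hardy_iff_laplace using sq_int_diff[OF fg] by blast
qed

lemma hardy_eval_le:
  assumes "F \<in> hardy" "z \<in> Cplus"
  shows "cmod (F z) \<le> hardy_norm F / sqrt (2 * Re z)"
proof -
  from assms(1) obtain f where f: "sq_int Rplus f" and F: "\<And>z. z \<in> Cplus \<Longrightarrow> F z = laplace f z"
    using hardy_is_laplace by blast
  show ?thesis
    using cmod_laplace_le[OF f, of z] assms(2) hardy_laplace(2)[OF f F] F[OF assms(2)] by (simp add: Cplus_def)
qed

lemma hardy_simple_integral_eq:
  assumes "hardy_simple_integrable s"
  shows "integrable Rplus (\<lambda>t. s t z)" and "hardy_simple_integral s z = (LINT t|Rplus. s t z)"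
proof -
  have sf: "simple_function Rplus s" and supp: "emeasure Rplus {t \<in> space Rplus. s t \<noteq> (\<lambda>_. 0)} \<noteq> \<infinity>"
    using assms by (auto simp: hardy_simple_integrable_def)
  define A where "A G = {t \<in> space Rplus. s t = G}" for G
  have fin: "finite (s ` space Rplus)" using sf by (rule simple_functionD)
  have A: "A G \<in> sets Rplus" for G
    using simple_functionD(2)[OF sf, of "{G}"] by (simp add: A_def vimage_def Int_def conj_commute)
  \<comment> \<open>Only the level set of the zero function may have infinite measure, and it
    contributes nothing to the sum.\<close>
  have A_fin: "emeasure Rplus (A G) < \<infinity>" if "G \<noteq> (\<lambda>_. 0)" for G
  proof -
    have "{t \<in> space Rplus. s t \<noteq> (\<lambda>_. 0)} \<in> sets Rplus"
      using simple_functionD(2)[OF sf, of "- {\<lambda>_. 0}"] by (simp add: vimage_def Int_def conj_commute)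
    hence "emeasure Rplus (A G) \<le> emeasure Rplus {t \<in> space Rplus. s t \<noteq> (\<lambda>_. 0)}"
      using that by (intro emeasure_mono) (auto simp: A_def)
    thus ?thesis using supp by (simp add: less_top order_le_less_trans)
  qed
  have rep: "s t z = (\<Sum>G\<in>s ` space Rplus. indicator (A G) t *\<^sub>R G z)" if "t \<in> space Rplus" for t
  proof -
    have "(\<Sum>G\<in>s ` space Rplus. indicator (A G) t *\<^sub>R G z) = (\<Sum>G\<in>s ` space Rplus. if G = s t then G z else 0)"
      using that by (intro sum.cong) (auto simp: A_def)
    also have "\<dots> = s t z" using that fin by simp
    finally show ?thesis ..
  qed
  have i: "integrable Rplus (\<lambda>t. indicator (A G) t *\<^sub>R G z)" for G
  proof (cases "G = (\<lambda>_. 0)")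
    case False
    thus ?thesis using A A_fin by (intro integrable_indicator) auto
  qed simp
  have v: "(LINT t|Rplus. indicator (A G) t *\<^sub>R G z) = measure Rplus (A G) *\<^sub>R G z" for G
  proof (cases "G = (\<lambda>_. 0)")
    case False
    thus ?thesis using has_bochner_integral_indicator[OF A A_fin[OF False], of "G z"] by (simp add: has_bochner_integral_iff)
  qed simp
  show "integrable Rplus (\<lambda>t. s t z)"
    by (rule iffD2[OF Bochner_Integration.integrable_cong[OF refl rep]]) (auto intro!: i)
  have "(LINT t|Rplus. s t z) = (LINT t|Rplus. (\<Sum>G\<in>s ` space Rplus. indicator (A G) t *\<^sub>R G z))"
    by (rule Bochner_Integration.integral_cong[OF refl rep])
  also have "\<dots> = (\<Sum>G\<in>s ` space Rplus. measure Rplus (A G) *\<^sub>R G z)"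
    unfolding v[symmetric] by (rule Bochner_Integration.integral_sum) (rule i)
  finally show "hardy_simple_integral s z = (LINT t|Rplus. s t z)"
    by (simp add: hardy_simple_integral_def A_def)
qed

lemma hardy_simple_integral_hardy:
  assumes "hardy_simple_integrable s"
  shows "hardy_simple_integral s \<in> hardy"
proof -
  have sf: "simple_function Rplus s" and sh: "\<And>t. t \<in> space Rplus \<Longrightarrow> s t \<in> hardy"
    using assms by (auto simp: hardy_simple_integrable_def)
  have fin: "finite (s ` space Rplus)" using sf by (rule simple_functionD)
  have "(\<lambda>z. \<Sum>G\<in>S. measure Rplus {t \<in> space Rplus. s t = G} *\<^sub>R G z) \<in> hardy"
    if "finite S" "S \<subseteq> hardy" for S
    using that
  proof (induction S)
    case empty
    show ?case unfolding hardy_iff_laplace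
      by (intro exI[of _ "\<lambda>_. 0"]) (simp add: laplace_def)
  next
    case (insert G S)
    let ?m = "complex_of_real (measure Rplus {t \<in> space Rplus. s t = G})"
    from insert obtain f where f: "sq_int Rplus f"
      "\<forall>z\<in>Cplus. (\<Sum>G\<in>S. measure Rplus {t \<in> space Rplus. s t = G} *\<^sub>R G z) = laplace f z"
      unfolding hardy_iff_laplace by auto
    from insert obtain g where g: "sq_int Rplus g" "\<forall>z\<in>Cplus. G z = laplace g z"
      unfolding hardy_iff_laplace[symmetric] using hardy_iff_laplace[of G] by auto
    have "sq_int Rplus (\<lambda>t. ?m * g t + f t)" by (intro sq_int_add(1) sq_int_scale f g)
    moreover have "\<forall>z\<in>Cplus. (\<Sum>G\<in>insert G S. measure Rplus {t \<in> space Rplus. s t = G} *\<^sub>R G z) = laplace (\<lambda>t. ?m * g t + f t) z"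
      using insert f g by (simp add: laplace_add sq_int_scale laplace_scale Cplus_def scaleR_conv_of_real)
    ultimately show ?case unfolding hardy_iff_laplace by blast
  qed
  from this[OF fin] sh show ?thesis
    unfolding hardy_simple_integral_def[abs_def] by blast
qed

text \<open>Point evaluations are bounded on the Hardy space, so they commute with the Bochner integral.\<close>

lemma has_hardy_integral_eval:
  assumes int: "has_hardy_integral \<phi> G" and z: "z \<in> Cplus"
    and meas: "(\<lambda>t. \<phi> t z) \<in> borel_measurable Rplus"
  shows "G z = (LINT t|Rplus. \<phi> t z)"
proof -
  from int obtain s where G: "G \<in> hardy" and \<phi>: "\<And>t. t \<in> space Rplus \<Longrightarrow> \<phi> t \<in> hardy"
    and s: "\<And>n::nat. hardy_simple_integrable (s n)"
    and sm: "\<And>n. (\<lambda>t. hardy_norm (\<lambda>z. \<phi> t z - s n t z)) \<in> borel_measurable Rplus"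
    and lim1: "(\<lambda>n. \<integral>\<^sup>+t. ennreal (hardy_norm (\<lambda>z. \<phi> t z - s n t z)) \<partial>Rplus) \<longlonglongrightarrow> 0"
    and lim2: "(\<lambda>n. hardy_norm (\<lambda>z. hardy_simple_integral (s n) z - G z)) \<longlonglongrightarrow> 0"
    unfolding has_hardy_integral_def by blast
  define k where "k = 1 / sqrt (2 * Re z)"
  have k: "0 < k" using z by (simp add: k_def Cplus_def)
  have ev: "cmod (F z) \<le> k * hardy_norm F" if "F \<in> hardy" for F
    using hardy_eval_le[OF that z] by (simp add: k_def)
  have sh: "s n t \<in> hardy" if "t \<in> space Rplus" for n t
    using s[of n] that by (simp add: hardy_simple_integrable_def)
  have sint: "integrable Rplus (\<lambda>t. s n t z)" for n by (rule hardy_simple_integral_eq(1)[OF s])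
  have le: "(\<integral>\<^sup>+t. ennreal (cmod (s n t z - \<phi> t z)) \<partial>Rplus)
      \<le> ennreal k * (\<integral>\<^sup>+t. ennreal (hardy_norm (\<lambda>z. \<phi> t z - s n t z)) \<partial>Rplus)" for n
  proof -
    have "(\<integral>\<^sup>+t. ennreal (cmod (s n t z - \<phi> t z)) \<partial>Rplus)
        \<le> (\<integral>\<^sup>+t. ennreal k * ennreal (hardy_norm (\<lambda>z. \<phi> t z - s n t z)) \<partial>Rplus)"
    proof (rule nn_integral_mono)
      fix t assume t: "t \<in> space Rplus"
      have "cmod (\<phi> t z - s n t z) \<le> k * hardy_norm (\<lambda>z. \<phi> t z - s n t z)"
        by (rule ev[OF hardy_diff[OF \<phi>[OF t] sh[OF t]]])
      thus "ennreal (cmod (s n t z - \<phi> t z)) \<le> ennreal k * ennreal (hardy_norm (\<lambda>z. \<phi> t z - s n t z))"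
        using k by (subst ennreal_mult'[symmetric]) (auto simp: norm_minus_commute intro!: ennreal_leI)
    qed
    also have "\<dots> = ennreal k * (\<integral>\<^sup>+t. ennreal (hardy_norm (\<lambda>z. \<phi> t z - s n t z)) \<partial>Rplus)"
      using sm[of n] by (intro nn_integral_cmult) measurable
    finally show ?thesis .
  qed
  have "(\<lambda>n. ennreal k * (\<integral>\<^sup>+t. ennreal (hardy_norm (\<lambda>z. \<phi> t z - s n t z)) \<partial>Rplus)) \<longlonglongrightarrow> ennreal k * 0"
    by (rule ennreal_tendsto_cmult[OF _ lim1]) simp
  hence lim_k: "(\<lambda>n. ennreal k * (\<integral>\<^sup>+t. ennreal (hardy_norm (\<lambda>z. \<phi> t z - s n t z)) \<partial>Rplus)) \<longlonglongrightarrow> 0" by simp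
  have L1: "(\<lambda>n. \<integral>\<^sup>+t. ennreal (cmod (s n t z - \<phi> t z)) \<partial>Rplus) \<longlonglongrightarrow> 0"
    by (rule tendsto_sandwich[OF _ _ tendsto_const lim_k]) (use le in auto)
  have i\<phi>: "integrable Rplus (\<lambda>t. \<phi> t z)"
  proof -
    from order_tendstoD(2)[OF L1, of 1] obtain n where "(\<integral>\<^sup>+t. ennreal (cmod (s n t z - \<phi> t z)) \<partial>Rplus) < 1"
      by (auto simp: eventually_sequentially)
    hence "(\<integral>\<^sup>+t. ennreal (norm (s n t z - \<phi> t z)) \<partial>Rplus) < \<infinity>" by (rule less_trans) simp
    moreover have "(\<lambda>t. s n t z) \<in> borel_measurable Rplus" using sint by simp
    ultimately have "integrable Rplus (\<lambda>t. s n t z - \<phi> t z)"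
      using meas by (intro integrableI_bounded borel_measurable_diff)
    from Bochner_Integration.integrable_diff[OF sint[of n] this] show ?thesis by simp
  qed
  have "(\<lambda>n. LINT t|Rplus. s n t z) \<longlonglongrightarrow> (LINT t|Rplus. \<phi> t z)"
    by (rule tendsto_L1_int[OF sint i\<phi> L1])
  moreover have "(\<lambda>n. LINT t|Rplus. s n t z) \<longlonglongrightarrow> G z"
  proof (rule LIM_zero_cancel, rule Lim_null_comparison)
    show "(\<lambda>n. k * hardy_norm (\<lambda>z. hardy_simple_integral (s n) z - G z)) \<longlonglongrightarrow> 0"
      using tendsto_mult_left[OF lim2, of k] by simp
    show "\<forall>\<^sub>F n in sequentially. norm ((LINT t|Rplus. s n t z) - G z)
        \<le> k * hardy_norm (\<lambda>z. hardy_simple_integral (s n) z - G z)"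
      using ev[OF hardy_diff[OF hardy_simple_integral_hardy[OF s] G]]
      by (simp add: hardy_simple_integral_eq(2)[OF s])
  qed
  ultimately show ?thesis using LIMSEQ_unique by blast
qed


section \<open>Norm continuity of the integrand and its approximation by simple functions\<close>

lemma norm2_exp_diff_tendsto:
  assumes b: "\<And>n. 0 < b n" and c: "0 < c" and lim: "b \<longlonglongrightarrow> c"
  shows "(\<lambda>n. norm2 Rplus (\<lambda>t. exp (- (of_real (b n) * of_real t)) - exp (- (of_real c * of_real t)))) \<longlonglongrightarrow> 0"
proof -
  \<comment> \<open>The square is expanded by the Gram matrix of exponentials; the result is
    continuous in \<open>b\<close> and vanishes at \<open>b = c\<close>.\<close>
  have eq: "(norm2 Rplus (\<lambda>t. exp (- (of_real b * of_real t)) - exp (- (of_real c * of_real t))))\<^sup>2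
      = 1 / (2 * b) - 2 / (b + c) + 1 / (2 * c)" if b: "0 < b" for b :: real
  proof -
    have s: "sq_int Rplus (\<lambda>t. exp (- (of_real b * of_real t)))"
      "sq_int Rplus (\<lambda>t. (- 1) * exp (- (of_real c * of_real t)))"
      using b c by (auto intro!: sq_int_exp sq_int_scale[of _ _ "- 1", simplified])
    have "inner2 Rplus (\<lambda>t. exp (- (of_real b * of_real t))) (\<lambda>t. exp (- (of_real c * of_real t))) = of_real (1 / (b + c))"
      using b c by (subst inner2_exp) auto
    hence "Re (inner2 Rplus (\<lambda>t. exp (- (of_real b * of_real t))) (\<lambda>t. (- 1) * exp (- (of_real c * of_real t)))) = - (1 / (b + c))"
      by (simp only: inner2_scale_right) simp
    moreover have "norm2 Rplus (\<lambda>t. (- 1) * exp (- (of_real c * of_real t))) = norm2 Rplus (\<lambda>t. exp (- (of_real c * of_real t)))"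
      by (simp only: norm2_scale) simp
    ultimately have "(norm2 Rplus (\<lambda>t. exp (- (of_real b * of_real t)) + (- 1) * exp (- (of_real c * of_real t))))\<^sup>2
      = 1 / (2 * b) - 2 / (b + c) + 1 / (2 * c)"
      unfolding norm2_add_power2[OF s] using b c
      by (simp add: norm2_exp power_divide)
    thus ?thesis by simp
  qed
  have "(\<lambda>n. 1 / (2 * b n) - 2 / (b n + c) + 1 / (2 * c)) \<longlonglongrightarrow> 1 / (2 * c) - 2 / (c + c) + 1 / (2 * c)"
    using c by (intro tendsto_intros lim) auto
  hence "(\<lambda>n. sqrt (1 / (2 * b n) - 2 / (b n + c) + 1 / (2 * c))) \<longlonglongrightarrow> sqrt (1 / (2 * c) - 2 / (c + c) + 1 / (2 * c))"
    by (rule tendsto_real_sqrt)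
  moreover have "1 / (2 * c) - 2 / (c + c) + 1 / (2 * c) = 0" using c by (simp add: field_simps)
  moreover have "sqrt (1 / (2 * b n) - 2 / (b n + c) + 1 / (2 * c))
      = norm2 Rplus (\<lambda>t. exp (- (of_real (b n) * of_real t)) - exp (- (of_real c * of_real t)))" for n
    by (simp add: eq[OF b, symmetric])
  ultimately show ?thesis by simp
qed

lemma dil_expsum_tendsto:
  assumes r: "\<And>n. 0 < r n" and r0: "0 < r0" and lim: "r \<longlonglongrightarrow> r0"
  shows "xs \<in> pos_exponents \<Longrightarrow> (\<lambda>n. norm2 Rplus (\<lambda>v. expsum xs (r n * v) - expsum xs (r0 * v))) \<longlonglongrightarrow> 0"
proof (induction xs)
  case (Cons x xs)
  obtain c a where x: "x = (c, a)" by (cases x)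
  have a: "0 < a" and xs: "xs \<in> pos_exponents" using Cons.prems x by auto
  let ?E = "\<lambda>b v. exp (- (complex_of_real b * complex_of_real v))"
  have s: "sq_int Rplus (\<lambda>v. c * (?E (a * r n) v - ?E (a * r0) v))"
    "sq_int Rplus (\<lambda>v. expsum xs (r n * v) - expsum xs (r0 * v))" for n
    using a r r0 xs by (auto intro!: sq_int_scale sq_int_diff sq_int_exp sq_int_scale_arg sq_int_expsum)
  have "(\<lambda>n. cmod c * norm2 Rplus (\<lambda>v. ?E (a * r n) v - ?E (a * r0) v)
      + norm2 Rplus (\<lambda>v. expsum xs (r n * v) - expsum xs (r0 * v))) \<longlonglongrightarrow> cmod c * 0 + 0"
    using a r r0 by (intro tendsto_add tendsto_mult tendsto_const norm2_exp_diff_tendsto Cons.IH[OF xs] lim) auto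
  hence lim0: "(\<lambda>n. cmod c * norm2 Rplus (\<lambda>v. ?E (a * r n) v - ?E (a * r0) v)
      + norm2 Rplus (\<lambda>v. expsum xs (r n * v) - expsum xs (r0 * v))) \<longlonglongrightarrow> 0" by simp
  show ?case
  proof (rule Lim_null_comparison[OF _ lim0], intro always_eventually allI)
    fix n
    have "(\<lambda>v. expsum (x # xs) (r n * v) - expsum (x # xs) (r0 * v))
        = (\<lambda>v. c * (?E (a * r n) v - ?E (a * r0) v) + (expsum xs (r n * v) - expsum xs (r0 * v)))"
      by (rule ext) (simp add: x algebra_simps)
    thus "norm (norm2 Rplus (\<lambda>v. expsum (x # xs) (r n * v) - expsum (x # xs) (r0 * v)))
      \<le> cmod c * norm2 Rplus (\<lambda>v. ?E (a * r n) v - ?E (a * r0) v)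
        + norm2 Rplus (\<lambda>v. expsum xs (r n * v) - expsum xs (r0 * v))"
      using norm2_add_le[OF s[of n]] by (simp only: norm2_scale real_norm_def abs_of_nonneg[OF norm2_nonneg])
  qed
qed simp

text \<open>An argument with three thirds of \<open>e\<close>: dilations by factors of at least
  \<open>r0 / 2\<close> have norm at most \<open>K\<close>, so convergence need only be known on the
  dense set of exponential sums.\<close>

lemma dil_tendsto:
  assumes g: "sq_int Rplus g" and r: "\<And>n. 0 < r n" and r0: "0 < r0" and lim: "r \<longlonglongrightarrow> r0"
  shows "(\<lambda>n. norm2 Rplus (\<lambda>v. g (r n * v) - g (r0 * v))) \<longlonglongrightarrow> 0"
proof (rule LIMSEQ_I)
  fix e :: real assume e: "0 < e"
  define K where "K = 1 / sqrt (r0 / 2)"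
  have K: "0 < K" using r0 by (simp add: K_def)
  obtain ys where ys: "\<And>n. ys n \<in> pos_exponents"
    and ylim: "(\<lambda>n. norm2 Rplus (\<lambda>t. expsum (ys n) t - g t)) \<longlonglongrightarrow> 0"
    using expsum_dense[OF g] by blast
  have "\<forall>\<^sub>F n in sequentially. norm2 Rplus (\<lambda>t. expsum (ys n) t - g t) < e / (3 * K)"
    using order_tendstoD(2)[OF ylim, of "e / (3 * K)"] e K by simp
  then obtain m where "norm2 Rplus (\<lambda>t. expsum (ys m) t - g t) < e / (3 * K)"
    by (auto simp: eventually_sequentially)
  then obtain xs where xs: "xs \<in> pos_exponents" and d: "norm2 Rplus (\<lambda>t. expsum xs t - g t) < e / (3 * K)"
    using ys by blast
  note sx = sq_int_expsum[OF xs]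
  have small: "norm2 Rplus (\<lambda>v. expsum xs (q * v) - g (q * v)) < e / 3" if q: "r0 / 2 \<le> q" for q
  proof -
    have q0: "0 < q" using q r0 by simp
    have "1 / sqrt q \<le> K" unfolding K_def using q r0 by (intro divide_left_mono) auto
    hence "norm2 Rplus (\<lambda>t. expsum xs t - g t) * (1 / sqrt q) \<le> norm2 Rplus (\<lambda>t. expsum xs t - g t) * K"
      by (intro mult_left_mono) auto
    also have "\<dots> < e / (3 * K) * K" by (rule mult_strict_right_mono[OF d K])
    finally show ?thesis
      using norm2_scale_arg[OF sq_int_diff[OF sx g] q0] K by simp
  qed
  have "\<forall>\<^sub>F n in sequentially. norm2 Rplus (\<lambda>v. expsum xs (r n * v) - expsum xs (r0 * v)) < e / 3"
    using order_tendstoD(2)[OF dil_expsum_tendsto[OF r r0 lim xs], of "e / 3"] e by simp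
  moreover have "\<forall>\<^sub>F n in sequentially. r0 / 2 < r n"
    using order_tendstoD(1)[OF lim, of "r0 / 2"] r0 by simp
  ultimately have "\<forall>\<^sub>F n in sequentially. norm (norm2 Rplus (\<lambda>v. g (r n * v) - g (r0 * v)) - 0) < e"
  proof eventually_elim
    case (elim n)
    note gs = sq_int_scale_arg(1)[OF g r[of n]] sq_int_scale_arg(1)[OF g r0]
    note xss = sq_int_scale_arg(1)[OF sx r[of n]] sq_int_scale_arg(1)[OF sx r0]
    have "norm2 Rplus (\<lambda>v. g (r n * v) - g (r0 * v))
        \<le> norm2 Rplus (\<lambda>v. g (r n * v) - expsum xs (r n * v)) + norm2 Rplus (\<lambda>v. expsum xs (r n * v) - g (r0 * v))"
      by (rule norm2_triangle[OF gs(1) xss(1) gs(2)])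
    also have "norm2 Rplus (\<lambda>v. expsum xs (r n * v) - g (r0 * v))
        \<le> norm2 Rplus (\<lambda>v. expsum xs (r n * v) - expsum xs (r0 * v)) + norm2 Rplus (\<lambda>v. expsum xs (r0 * v) - g (r0 * v))"
      by (rule norm2_triangle[OF xss gs(2)])
    also have "norm2 Rplus (\<lambda>v. g (r n * v) - expsum xs (r n * v)) = norm2 Rplus (\<lambda>v. expsum xs (r n * v) - g (r n * v))"
      by (rule norm2_minus)
    finally show ?case using small[of "r n"] small[of r0] elim r0 by simp
  qed
  thus "\<exists>no. \<forall>n\<ge>no. norm (norm2 Rplus (\<lambda>v. g (r n * v) - g (r0 * v)) - 0) < e"
    by (simp add: eventually_sequentially)
qed

lemma dil_path_tendsto:
  assumes g: "sq_int Rplus g" and \<alpha>: "0 < \<alpha>" and t: "0 < t" and lim: "q \<longlonglongrightarrow> t"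
  shows "(\<lambda>n. norm2 Rplus (\<lambda>v. dil_path \<alpha> g (q n) v - dil_path \<alpha> g t v)) \<longlonglongrightarrow> 0"
proof -
  define c where "c t = exp_weight \<alpha> t * exp (- t)" for t
  have c_lim: "(\<lambda>n. c (q n)) \<longlonglongrightarrow> c t"
    unfolding c_def exp_weight_def using t by (intro tendsto_intros lim) auto
  have e: "0 < exp (- s)" for s :: real by simp
  let ?D = "\<lambda>n. norm2 Rplus (\<lambda>v. g (exp (- q n) * v) - g (exp (- t) * v))"
  have D_lim: "?D \<longlonglongrightarrow> 0"
    by (rule dil_tendsto[OF g e e]) (intro tendsto_intros lim)
  have "(\<lambda>n. \<bar>c (q n)\<bar> * ?D n + \<bar>c (q n) - c t\<bar> * norm2 Rplus (\<lambda>v. g (exp (- t) * v)))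
      \<longlonglongrightarrow> \<bar>c t\<bar> * 0 + \<bar>c t - c t\<bar> * norm2 Rplus (\<lambda>v. g (exp (- t) * v))"
    by (intro tendsto_intros c_lim D_lim)
  hence lim0: "(\<lambda>n. \<bar>c (q n)\<bar> * ?D n + \<bar>c (q n) - c t\<bar> * norm2 Rplus (\<lambda>v. g (exp (- t) * v))) \<longlonglongrightarrow> 0" by simp
  show ?thesis
  proof (rule Lim_null_comparison[OF _ lim0], intro always_eventually allI)
    fix n
    note gs = sq_int_scale_arg(1)[OF g e[of "q n"]] sq_int_scale_arg(1)[OF g e[of t]]
    have "(\<lambda>v. dil_path \<alpha> g (q n) v - dil_path \<alpha> g t v)
        = (\<lambda>v. of_real (c (q n)) * (g (exp (- q n) * v) - g (exp (- t) * v)) + of_real (c (q n) - c t) * g (exp (- t) * v))"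
      by (rule ext) (simp add: dil_path_def c_def algebra_simps)
    hence "norm2 Rplus (\<lambda>v. dil_path \<alpha> g (q n) v - dil_path \<alpha> g t v)
        \<le> norm2 Rplus (\<lambda>v. of_real (c (q n)) * (g (exp (- q n) * v) - g (exp (- t) * v)))
          + norm2 Rplus (\<lambda>v. of_real (c (q n) - c t) * g (exp (- t) * v))"
      using norm2_add_le[OF sq_int_scale[OF sq_int_diff[OF gs]] sq_int_scale[OF gs(2)]] by simp
    thus "norm (norm2 Rplus (\<lambda>v. dil_path \<alpha> g (q n) v - dil_path \<alpha> g t v))
        \<le> \<bar>c (q n)\<bar> * ?D n + \<bar>c (q n) - c t\<bar> * norm2 Rplus (\<lambda>v. g (exp (- t) * v))"
      by (simp only: norm2_scale norm_of_real real_norm_def abs_of_nonneg[OF norm2_nonneg])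
  qed
qed

text \<open>Rounding upwards keeps the grid point of a positive \<open>t\<close> in range at or
  beyond \<open>t\<close>, away from \<open>0\<close>, where the weight is singular for
  \<open>\<alpha> < 1\<close>. For positive \<open>t\<close> the value \<open>0\<close> occurs
  beyond the range only, and marks where the approximation is set to zero.\<close>

definition grid :: "nat \<Rightarrow> real \<Rightarrow> real" where
  "grid n t = (if t \<le> real (Suc n) then of_int \<lceil>t * real (Suc n)\<rceil> / real (Suc n) else 0)"

lemma measurable_grid: "grid n \<in> borel_measurable borel"
  unfolding grid_def[abs_def] by measurable

lemma grid_ge:
  assumes "t \<le> real (Suc n)"
  shows "t \<le> grid n t" "grid n t \<le> t + 1 / real (Suc n)"
proof -
  have p: "0 < real (Suc n)" by simp
  have "t * real (Suc n) \<le> of_int \<lceil>t * real (Suc n)\<rceil>" by (rule le_of_int_ceiling)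
  thus "t \<le> grid n t" using assms p by (simp only: grid_def if_True pos_le_divide_eq)
  have "of_int \<lceil>t * real (Suc n)\<rceil> \<le> t * real (Suc n) + 1" by (rule of_int_ceiling_le_add_one)
  hence "of_int \<lceil>t * real (Suc n)\<rceil> / real (Suc n) \<le> (t * real (Suc n) + 1) / real (Suc n)"
    by (rule divide_right_mono) simp
  also have "\<dots> = t + 1 / real (Suc n)" using p by (simp only: add_divide_distrib) simp
  finally show "grid n t \<le> t + 1 / real (Suc n)" using assms by (simp only: grid_def if_True)
qed

lemma grid_tendsto: "(\<lambda>n. grid n t) \<longlonglongrightarrow> t"
proof (rule tendsto_sandwich)
  have ev: "\<forall>\<^sub>F n in sequentially. t \<le> real (Suc n)"
    using eventually_ge_at_top[of "nat \<lceil>t\<rceil>"] by eventually_elim linarith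
  show "\<forall>\<^sub>F n in sequentially. t \<le> grid n t" using ev by eventually_elim (rule grid_ge)
  show "\<forall>\<^sub>F n in sequentially. grid n t \<le> t + 1 / real (Suc n)" using ev by eventually_elim (rule grid_ge)
  show "(\<lambda>n. t + 1 / real (Suc n)) \<longlonglongrightarrow> t"
    using tendsto_add[OF tendsto_const LIMSEQ_inverse_real_of_nat, of t] by (simp add: inverse_eq_divide)
qed simp

lemma simple_function_grid: "simple_function Rplus (grid n)"
proof (rule simple_function_borel_measurable)
  show "grid n \<in> borel_measurable Rplus" by (rule measurable_Rplus_borel[OF measurable_grid])
  have "grid n ` space Rplus \<subseteq> (\<lambda>k::int. of_int k / real (Suc n)) ` {0..int (Suc n * Suc n)}"
  proof
    fix y assume "y \<in> grid n ` space Rplus"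
    then obtain t where t: "0 < t" and y: "y = grid n t" by auto
    show "y \<in> (\<lambda>k::int. of_int k / real (Suc n)) ` {0..int (Suc n * Suc n)}"
    proof (cases "t \<le> real (Suc n)")
      case True
      have "t * real (Suc n) \<le> real (Suc n) * real (Suc n)" using True by (intro mult_right_mono) auto
      also have "\<dots> = of_int (int (Suc n * Suc n))" by (simp only: of_int_mult of_int_of_nat_eq of_nat_mult)
      finally have "\<lceil>t * real (Suc n)\<rceil> \<le> int (Suc n * Suc n)" by (simp only: ceiling_le_iff)
      moreover have "0 \<le> \<lceil>t * real (Suc n)\<rceil>"
      proof -
        have "0 < t * real (Suc n)" using t by simp
        thus ?thesis by linarith
      qed
      ultimately have "\<lceil>t * real (Suc n)\<rceil> \<in> {0..int (Suc n * Suc n)}" by simp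
      moreover have "y = of_int \<lceil>t * real (Suc n)\<rceil> / real (Suc n)" using True y by (simp only: grid_def if_True)
      ultimately show ?thesis by blast
    next
      case False
      hence "y = of_int 0 / real (Suc n)" using y by (simp add: grid_def)
      thus ?thesis by force
    qed
  qed
  thus "finite (grid n ` space Rplus)" by (rule finite_subset) simp
qed

text \<open>For \<open>\<alpha> \<ge> 1\<close> the weight is at most \<open>\<alpha>\<close>, and
  for \<open>\<alpha> < 1\<close> it decreases. The sum of both bounds depends on \<open>t\<close>
  alone and dominates the grid values for all \<open>n\<close>.\<close>

lemma exp_weight_dominated:
  assumes \<alpha>: "0 < \<alpha>" and t: "0 < t" "t \<le> q"
  shows "exp_weight \<alpha> q * exp (- q / 2) \<le> exp_weight \<alpha> t * exp (- t / 2) + \<alpha> * exp (- t / 2)"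
proof (cases "1 \<le> \<alpha>")
  case True
  have "(1 - exp (- q)) powr (\<alpha> - 1) \<le> 1" using True t by (intro powr_le1) auto
  hence "exp_weight \<alpha> q \<le> \<alpha> * 1" unfolding exp_weight_def using \<alpha> by (intro mult_left_mono) auto
  hence "exp_weight \<alpha> q * exp (- q / 2) \<le> \<alpha> * exp (- t / 2)"
    using t \<alpha> by (intro mult_mono) auto
  moreover have "0 \<le> exp_weight \<alpha> t * exp (- t / 2)" using exp_weight_nonneg[OF \<alpha>] by simp
  ultimately show ?thesis by linarith
next
  case False
  have "(1 - exp (- q)) powr (\<alpha> - 1) \<le> (1 - exp (- t)) powr (\<alpha> - 1)"
    using False t by (intro powr_mono2') auto
  hence "exp_weight \<alpha> q \<le> exp_weight \<alpha> t" unfolding exp_weight_def using \<alpha> by (intro mult_left_mono) auto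
  hence "exp_weight \<alpha> q * exp (- q / 2) \<le> exp_weight \<alpha> t * exp (- t / 2)"
    using t exp_weight_nonneg[OF \<alpha>] by (intro mult_mono) auto
  moreover have "0 \<le> \<alpha> * exp (- t / 2)" using \<alpha> by simp
  ultimately show ?thesis by linarith
qed

text \<open>
  The integrand is norm continuous in \<open>t\<close> and is approximated by its values on the grid.
\<close>

lemma has_hardy_integral_dilation:
  assumes g: "sq_int Rplus g" and \<alpha>: "0 < \<alpha>" and F: "\<And>z. z \<in> Cplus \<Longrightarrow> F z = laplace g z"
  defines "\<phi> \<equiv> \<lambda>t z. (\<alpha> * (1 - exp (- t)) powr (\<alpha> - 1) * exp (- t / 2)) *\<^sub>R dilation (- t) F z"
  shows "has_hardy_integral \<phi> (laplace (cesaro \<alpha> g))"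
    and "\<And>z. z \<in> Cplus \<Longrightarrow> (\<lambda>t. \<phi> t z) \<in> borel_measurable Rplus"
    and "\<And>z. z \<in> Cplus \<Longrightarrow> (LINT t|Rplus. \<phi> t z) = laplace (cesaro \<alpha> g) z"
proof -
  have g_meas: "g \<in> borel_measurable Rplus" using g by (simp add: sq_int_def)
  let ?w = "dil_path \<alpha> g"
  have w: "sq_int Rplus (?w t)" for t by (rule sq_int_dil_path[OF g \<alpha>])
  have w_meas: "(\<lambda>(t, v). ?w t v) \<in> borel_measurable (Rplus \<Otimes>\<^sub>M Rplus)"
    by (rule measurable_dil_path[OF g_meas measurable_ident_Rplus])
  have w_int: "integrable Rplus (\<lambda>t. norm2 Rplus (?w t))"
    unfolding sq_int_dil_path(2)[OF g \<alpha>] by (intro integrable_mult_left integrable_exp_weight \<alpha>)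
  have \<phi>_w: "\<phi> t z = laplace (?w t) z" if z: "z \<in> Cplus" for t z
  proof -
    have "complex_of_real (exp t) * z \<in> Cplus" using z by (simp add: Cplus_def)
    thus ?thesis
      unfolding \<phi>_def laplace_dil_path exp_weight_def by (simp add: dilation_def F)
  qed
  have \<phi>_hardy: "\<phi> t \<in> hardy" for t by (rule hardy_laplace(1)[OF w \<phi>_w])
  have cesaro_w: "AE v in Rplus. (LINT t|Rplus. ?w t v) = cesaro \<alpha> g v"
    by (rule AE_I2) (simp add: cesaro_eq_dil_path[OF g_meas])
  have sqV: "sq_int Rplus (\<lambda>v. LINT t|Rplus. ?w t v)"
    by (rule Minkowski_integral(1)[OF pair_sigma_finite_Rplus w_meas w w_int])
  have lap_int: "integrable Rplus (\<lambda>t. \<phi> t z)" and lap_eq: "(LINT t|Rplus. \<phi> t z) = laplace (cesaro \<alpha> g) z"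
    if z: "z \<in> Cplus" for z
  proof -
    have e: "sq_int Rplus (\<lambda>t. exp (- (cnj z * of_real t)))"
      using z by (intro sq_int_exp) (simp add: Cplus_def)
    note r = inner2_integral_left[OF pair_sigma_finite_Rplus w_meas w w_int e, folded laplace_eq_inner2]
    show "integrable Rplus (\<lambda>t. \<phi> t z)" using r(1) by (simp add: \<phi>_w[OF z])
    have "laplace (cesaro \<alpha> g) z = laplace (\<lambda>v. LINT t|Rplus. ?w t v) z"
      by (rule laplace_cong_AE[OF sqV measurable_cesaro(1)[OF g \<alpha>] cesaro_w, symmetric])
    also have "\<dots> = (LINT t|Rplus. laplace (?w t) z)" by (rule r(2))
    finally show "(LINT t|Rplus. \<phi> t z) = laplace (cesaro \<alpha> g) z" by (simp add: \<phi>_w[OF z])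
  qed
  from lap_int show "(\<lambda>t. \<phi> t z) \<in> borel_measurable Rplus" if "z \<in> Cplus" for z using that by simp
  from lap_eq show "(LINT t|Rplus. \<phi> t z) = laplace (cesaro \<alpha> g) z" if "z \<in> Cplus" for z using that by simp
  \<comment> \<open>Beyond the range of the grid the value is the zero function, which gives the
    support finite measure.\<close>
  define s where "s n t = (if grid n t = 0 then (\<lambda>_. 0) else \<phi> (grid n t))" for n t
  \<comment> \<open>Represents the approximation error on the half-line, so that its Hardy norm
    becomes an integral and is measurable in \<open>t\<close>.\<close>
  define W where "W n t v = ?w t v - (if grid n t = 0 then 0 else ?w (grid n t) v)" for n t v
  have W: "sq_int Rplus (W n t)" for n t
    unfolding W_def[abs_def] using w by (cases "grid n t = 0") (auto intro!: sq_int_diff)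
  have W_lap: "\<phi> t z - s n t z = laplace (W n t) z" if z: "z \<in> Cplus" for n t z
    using z \<phi>_w[OF z] laplace_diff[OF w w, of z t "grid n t"]
    by (cases "grid n t = 0") (simp_all add: s_def W_def[abs_def] Cplus_def)
  have norm_W: "hardy_norm (\<lambda>z. \<phi> t z - s n t z) = norm2 Rplus (W n t)" for n t
    by (rule hardy_laplace(2)[OF W W_lap])
  have W_meas: "(\<lambda>(t, v). W n t v) \<in> borel_measurable (Rplus \<Otimes>\<^sub>M Rplus)" for n
  proof -
    have gr: "grid n \<in> borel_measurable Rplus" by (rule measurable_Rplus_borel[OF measurable_grid])
    have [measurable]: "(\<lambda>p. ?w (fst p) (snd p)) \<in> borel_measurable (Rplus \<Otimes>\<^sub>M Rplus)"
      "(\<lambda>p. ?w (grid n (fst p)) (snd p)) \<in> borel_measurable (Rplus \<Otimes>\<^sub>M Rplus)"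
      using w_meas measurable_dil_path[OF g_meas gr, of \<alpha>] by (simp_all add: split_def)
    have [measurable]: "(\<lambda>p. grid n (fst p)) \<in> borel_measurable (Rplus \<Otimes>\<^sub>M Rplus)"
      by (rule measurable_compose[OF measurable_fst gr])
    show ?thesis unfolding W_def split_def by measurable
  qed
  have nW_meas: "(\<lambda>t. norm2 Rplus (W n t)) \<in> borel_measurable Rplus" for n
  proof -
    have "(\<lambda>(t, v). (cmod (W n t v))\<^sup>2) \<in> borel_measurable (Rplus \<Otimes>\<^sub>M Rplus)"
      using W_meas[of n] unfolding split_def by measurable
    from Rplus.borel_measurable_lebesgue_integral[OF this] show ?thesis
      unfolding norm2_def by measurable
  qed
  \<comment> \<open>The norm at \<open>t\<close> plus the bound of
    \<open>exp_weight_dominated\<close> for the norm at the grid point.\<close>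
  define u where "u t = (2 * (exp_weight \<alpha> t * exp (- t / 2)) + \<alpha> * exp (- t / 2)) * norm2 Rplus g" for t
  have u_int: "integrable Rplus u"
  proof -
    have "integrable Rplus (\<lambda>t. Re (exp (- (of_real (1/2) * of_real t))))"
      by (intro integrable_Re integral_exp_Rplus) simp
    moreover have "Re (exp (- (of_real (1/2) * of_real t))) = exp (- t / 2)" for t :: real
    proof -
      have "- (of_real (1/2) * of_real t) = complex_of_real (- t / 2)" by simp
      thus ?thesis by (simp only: exp_of_real Re_complex_of_real)
    qed
    ultimately show ?thesis
      unfolding u_def using integrable_exp_weight[OF \<alpha>]
      by (intro integrable_mult_left Bochner_Integration.integrable_add integrable_mult_right) auto
  qed
  have W_le: "norm2 Rplus (W n t) \<le> u t" if t: "0 < t" for n t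
  proof (cases "grid n t = 0")
    case True
    have "norm2 Rplus (W n t) = exp_weight \<alpha> t * exp (- t / 2) * norm2 Rplus g"
      using True by (simp add: W_def[abs_def] sq_int_dil_path(2)[OF g \<alpha>])
    also have "\<dots> \<le> u t" unfolding u_def
      using exp_weight_nonneg[OF \<alpha>, of t] \<alpha> by (intro mult_right_mono) auto
    finally show ?thesis .
  next
    case False
    hence "t \<le> real (Suc n)" by (auto simp: grid_def split: if_splits)
    hence ge: "t \<le> grid n t" by (rule grid_ge)
    have "norm2 Rplus (W n t) \<le> norm2 Rplus (?w t) + norm2 Rplus (?w (grid n t))"
      using False norm2_diff_le[OF w w] by (simp add: W_def[abs_def])
    also have "\<dots> = (exp_weight \<alpha> t * exp (- t / 2) + exp_weight \<alpha> (grid n t) * exp (- grid n t / 2)) * norm2 Rplus g"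
      unfolding sq_int_dil_path(2)[OF g \<alpha>] by (simp only: distrib_right)
    also have "\<dots> \<le> u t" unfolding u_def
      using exp_weight_dominated[OF \<alpha> t ge] by (intro mult_right_mono) auto
    finally show ?thesis .
  qed
  have nW_int: "integrable Rplus (\<lambda>t. norm2 Rplus (W n t))" for n
    by (rule Bochner_Integration.integrable_bound[OF u_int nW_meas])
       (use W_le in \<open>auto intro!: AE_I2 intro: order_trans[OF _ abs_ge_self]\<close>)
  have W_lim: "(\<lambda>n. norm2 Rplus (W n t)) \<longlonglongrightarrow> 0" if t: "0 < t" for t
  proof -
    have "\<forall>\<^sub>F n in sequentially. 0 < grid n t" using order_tendstoD(1)[OF grid_tendsto t] .
    hence "\<forall>\<^sub>F n in sequentially. norm2 Rplus (\<lambda>v. ?w (grid n t) v - ?w t v) = norm2 Rplus (W n t)"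
      by eventually_elim (simp add: W_def[abs_def] norm2_minus)
    from Lim_transform_eventually[OF dil_path_tendsto[OF g \<alpha> t grid_tendsto] this] show ?thesis .
  qed
  have int_lim: "(\<lambda>n. LINT t|Rplus. norm2 Rplus (W n t)) \<longlonglongrightarrow> 0"
  proof -
    have "(\<lambda>n. LINT t|Rplus. norm2 Rplus (W n t)) \<longlonglongrightarrow> (LINT t|Rplus. (0::real))"
      by (rule integral_dominated_convergence[where w = u])
         (use u_int nW_meas W_lim W_le in \<open>auto intro!: AE_I2\<close>)
    thus ?thesis by simp
  qed
  have simp_s: "hardy_simple_integrable (s n)" for n
    unfolding hardy_simple_integrable_def
  proof (intro conjI ballI)
    show "simple_function Rplus (s n)"
      unfolding s_def[abs_def]
      by (rule simple_function_compose1[OF simple_function_grid, of "\<lambda>q. if q = 0 then (\<lambda>_. 0) else \<phi> q"])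
    \<comment> \<open>The zero function belongs to the Hardy space as the difference of
      \<open>\<phi> 0\<close> with itself.\<close>
    show "s n t \<in> hardy" for t
      using \<phi>_hardy hardy_diff[OF \<phi>_hardy \<phi>_hardy, of 0 0] by (simp add: s_def)
    have "{t \<in> space Rplus. s n t \<noteq> (\<lambda>_. 0)} \<subseteq> {0<..real (Suc n)}"
      by (auto simp: s_def grid_def split: if_splits)
    moreover have "{0<..real (Suc n)} \<in> sets Rplus"
      by (auto simp: sets_Rplus sets_restrict_space_iff)
    ultimately have "emeasure Rplus {t \<in> space Rplus. s n t \<noteq> (\<lambda>_. 0)} \<le> emeasure Rplus {0<..real (Suc n)}"
      by (intro emeasure_mono)
    also have "\<dots> = ennreal (real (Suc n))"
      unfolding Rplus_def by (subst emeasure_restrict_space) auto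
    finally show "emeasure Rplus {t \<in> space Rplus. s n t \<noteq> (\<lambda>_. 0)} \<noteq> \<infinity>"
      by (auto simp: top_unique)
  qed
  \<comment> \<open>The error of the integrals is the transform of \<open>- D\<close>, so its Hardy
    norm is the norm of the integral \<open>D\<close>, to which Minkowski's inequality
    applies.\<close>
  have last: "hardy_norm (\<lambda>z. hardy_simple_integral (s n) z - laplace (cesaro \<alpha> g) z) \<le> (LINT t|Rplus. norm2 Rplus (W n t))" for n
  proof -
    define D where "D v = (LINT t|Rplus. W n t v)" for v
    note mink = Minkowski_integral[OF pair_sigma_finite_Rplus W_meas W nW_int, of n, folded D_def[abs_def]]
    have "hardy_simple_integral (s n) z - laplace (cesaro \<alpha> g) z = laplace (\<lambda>v. (- 1) * D v) z" if z: "z \<in> Cplus" for z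
    proof -
      have e: "sq_int Rplus (\<lambda>t. exp (- (cnj z * of_real t)))"
        using z by (intro sq_int_exp) (simp add: Cplus_def)
      have "laplace D z = (LINT t|Rplus. laplace (W n t) z)"
        using inner2_integral_left(2)[OF pair_sigma_finite_Rplus W_meas W nW_int e, of n]
        by (simp only: laplace_eq_inner2 D_def[abs_def])
      also have "\<dots> = (LINT t|Rplus. \<phi> t z - s n t z)" by (simp only: W_lap[OF z])
      also have "\<dots> = laplace (cesaro \<alpha> g) z - hardy_simple_integral (s n) z"
        by (simp only: Bochner_Integration.integral_diff[OF lap_int[OF z] hardy_simple_integral_eq(1)[OF simp_s]]
            lap_eq[OF z] hardy_simple_integral_eq(2)[OF simp_s])
      finally show ?thesis by (simp only: laplace_scale) simp
    qed
    from hardy_laplace(2)[OF sq_int_scale[OF mink(1), of "- 1"] this]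
    show ?thesis using mink(2) by (simp only: norm2_scale) simp
  qed
  have hn_nonneg: "0 \<le> hardy_norm (\<lambda>z. hardy_simple_integral (s n) z - laplace (cesaro \<alpha> g) z)" for n
  proof -
    have "laplace (cesaro \<alpha> g) \<in> hardy" by (rule hardy_laplace(1)[OF sq_int_cesaro(1)[OF g \<alpha>]]) simp
    from hardy_diff[OF hardy_simple_integral_hardy[OF simp_s[of n]] this]
    obtain f where "sq_int Rplus f"
      "\<And>z. z \<in> Cplus \<Longrightarrow> hardy_simple_integral (s n) z - laplace (cesaro \<alpha> g) z = laplace f z"
      using hardy_is_laplace by blast
    from hardy_laplace(2)[OF this] show ?thesis by simp
  qed
  show "has_hardy_integral \<phi> (laplace (cesaro \<alpha> g))"
    unfolding has_hardy_integral_def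
  proof (intro conjI ballI exI[of _ s] allI)
    show "laplace (cesaro \<alpha> g) \<in> hardy" by (rule hardy_laplace(1)[OF sq_int_cesaro(1)[OF g \<alpha>]]) simp
    show "\<phi> t \<in> hardy" for t by (rule \<phi>_hardy)
    show "hardy_simple_integrable (s n)" for n by (rule simp_s)
    show "(\<lambda>t. hardy_norm (\<lambda>z. \<phi> t z - s n t z)) \<in> borel_measurable Rplus" for n
      unfolding norm_W by (rule nW_meas)
    have "(\<integral>\<^sup>+t. ennreal (norm2 Rplus (W n t)) \<partial>Rplus) = ennreal (LINT t|Rplus. norm2 Rplus (W n t))" for n
      by (rule nn_integral_eq_integral[OF nW_int]) simp
    thus "(\<lambda>n. \<integral>\<^sup>+t. ennreal (hardy_norm (\<lambda>z. \<phi> t z - s n t z)) \<partial>Rplus) \<longlonglongrightarrow> 0"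
      unfolding norm_W using tendsto_ennrealI[OF int_lim] by simp
    show "(\<lambda>n. hardy_norm (\<lambda>z. hardy_simple_integral (s n) z - laplace (cesaro \<alpha> g) z)) \<longlonglongrightarrow> 0"
      by (rule tendsto_sandwich[OF _ _ tendsto_const int_lim]) (use last hn_nonneg in auto)
  qed
qed

text \<open>A Hardy-valued integral is determined on \<open>Cplus\<close> by point evaluations, so
  whichever one is chosen takes these values there.\<close>

lemma hardy_cesaro_adj_laplace:
  assumes g: "sq_int Rplus g" and \<alpha>: "0 < \<alpha>" and F: "\<And>z. z \<in> Cplus \<Longrightarrow> F z = laplace g z" and z: "z \<in> Cplus"
  shows "hardy_cesaro_adj \<alpha> F z = laplace (cesaro \<alpha> g) z"
proof -
  let ?\<phi> = "\<lambda>t z. (\<alpha> * (1 - exp (- t)) powr (\<alpha> - 1) * exp (- t / 2)) *\<^sub>R dilation (- t) F z"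
  have "has_hardy_integral ?\<phi> (laplace (cesaro \<alpha> g))"
    by (rule has_hardy_integral_dilation(1)[OF g \<alpha>]) (rule F)
  hence "has_hardy_integral ?\<phi> (hardy_cesaro_adj \<alpha> F)"
    unfolding hardy_cesaro_adj_def hardy_integral_def by (rule someI[where P = "has_hardy_integral ?\<phi>"])
  moreover have "(\<lambda>t. ?\<phi> t z) \<in> borel_measurable Rplus"
    by (rule has_hardy_integral_dilation(2)[OF g \<alpha>]) (rule F, assumption, rule z)
  ultimately have "hardy_cesaro_adj \<alpha> F z = (LINT t|Rplus. ?\<phi> t z)"
    by (rule has_hardy_integral_eval[OF _ z])
  also have "\<dots> = laplace (cesaro \<alpha> g) z"
    by (rule has_hardy_integral_dilation(3)[OF g \<alpha>]) (rule F, assumption, rule z)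
  finally show ?thesis .
qed


section \<open>Coincidence of the spaces\<close>

lemma laplace_eq_imp_AE:
  assumes f: "sq_int Rplus f" and g: "sq_int Rplus g" and eq: "\<And>z. z \<in> Cplus \<Longrightarrow> laplace f z = laplace g z"
  shows "AE t in Rplus. f t = g t"
proof -
  have "AE t in Rplus. f t - g t = 0"
  proof (rule laplace_inj)
    show "sq_int Rplus (\<lambda>t. f t - g t)" by (rule sq_int_diff[OF f g])
    show "laplace (\<lambda>t. f t - g t) (of_real a) = 0" if "0 < a" for a
      using that by (simp add: laplace_diff[OF f g] eq Cplus_def)
  qed
  thus ?thesis by eventually_elim simp
qed

lemma laplace_cesaro_eq_imp_AE:
  assumes "sq_int Rplus f" "sq_int Rplus g" "0 < \<alpha>"
    and "\<And>z. z \<in> Cplus \<Longrightarrow> laplace (cesaro \<alpha> f) z = laplace (cesaro \<alpha> g) z"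
  shows "AE t in Rplus. f t = g t"
proof -
  have "AE t in Rplus. cesaro \<alpha> f t = cesaro \<alpha> g t"
    by (rule laplace_eq_imp_AE) (use assms sq_int_cesaro in auto)
  thus ?thesis using AE_diff_of_cesaro_eq[OF assms(1-3)] by blast
qed

lemma laplace_cesaro_linear:
  assumes f: "sq_int Rplus f" and g: "sq_int Rplus g" and \<alpha>: "0 < \<alpha>" and z: "z \<in> Cplus"
  shows "laplace (cesaro \<alpha> (\<lambda>t. f t + c * g t)) z = laplace (cesaro \<alpha> f) z + c * laplace (cesaro \<alpha> g) z"
proof -
  note C = sq_int_cesaro(1)[OF f \<alpha>] sq_int_cesaro(1)[OF g \<alpha>]
  have s: "sq_int Rplus (\<lambda>t. f t + c * g t)" by (intro sq_int_add sq_int_scale f g)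
  have "(\<lambda>t. cesaro \<alpha> f t + c * cesaro \<alpha> g t) \<in> borel_measurable Rplus"
    using sq_int_add(1)[OF C(1) sq_int_scale[OF C(2)]] by (simp add: sq_int_def)
  hence "laplace (cesaro \<alpha> (\<lambda>t. f t + c * g t)) z = laplace (\<lambda>t. cesaro \<alpha> f t + c * cesaro \<alpha> g t) z"
    by (rule laplace_cong_AE[OF sq_int_cesaro(1)[OF s \<alpha>] _ cesaro_linear(1)[OF f g \<alpha>]])
  thus ?thesis using z by (simp add: laplace_add[OF C(1) sq_int_scale[OF C(2)]] laplace_scale Cplus_def)
qed

lemma L2_range_iff: "h \<in> L2_range A \<longleftrightarrow> sq_int Rplus h \<and> (\<exists>f. sq_int Rplus f \<and> (AE s in Rplus. h s = A f s))"
  by (auto simp: L2_range_def L2_eq)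

lemma L2_inv_range:
  assumes "h \<in> L2_range A"
  shows "sq_int Rplus (L2_inv A h)" "AE s in Rplus. h s = A (L2_inv A h) s"
proof -
  have "\<exists>f. f \<in> L2 \<and> (AE s in Rplus. h s = A f s)" using assms by (auto simp: L2_range_def)
  hence "L2_inv A h \<in> L2 \<and> (AE s in Rplus. h s = A (L2_inv A h) s)"
    unfolding L2_inv_def by (rule someI_ex)
  thus "sq_int Rplus (L2_inv A h)" "AE s in Rplus. h s = A (L2_inv A h) s" by (auto simp: L2_eq)
qed

lemma cesaro_in_T_lower: "sq_int Rplus f \<Longrightarrow> 0 < \<alpha> \<Longrightarrow> cesaro \<alpha> f \<in> T_lower \<alpha>"
  unfolding T_lower_def L2_range_iff using sq_int_cesaro(1) by auto

lemma T_upper_eq_T_lower: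
  assumes \<alpha>: "0 < \<alpha>"
  shows "T_upper \<alpha> = T_lower \<alpha>"
proof -
  have "h \<in> T_upper \<alpha> \<longleftrightarrow> h \<in> T_lower \<alpha>" for h
  proof
    assume "h \<in> T_upper \<alpha>"
    then obtain f where h: "sq_int Rplus h" and f: "sq_int Rplus f" and hf: "AE s in Rplus. h s = cesaro_adj \<alpha> f s"
      unfolding T_upper_def L2_range_iff by blast
    obtain g where g: "sq_int Rplus g" and gf: "AE s in Rplus. cesaro \<alpha> g s = cesaro_adj \<alpha> f s"
      using cesaro_range(1)[OF f \<alpha>] by blast
    have "AE s in Rplus. h s = cesaro \<alpha> g s" using hf gf by eventually_elim simp
    with h g show "h \<in> T_lower \<alpha>" unfolding T_lower_def L2_range_iff by blast
  next
    assume "h \<in> T_lower \<alpha>"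
    then obtain f where h: "sq_int Rplus h" and f: "sq_int Rplus f" and hf: "AE s in Rplus. h s = cesaro \<alpha> f s"
      unfolding T_lower_def L2_range_iff by blast
    obtain g where g: "sq_int Rplus g" and gf: "AE s in Rplus. cesaro_adj \<alpha> g s = cesaro \<alpha> f s"
      using cesaro_range(2)[OF f \<alpha>] by blast
    have "AE s in Rplus. h s = cesaro_adj \<alpha> g s" using hf gf by eventually_elim simp
    with h g show "h \<in> T_upper \<alpha>" unfolding T_upper_def L2_range_iff by blast
  qed
  thus ?thesis by blast
qed

lemma T_upper_norm_eq:
  assumes \<alpha>: "0 < \<alpha>"
  shows "T_upper_norm \<alpha> h = Gamma (\<alpha> + 1) * norm2 Rplus (L2_inv (cesaro_adj \<alpha>) h)"
proof -
  let ?q = "L2_inv (cesaro_adj \<alpha>) h"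
  have "(t powr \<alpha>) *\<^sub>R weyl \<alpha> h t = of_real (Gamma (\<alpha> + 1)) * ?q t" if "t \<in> space Rplus" for t
  proof -
    have "t powr \<alpha> * t powr (- \<alpha>) = 1" using that by (simp add: powr_add[symmetric])
    thus ?thesis by (simp add: weyl_def scaleR_conv_of_real mult.left_commute of_real_mult[symmetric] mult.assoc[symmetric] del: of_real_mult)
  qed
  hence "norm2 Rplus (\<lambda>t. (t powr \<alpha>) *\<^sub>R weyl \<alpha> h t) = norm2 Rplus (\<lambda>t. of_real (Gamma (\<alpha> + 1)) * ?q t)"
    unfolding norm2_def by (intro arg_cong[where f = sqrt] Bochner_Integration.integral_cong) auto
  also have "\<dots> = Gamma (\<alpha> + 1) * norm2 Rplus ?q"
    unfolding norm2_scale using Gamma_real_pos[of "\<alpha> + 1"] \<alpha> by simp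
  finally show ?thesis by (simp add: T_upper_norm_def L2_norm_eq)
qed

text \<open>Each preimage under one operator gives, by \<open>cesaro_range\<close>, a preimage of no
  larger norm under the other. Preimages are unique almost everywhere, so both inequalities hold for
  the chosen ones.\<close>

lemma T_norms_eq:
  assumes \<alpha>: "0 < \<alpha>" and h: "h \<in> T_lower \<alpha>"
  shows "T_upper_norm \<alpha> h = T_lower_norm \<alpha> h"
proof -
  let ?p = "L2_inv (cesaro \<alpha>) h" and ?q = "L2_inv (cesaro_adj \<alpha>) h"
  have p: "sq_int Rplus ?p" "AE s in Rplus. h s = cesaro \<alpha> ?p s"
    using L2_inv_range h by (auto simp: T_lower_def)
  have q: "sq_int Rplus ?q" "AE s in Rplus. h s = cesaro_adj \<alpha> ?q s"
    using L2_inv_range h T_upper_eq_T_lower[OF \<alpha>] by (auto simp: T_upper_def)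
  have "norm2 Rplus ?p \<le> norm2 Rplus ?q"
  proof -
    obtain g where g: "sq_int Rplus g" "norm2 Rplus g \<le> norm2 Rplus ?q" "AE s in Rplus. cesaro \<alpha> g s = cesaro_adj \<alpha> ?q s"
      using cesaro_range(1)[OF q(1) \<alpha>] by blast
    have "AE s in Rplus. cesaro \<alpha> ?p s = cesaro \<alpha> g s" using p(2) q(2) g(3) by eventually_elim simp
    hence "AE s in Rplus. ?p s = g s" using AE_diff_of_cesaro_eq[OF p(1) g(1) \<alpha>] by blast
    hence "norm2 Rplus ?p = norm2 Rplus g" using p(1) g(1) by (intro norm2_cong_AE) (auto simp: sq_int_def)
    thus ?thesis using g(2) by simp
  qed
  moreover have "norm2 Rplus ?q \<le> norm2 Rplus ?p"
  proof -
    obtain g where g: "sq_int Rplus g" "norm2 Rplus g \<le> norm2 Rplus ?p" "AE s in Rplus. cesaro_adj \<alpha> g s = cesaro \<alpha> ?p s"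
      using cesaro_range(2)[OF p(1) \<alpha>] by blast
    have "AE s in Rplus. cesaro_adj \<alpha> ?q s = cesaro_adj \<alpha> g s" using p(2) q(2) g(3) by eventually_elim simp
    hence "AE s in Rplus. ?q s = g s" using AE_diff_of_cesaro_eq[OF q(1) g(1) \<alpha>] by blast
    hence "norm2 Rplus ?q = norm2 Rplus g" using q(1) g(1) by (intro norm2_cong_AE) (auto simp: sq_int_def)
    thus ?thesis using g(2) by simp
  qed
  ultimately show ?thesis by (simp add: T_upper_norm_eq[OF \<alpha>] T_lower_norm_def L2_norm_eq)
qed

section \<open>Both half-plane spaces as transforms of Cesaro images, with their inner
  products\<close>

lemma H_lower_iff:
  assumes \<alpha>: "0 < \<alpha>"
  shows "F \<in> H_lower \<alpha> \<longleftrightarrow> (\<exists>f. sq_int Rplus f \<and> (\<forall>z\<in>Cplus. F z = laplace (cesaro \<alpha> f) z))"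
proof
  assume "F \<in> H_lower \<alpha>"
  then obtain h f where h: "sq_int Rplus h" and F: "\<forall>z\<in>Cplus. F z = laplace h z"
    and f: "sq_int Rplus f" and hf: "AE s in Rplus. h s = cesaro \<alpha> f s"
    unfolding H_lower_def T_lower_def by (auto simp: L2_range_iff)
  have "laplace h z = laplace (cesaro \<alpha> f) z" for z
    by (rule laplace_cong_AE[OF h measurable_cesaro(1)[OF f \<alpha>] hf])
  with F f show "\<exists>f. sq_int Rplus f \<and> (\<forall>z\<in>Cplus. F z = laplace (cesaro \<alpha> f) z)" by auto
next
  assume "\<exists>f. sq_int Rplus f \<and> (\<forall>z\<in>Cplus. F z = laplace (cesaro \<alpha> f) z)"
  thus "F \<in> H_lower \<alpha>" unfolding H_lower_def using cesaro_in_T_lower[OF _ \<alpha>] by blast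
qed

lemma H_upper_iff:
  assumes \<alpha>: "0 < \<alpha>"
  shows "F \<in> H_upper \<alpha> \<longleftrightarrow> (\<exists>f. sq_int Rplus f \<and> (\<forall>z\<in>Cplus. F z = laplace (cesaro \<alpha> f) z))"
proof
  assume "F \<in> H_upper \<alpha>"
  then obtain G where G: "G \<in> hardy" and F: "\<forall>z\<in>Cplus. F z = hardy_cesaro_adj \<alpha> G z"
    by (auto simp: H_upper_def)
  obtain g where "sq_int Rplus g" "\<And>z. z \<in> Cplus \<Longrightarrow> G z = laplace g z"
    using hardy_is_laplace[OF G] by blast
  with F show "\<exists>f. sq_int Rplus f \<and> (\<forall>z\<in>Cplus. F z = laplace (cesaro \<alpha> f) z)"
    using hardy_cesaro_adj_laplace[OF _ \<alpha>] by metis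
next
  assume "\<exists>f. sq_int Rplus f \<and> (\<forall>z\<in>Cplus. F z = laplace (cesaro \<alpha> f) z)"
  then obtain f where f: "sq_int Rplus f" "\<forall>z\<in>Cplus. F z = laplace (cesaro \<alpha> f) z" by blast
  have "laplace f \<in> hardy" by (rule hardy_laplace(1)[OF f(1)]) simp
  moreover have "\<forall>z\<in>Cplus. F z = hardy_cesaro_adj \<alpha> (laplace f) z"
    using f hardy_cesaro_adj_laplace[OF f(1) \<alpha>] by simp
  ultimately show "F \<in> H_upper \<alpha>" by (auto simp: H_upper_def)
qed

text \<open>Two choices are involved, the inverse transform and the Cesaro preimage. Injectivity of
  both maps determines the result almost everywhere, and the pairing ignores null sets.\<close>

lemma H_lower_inner_eq:
  assumes \<alpha>: "0 < \<alpha>" and f: "sq_int Rplus f" and g: "sq_int Rplus g"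
    and F: "\<And>z. z \<in> Cplus \<Longrightarrow> F z = laplace (cesaro \<alpha> f) z"
    and G: "\<And>z. z \<in> Cplus \<Longrightarrow> G z = laplace (cesaro \<alpha> g) z"
  shows "H_lower_inner \<alpha> F G = of_real ((Gamma (\<alpha> + 1))\<^sup>2) * inner2 Rplus f g"
proof -
  have inv: "sq_int Rplus (L2_inv (cesaro \<alpha>) (laplace_inv \<alpha> F)) \<and> (AE t in Rplus. L2_inv (cesaro \<alpha>) (laplace_inv \<alpha> F) t = f t)"
    if f: "sq_int Rplus f" and F: "\<And>z. z \<in> Cplus \<Longrightarrow> F z = laplace (cesaro \<alpha> f) z" for f F
  proof -
    have "\<exists>h. h \<in> T_lower \<alpha> \<and> (\<forall>z\<in>Cplus. F z = laplace h z)"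
      using cesaro_in_T_lower[OF f \<alpha>] F by blast
    hence "laplace_inv \<alpha> F \<in> T_lower \<alpha> \<and> (\<forall>z\<in>Cplus. F z = laplace (laplace_inv \<alpha> F) z)"
      unfolding laplace_inv_def by (rule someI_ex)
    hence h: "laplace_inv \<alpha> F \<in> T_lower \<alpha>" "\<forall>z\<in>Cplus. F z = laplace (laplace_inv \<alpha> F) z" by blast+
    let ?h = "laplace_inv \<alpha> F" and ?p = "L2_inv (cesaro \<alpha>) (laplace_inv \<alpha> F)"
    have sh: "sq_int Rplus ?h" using h(1) by (simp add: T_lower_def L2_range_iff)
    have p: "sq_int Rplus ?p" "AE s in Rplus. ?h s = cesaro \<alpha> ?p s"
      using L2_inv_range h(1) by (auto simp: T_lower_def)
    have "laplace (cesaro \<alpha> ?p) z = laplace (cesaro \<alpha> f) z" if "z \<in> Cplus" for z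
      using laplace_cong_AE[OF sh measurable_cesaro(1)[OF p(1) \<alpha>] p(2), of z] h(2) F that by simp
    from laplace_cesaro_eq_imp_AE[OF p(1) f \<alpha> this] p(1) show ?thesis by simp
  qed
  show ?thesis
    unfolding H_lower_inner_def T_lower_inner_def L2_inner_eq scaleR_conv_of_real
    using inv[OF f F] inv[OF g G] f g
    by (intro arg_cong2[where f = "(*)"] refl inner2_cong_AE) (auto simp: sq_int_def)
qed

lemma H_upper_norm_eq:
  assumes \<alpha>: "0 < \<alpha>" and f: "sq_int Rplus f" and F: "\<And>z. z \<in> Cplus \<Longrightarrow> F z = laplace (cesaro \<alpha> f) z"
  shows "H_upper_norm \<alpha> F = Gamma (\<alpha> + 1) * norm2 Rplus f"
proof -
  let ?G = "hardy_cesaro_adj_inv \<alpha> F"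
  have "\<exists>G. G \<in> hardy \<and> (\<forall>z\<in>Cplus. F z = hardy_cesaro_adj \<alpha> G z)"
    using H_upper_iff[OF \<alpha>, of F] f F by (auto simp: H_upper_def)
  hence "?G \<in> hardy \<and> (\<forall>z\<in>Cplus. F z = hardy_cesaro_adj \<alpha> ?G z)"
    unfolding hardy_cesaro_adj_inv_def by (rule someI_ex)
  hence G: "?G \<in> hardy" "\<forall>z\<in>Cplus. F z = hardy_cesaro_adj \<alpha> ?G z" by blast+
  obtain g where g: "sq_int Rplus g" and Gg: "\<And>z. z \<in> Cplus \<Longrightarrow> ?G z = laplace g z"
    using hardy_is_laplace[OF G(1)] by blast
  have "laplace (cesaro \<alpha> g) z = laplace (cesaro \<alpha> f) z" if z: "z \<in> Cplus" for z
    using hardy_cesaro_adj_laplace[OF g \<alpha> Gg z] G(2) F z by simp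
  hence "AE t in Rplus. g t = f t" by (rule laplace_cesaro_eq_imp_AE[OF g f \<alpha>])
  hence "norm2 Rplus g = norm2 Rplus f" using f g by (intro norm2_cong_AE) (auto simp: sq_int_def)
  thus ?thesis using hardy_laplace(2)[OF g Gg] by (simp add: H_upper_norm_def)
qed

text \<open>Weighted by the powers of \<open>\<i>\<close>, the squared norms cancel, as does the
  conjugate pairing, whose factors alternate in sign; four copies of the pairing remain.\<close>

lemma inner2_polarization:
  assumes f: "sq_int M f" and g: "sq_int M g"
  shows "(\<Sum>k<4. \<i> ^ k * complex_of_real ((norm2 M (\<lambda>t. f t + \<i> ^ k * g t))\<^sup>2)) / 4 = inner2 M f g"
proof -
  have "(norm2 M (\<lambda>t. f t + c * g t))\<^sup>2
      = (norm2 M f)\<^sup>2 + 2 * Re (cnj c * inner2 M f g) + (cmod c * norm2 M g)\<^sup>2" for c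
    using norm2_add_power2[OF f sq_int_scale[OF g]] by (simp only: inner2_scale_right norm2_scale)
  thus ?thesis
    by (simp add: numeral_eq_Suc complex_eq_iff)
qed

lemma H_upper_inner_eq:
  assumes \<alpha>: "0 < \<alpha>" and f: "sq_int Rplus f" and g: "sq_int Rplus g"
    and F: "\<And>z. z \<in> Cplus \<Longrightarrow> F z = laplace (cesaro \<alpha> f) z"
    and G: "\<And>z. z \<in> Cplus \<Longrightarrow> G z = laplace (cesaro \<alpha> g) z"
  shows "H_upper_inner \<alpha> F G = of_real ((Gamma (\<alpha> + 1))\<^sup>2) * inner2 Rplus f g"
proof -
  have N: "H_upper_norm \<alpha> (\<lambda>z. F z + c * G z) = Gamma (\<alpha> + 1) * norm2 Rplus (\<lambda>t. f t + c * g t)" for c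
    by (rule H_upper_norm_eq[OF \<alpha> sq_int_add(1)[OF f sq_int_scale[OF g]]])
       (simp add: F G laplace_cesaro_linear[OF f g \<alpha>])
  have "H_upper_inner \<alpha> F G
      = of_real ((Gamma (\<alpha> + 1))\<^sup>2) * ((\<Sum>k<4. \<i> ^ k * complex_of_real ((norm2 Rplus (\<lambda>t. f t + \<i> ^ k * g t))\<^sup>2)) / 4)"
    unfolding H_upper_inner_def polarization_def N
    by (simp add: sum_distrib_left power_mult_distrib mult.left_commute)
  thus ?thesis by (simp only: inner2_polarization[OF f g])
qed

section \<open>Reproducing kernels\<close>

lemma H_lower_kernel_exists:
  assumes \<alpha>: "0 < \<alpha>"
  shows "\<exists>R. reproducing_kernel (H_lower \<alpha>) (H_lower_inner \<alpha>) R"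
proof -
  define e where "e w t = exp (- (cnj w * of_real t))" for w t
  \<comment> \<open>Found by moving \<open>cesaro\<close> across the pairing of
    \<open>cesaro \<alpha> f\<close> with \<open>e w\<close>; the constant cancels the squared Gamma
    factor of the inner product.\<close>
  define k where "k w t = of_real (1 / (Gamma (\<alpha> + 1))\<^sup>2) * cesaro_adj \<alpha> (e w) t" for w t
  have "0 < Gamma (\<alpha> + 1)" by (rule Gamma_real_pos) (use \<alpha> in simp)
  hence G0: "Gamma (\<alpha> + 1) \<noteq> 0" by linarith
  have "reproducing_kernel (H_lower \<alpha>) (H_lower_inner \<alpha>) (\<lambda>z w. laplace (cesaro \<alpha> (k w)) z)"
    unfolding reproducing_kernel_def
  proof (intro ballI conjI)
    fix w assume w: "w \<in> Cplus"
    have e: "sq_int Rplus (e w)"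
      unfolding e_def[abs_def] by (rule sq_int_exp) (use w in \<open>simp add: Cplus_def\<close>)
    have k: "sq_int Rplus (k w)"
      unfolding k_def[abs_def] by (intro sq_int_scale sq_int_cesaro e \<alpha>)
    show "(\<lambda>z. laplace (cesaro \<alpha> (k w)) z) \<in> H_lower \<alpha>" using k by (auto simp: H_lower_iff[OF \<alpha>])
    fix F assume "F \<in> H_lower \<alpha>"
    then obtain f where f: "sq_int Rplus f" and F: "\<And>z. z \<in> Cplus \<Longrightarrow> F z = laplace (cesaro \<alpha> f) z"
      unfolding H_lower_iff[OF \<alpha>] by blast
    have "F w = inner2 Rplus (cesaro \<alpha> f) (e w)"
      by (simp add: F[OF w] laplace_eq_inner2 e_def[abs_def])
    also have "\<dots> = inner2 Rplus f (cesaro_adj \<alpha> (e w))" by (rule cesaro_adjoint[OF f e \<alpha>])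
    also have "\<dots> = of_real ((Gamma (\<alpha> + 1))\<^sup>2) * inner2 Rplus f (k w)"
      unfolding k_def[abs_def] inner2_scale_right using G0 by simp
    also have "\<dots> = H_lower_inner \<alpha> F (\<lambda>z. laplace (cesaro \<alpha> (k w)) z)"
      by (rule H_lower_inner_eq[OF \<alpha> f k F refl, symmetric])
    finally show "F w = H_lower_inner \<alpha> F (\<lambda>z. laplace (cesaro \<alpha> (k w)) z)" .
  qed
  thus ?thesis by blast
qed

text \<open>The pairing of the section of \<open>R\<close> at \<open>w\<close> with the section of
  \<open>K\<close> at \<open>z\<close> is evaluated by either kernel, and the same is done with two
  sections of \<open>K\<close>. Hermitian symmetry connects the results.\<close>

lemma reproducing_kernel_unique:
  assumes R: "reproducing_kernel H ip R" and K: "reproducing_kernel H ip K"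
    and herm: "\<And>F G. F \<in> H \<Longrightarrow> G \<in> H \<Longrightarrow> ip F G = cnj (ip G F)"
    and z: "z \<in> Cplus" and w: "w \<in> Cplus"
  shows "R z w = K z w"
proof -
  have RH: "(\<lambda>x. R x w) \<in> H" and KH: "(\<lambda>x. K x z) \<in> H" "(\<lambda>x. K x w) \<in> H"
    and Rw: "\<And>F. F \<in> H \<Longrightarrow> F w = ip F (\<lambda>x. R x w)"
    and Kz: "\<And>F. F \<in> H \<Longrightarrow> F z = ip F (\<lambda>x. K x z)"
    and Kw: "\<And>F. F \<in> H \<Longrightarrow> F w = ip F (\<lambda>x. K x w)"
    using R K z w by (auto simp: reproducing_kernel_def)
  have "R z w = cnj (K w z)"
    using Kz[OF RH] Rw[OF KH(1)] herm[OF RH KH(1)] by simp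
  also have "\<dots> = K z w"
    using Kz[OF KH(2)] Kw[OF KH(1)] herm[OF KH(2,1)] by simp
  finally show ?thesis .
qed

theorem mainTheorem6:
  fixes \<alpha> :: real
  assumes "0 < \<alpha>"
  shows "(\<exists>R. reproducing_kernel (H_lower \<alpha>) (H_lower_inner \<alpha>) R) \<and>
         (\<exists>K. reproducing_kernel (H_upper \<alpha>) (H_upper_inner \<alpha>) K) \<and>
         (\<forall>R K. reproducing_kernel (H_lower \<alpha>) (H_lower_inner \<alpha>) R \<longrightarrow>
                reproducing_kernel (H_upper \<alpha>) (H_upper_inner \<alpha>) K \<longrightarrow>
                (\<forall>z\<in>Cplus. \<forall>w\<in>Cplus. R z w = K z w)) \<and>
         H_lower \<alpha> = H_upper \<alpha> \<and>
         (\<forall>F\<in>H_lower \<alpha>. \<forall>G\<in>H_lower \<alpha>. H_lower_inner \<alpha> F G = H_upper_inner \<alpha> F G) \<and>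
         T_upper \<alpha> = T_lower \<alpha> \<and>
         (\<exists>c>0. \<exists>C>0. \<forall>f\<in>T_lower \<alpha>.
            c * T_lower_norm \<alpha> f \<le> T_upper_norm \<alpha> f \<and>
            T_upper_norm \<alpha> f \<le> C * T_lower_norm \<alpha> f)"
proof -
  have H: "H_lower \<alpha> = H_upper \<alpha>"
    by (auto simp: H_lower_iff[OF assms] H_upper_iff[OF assms])
  have ip: "H_lower_inner \<alpha> F G = H_upper_inner \<alpha> F G \<and> H_lower_inner \<alpha> F G = cnj (H_lower_inner \<alpha> G F)"
    if FG: "F \<in> H_lower \<alpha>" "G \<in> H_lower \<alpha>" for F G
  proof -
    from FG obtain f g where f: "sq_int Rplus f" "\<And>z. z \<in> Cplus \<Longrightarrow> F z = laplace (cesaro \<alpha> f) z"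
      and g: "sq_int Rplus g" "\<And>z. z \<in> Cplus \<Longrightarrow> G z = laplace (cesaro \<alpha> g) z"
      unfolding H_lower_iff[OF assms] by blast
    have fg: "H_lower_inner \<alpha> F G = of_real ((Gamma (\<alpha> + 1))\<^sup>2) * inner2 Rplus f g"
      by (rule H_lower_inner_eq[OF assms f(1) g(1) f(2) g(2)])
    have gf: "H_lower_inner \<alpha> G F = of_real ((Gamma (\<alpha> + 1))\<^sup>2) * inner2 Rplus g f"
      by (rule H_lower_inner_eq[OF assms g(1) f(1) g(2) f(2)])
    have "H_upper_inner \<alpha> F G = of_real ((Gamma (\<alpha> + 1))\<^sup>2) * inner2 Rplus f g"
      by (rule H_upper_inner_eq[OF assms f(1) g(1) f(2) g(2)])
    moreover have "H_lower_inner \<alpha> F G = cnj (H_lower_inner \<alpha> G F)"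
      unfolding fg gf complex_cnj_mult complex_cnj_complex_of_real inner2_commute[of Rplus f g] ..
    ultimately show ?thesis using fg by simp
  qed
  \<comment> \<open>The reproducing property evaluates the inner product on members of the space
    only, where the two inner products agree.\<close>
  have kernel: "reproducing_kernel (H_upper \<alpha>) (H_upper_inner \<alpha>) K \<longleftrightarrow> reproducing_kernel (H_lower \<alpha>) (H_lower_inner \<alpha>) K" for K
    unfolding reproducing_kernel_def H[symmetric] using ip by auto
  show ?thesis
  proof (intro conjI)
    show ex: "\<exists>R. reproducing_kernel (H_lower \<alpha>) (H_lower_inner \<alpha>) R" by (rule H_lower_kernel_exists[OF assms])
    show "\<exists>K. reproducing_kernel (H_upper \<alpha>) (H_upper_inner \<alpha>) K" unfolding kernel by (rule ex)
    show "\<forall>R K. reproducing_kernel (H_lower \<alpha>) (H_lower_inner \<alpha>) R \<longrightarrow>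
                reproducing_kernel (H_upper \<alpha>) (H_upper_inner \<alpha>) K \<longrightarrow>
                (\<forall>z\<in>Cplus. \<forall>w\<in>Cplus. R z w = K z w)"
      unfolding kernel using reproducing_kernel_unique[where H = "H_lower \<alpha>" and ip = "H_lower_inner \<alpha>"] ip by blast
    show "H_lower \<alpha> = H_upper \<alpha>" by (rule H)
    show "\<forall>F\<in>H_lower \<alpha>. \<forall>G\<in>H_lower \<alpha>. H_lower_inner \<alpha> F G = H_upper_inner \<alpha> F G" using ip by blast
    show "T_upper \<alpha> = T_lower \<alpha>" by (rule T_upper_eq_T_lower[OF assms])
    show "\<exists>c>0. \<exists>C>0. \<forall>f\<in>T_lower \<alpha>. c * T_lower_norm \<alpha> f \<le> T_upper_norm \<alpha> f \<and> T_upper_norm \<alpha> f \<le> C * T_lower_norm \<alpha> f"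
      \<comment> \<open>The norms are not merely equivalent but equal, so both constants are
        \<open>1\<close>.\<close>
      by (intro exI[of _ 1] conjI) (auto simp: T_norms_eq[OF assms])
  qed
qed

end
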